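(* If $\mathbb{X}$ is a Cartesian category, then $\mathbf{Fa\grave{a}}(\mathbb{X})$ is a generalized Cartesian differential category, with $$D[f] = [\delta(f)]_1$$ for each map $f$ of $\mathbf{Fa\grave{a}}(\mathbb{X})$, and with $L((A,+,0),X)$ being the first component of $\delta((A,+,0),X)$, i.e. the commutative monoid $\big(((A,+,0),A),(+,\pi_0+,0,\ldots),(0,\pi_00,0,\ldots)\big)$ in $\mathbf{Fa\grave{a}}(\mathbb{X})$.
   Context: Composition is diagrammatic: $fg$ means first $f$, then $g$. A Cartesian category is a category with chosen finite products (including a chosen terminal object $1$). For a commutative monoid $(A,+,0)$ in a Cartesian category and maps $f,g:X\to A$, $f+g := \langle f,g\rangle +$ and $0: X\to A$ denotes $!\,0$. In $A^n\times X$, $\pi_0,\ldots,\pi_{n-1}$ are the projections to the copies of $A$ and $\pi_n$ the projection to $X$. We write $h(z_1,\ldots,z_k)$ for $\langle z_1,\ldots,z_k\rangle h$. A generalized Cartesian differential category is a Cartesian category $\mathbb{Y}$ with: for each object $X$, a commutative monoid $L(X)=(L_0(X),+_X,0_X)$ in $\mathbb{Y}$ with $L(L_0(X))=L(X)$, $L(X\times Y)=L(X)\times L(Y)$ (product monoid) and $L(1)=1$; and for each map $f:X\to Y$ a map $D[f]:L_0(X)\times X\to L_0(Y)$ such that (for all well-typed maps): [CD.1] $D[+_X]=\pi_0+_X$, $D[0_X]=\pi_0 0_X$; [CD.2] $\langle a+b,c\rangle D[f]=\langle a,c\rangle D[f]+\langle b,c\rangle D[f]$ and $\langle 0,a\rangle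 D[f]=0$; [CD.3] $D[\pi_0]=\pi_0\pi_0$ and $D[\pi_1]=\pi_0\pi_1$; [CD.4] $D[\langle f,g\rangle]=\langle D[f],D[g]\rangle$; [CD.5] $D[fg]=\langle D[f],\pi_1f\rangle D[g]$; [CD.6] $\langle\langle a,0\rangle,\langle c,d\rangle\rangle D[D[f]]=\langle a,d\rangle D[f]$; [CD.7] $\langle\langle 0,b\rangle,\langle c,d\rangle\rangle D[D[f]]=\langle\langle 0,c\rangle,\langle b,d\rangle\rangle D[D[f]]$. The category $\mathbf{Fa\grave{a}}(\mathbb{X})$. Objects: pairs $((A,+,0),X)$, abbreviated $(A,X)$, with $(A,+,0)$ a commutative monoid in $\mathbb{X}$ and $X$ an object of $\mathbb{X}$. A morphism $(A,X)\to(B,Y)$ is a sequence $f=(f_*,f_1,f_2,\ldots)$ with $f_*: X\to Y$ a map of $\mathbb{X}$ and, for $n\ge 1$, $f_n: A^n\times X\to B$ a map that is symmetric in its first $n$ arguments and additive (preserves $+$ and $0$) in each of them. Identities: $(1_X,\pi_0,0,0,\ldots)$. Composition of $f:(A,X)\to(B,Y)$ and $g:(B,Y)\to(C,Z)$: $(fg)_*=f_*g_*$ and $$(fg)_n(a_1,\ldots,a_n,x)=\sum_{\{B_1,\ldots,B_k\}} g_k\big(f_{|B_1|}(a_{B_1},x),\ldots,f_{|B_k|}(a_{B_k},x),f_*(x)\big),$$ the sum being over all partitions of $\{1,\ldots,n\}$ into nonempty blocks, with $f_m(a_{B},x)=f_m(a_{i_1},\ldots,a_{i_m},x)$ for $B=\{i_1<\cdots<i_m\}$,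 and $a_1,\ldots,a_n,x$ the projections from $A^n\times X$. Chosen products: $(A,X)\times(B,Y)=(A\times B, X\times Y)$ with the product monoid structure on $A\times B$, and projections $(\pi_i,\pi_0\pi_i,0,0,\ldots)$, $i=0,1$; the terminal object is $(1,1)$. The map $[\delta(f)]_1$. For $f:(A,X)\to(B,Y)$, $[\delta(f)]_1:(A,A)\times(A,X)=(A\times A,A\times X)\to(B,B)$ is the map of $\mathbf{Fa\grave{a}}(\mathbb{X})$ with $([\delta(f)]_1)_*=f_1$ and, for $r\ge1$, writing the variables of $(A\times A)^r\times(A\times X)$ as $(v^1,w^1),\ldots,(v^r,w^r),(a,x)$, $$([\delta(f)]_1)_r=f_{r+1}(a,w^1,\ldots,w^r,x)+\sum_{j=1}^r f_r\big(v^j,w^1,\ldots,\widehat{w^j},\ldots,w^r,x\big),$$ where $\widehat{w^j}$ means $w^j$ is omitted. *)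

theory Defs
  imports
    "HOL-Algebra.FiniteProduct"
    "HOL-Library.Disjoint_Sets"
    "HOL-Combinatorics.Permutations"
begin

section \<open>Categories with chosen finite products\<close>

text \<open>
  Objects and maps are elements of carrier sets.  Composition is diagrammatic: \<open>f \<Zcomp> g\<close> is
  first \<open>f\<close>, then \<open>g\<close>.  The chosen structure consists of a terminal object and, for each
  pair of objects, a product with its two projections.
\<close>

record ('o, 'm) cart =
  Obj :: "'o set"
  Arr :: "'m set"
  Dom :: "'m \<Rightarrow> 'o"
  Cod :: "'m \<Rightarrow> 'o"
  Id :: "'o \<Rightarrow> 'm"
  Comp :: "'m \<Rightarrow> 'm \<Rightarrow> 'm" (infixl "\<Zcomp>\<index>" 70)
  Prod :: "'o \<Rightarrow> 'o \<Rightarrow> 'o" (infixr "\<star>\<index>" 75)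
  Proj0 :: "'o \<Rightarrow> 'o \<Rightarrow> 'm"
  Proj1 :: "'o \<Rightarrow> 'o \<Rightarrow> 'm"
  One :: "'o"

definition Hom :: "('o, 'm) cart \<Rightarrow> 'o \<Rightarrow> 'o \<Rightarrow> 'm set" where
  "Hom C X Y = {f \<in> Arr C. Dom C f = X \<and> Cod C f = Y}"

locale category =
  fixes C :: "('o, 'm) cart" (structure)
  assumes Dom_Obj: "f \<in> Arr C \<Longrightarrow> Dom C f \<in> Obj C"
    and Cod_Obj: "f \<in> Arr C \<Longrightarrow> Cod C f \<in> Obj C"
    and Id_Hom: "X \<in> Obj C \<Longrightarrow> Id C X \<in> Hom C X X"
    and Comp_Hom: "f \<in> Hom C X Y \<Longrightarrow> g \<in> Hom C Y Z \<Longrightarrow> f \<Zcomp> g \<in> Hom C X Z"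
    and Id_Comp: "f \<in> Hom C X Y \<Longrightarrow> Id C X \<Zcomp> f = f"
    and Comp_Id: "f \<in> Hom C X Y \<Longrightarrow> f \<Zcomp> Id C Y = f"
    and Comp_assoc: "f \<in> Hom C W X \<Longrightarrow> g \<in> Hom C X Y \<Longrightarrow> h \<in> Hom C Y Z \<Longrightarrow>
      (f \<Zcomp> g) \<Zcomp> h = f \<Zcomp> (g \<Zcomp> h)"

locale cartesian_category = category C for C :: "('o, 'm) cart" (structure) +
  assumes One_Obj: "One C \<in> Obj C"
    and One_terminal: "X \<in> Obj C \<Longrightarrow> \<exists>!f. f \<in> Hom C X (One C)"
    and Prod_Obj: "X \<in> Obj C \<Longrightarrow> Y \<in> Obj C \<Longrightarrow> X \<star> Y \<in> Obj C"
    and Proj0_Hom: "X \<in> Obj C \<Longrightarrow> Y \<in> Obj C \<Longrightarrow> Proj0 C X Y \<in> Hom C (X \<star> Y) X"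
    and Proj1_Hom: "X \<in> Obj C \<Longrightarrow> Y \<in> Obj C \<Longrightarrow> Proj1 C X Y \<in> Hom C (X \<star> Y) Y"
    and Prod_universal: "f \<in> Hom C W X \<Longrightarrow> g \<in> Hom C W Y \<Longrightarrow>
      \<exists>!h. h \<in> Hom C W (X \<star> Y) \<and> h \<Zcomp> Proj0 C X Y = f \<and> h \<Zcomp> Proj1 C X Y = g"

definition bang :: "('o, 'm) cart \<Rightarrow> 'o \<Rightarrow> 'm" where
  "bang C X = (THE f. f \<in> Hom C X (One C))"

definition pair :: "('o, 'm) cart \<Rightarrow> 'm \<Rightarrow> 'm \<Rightarrow> 'm" ("\<langle>_,/ _\<rangle>\<index>") where
  "\<langle>f, g\<rangle>\<^bsub>C\<^esub> = (THE h. h \<in> Hom C (Dom C f) (Cod C f \<star>\<^bsub>C\<^esub> Cod C g) \<and>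
     h \<Zcomp>\<^bsub>C\<^esub> Proj0 C (Cod C f) (Cod C g) = f \<and> h \<Zcomp>\<^bsub>C\<^esub> Proj1 C (Cod C f) (Cod C g) = g)"


section \<open>Commutative monoids in a Cartesian category\<close>

datatype ('o, 'm) cmon = CMon (mobj: 'o) (madd: 'm) (mzero: 'm)

definition plus_map :: "('o, 'm) cart \<Rightarrow> ('o, 'm) cmon \<Rightarrow> 'm \<Rightarrow> 'm \<Rightarrow> 'm" where
  "plus_map C M f g = \<langle>f, g\<rangle>\<^bsub>C\<^esub> \<Zcomp>\<^bsub>C\<^esub> madd M"

definition zero_map :: "('o, 'm) cart \<Rightarrow> ('o, 'm) cmon \<Rightarrow> 'o \<Rightarrow> 'm" where
  "zero_map C M X = bang C X \<Zcomp>\<^bsub>C\<^esub> mzero M"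

definition comm_monoid_in :: "('o, 'm) cart \<Rightarrow> ('o, 'm) cmon \<Rightarrow> bool" where
  "comm_monoid_in C M \<longleftrightarrow>
    (let A = mobj M; p0 = Proj0 C A A; p1 = Proj1 C A A;
         q0 = Proj0 C (A \<star>\<^bsub>C\<^esub> A) A; q1 = Proj1 C (A \<star>\<^bsub>C\<^esub> A) A
     in A \<in> Obj C \<and> madd M \<in> Hom C (A \<star>\<^bsub>C\<^esub> A) A \<and> mzero M \<in> Hom C (One C) A \<and>
        plus_map C M (plus_map C M (q0 \<Zcomp>\<^bsub>C\<^esub> p0) (q0 \<Zcomp>\<^bsub>C\<^esub> p1)) q1
          = plus_map C M (q0 \<Zcomp>\<^bsub>C\<^esub> p0) (plus_map C M (q0 \<Zcomp>\<^bsub>C\<^esub> p1) q1) \<and>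
        plus_map C M p1 p0 = madd M \<and>
        plus_map C M (zero_map C M A) (Id C A) = Id C A \<and>
        plus_map C M (Id C A) (zero_map C M A) = Id C A)"

definition prod_cmon :: "('o, 'm) cart \<Rightarrow> ('o, 'm) cmon \<Rightarrow> ('o, 'm) cmon \<Rightarrow> ('o, 'm) cmon" where
  "prod_cmon C M N =
    (let A = mobj M; B = mobj N;
         p0 = Proj0 C (A \<star>\<^bsub>C\<^esub> B) (A \<star>\<^bsub>C\<^esub> B); p1 = Proj1 C (A \<star>\<^bsub>C\<^esub> B) (A \<star>\<^bsub>C\<^esub> B);
         a = Proj0 C A B; b = Proj1 C A B
     in CMon (A \<star>\<^bsub>C\<^esub> B)
          \<langle>plus_map C M (p0 \<Zcomp>\<^bsub>C\<^esub> a) (p1 \<Zcomp>\<^bsub>C\<^esub> a), plus_map C N (p0 \<Zcomp>\<^bsub>C\<^esub> b) (p1 \<Zcomp>\<^bsub>C\<^esub> b)\<rangle>\<^bsub>C\<^esub>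
          \<langle>mzero M, mzero N\<rangle>\<^bsub>C\<^esub>)"

definition one_cmon :: "('o, 'm) cart \<Rightarrow> ('o, 'm) cmon" where
  "one_cmon C = CMon (One C) (bang C (One C \<star>\<^bsub>C\<^esub> One C)) (bang C (One C))"

definition hom_monoid :: "('o, 'm) cart \<Rightarrow> ('o, 'm) cmon \<Rightarrow> 'o \<Rightarrow> 'm monoid" where
  "hom_monoid C M X =
    \<lparr>carrier = Hom C X (mobj M), monoid.mult = plus_map C M, one = zero_map C M X\<rparr>"

definition sum_map :: "('o, 'm) cart \<Rightarrow> ('o, 'm) cmon \<Rightarrow> 'o \<Rightarrow> ('i \<Rightarrow> 'm) \<Rightarrow> 'i set \<Rightarrow> 'm" where
  "sum_map C M X f I = finprod (hom_monoid C M X) f I"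


section \<open>Generalized Cartesian differential categories\<close>

locale generalized_cartesian_differential_category =
  cartesian_category C for C :: "('o, 'm) cart" (structure) +
  fixes L :: "'o \<Rightarrow> ('o, 'm) cmon"
    and D :: "'m \<Rightarrow> 'm"
  assumes L_monoid: "X \<in> Obj C \<Longrightarrow> comm_monoid_in C (L X)"
    and L_idem: "X \<in> Obj C \<Longrightarrow> L (mobj (L X)) = L X"
    and L_Prod: "X \<in> Obj C \<Longrightarrow> Y \<in> Obj C \<Longrightarrow> L (X \<star> Y) = prod_cmon C (L X) (L Y)"
    and L_One: "L (One C) = one_cmon C"
    and D_Hom: "f \<in> Hom C X Y \<Longrightarrow> D f \<in> Hom C (mobj (L X) \<star> X) (mobj (L Y))"
    and CD1_add: "X \<in> Obj C \<Longrightarrow>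
      D (madd (L X)) =
        Proj0 C (mobj (L X) \<star> mobj (L X)) (mobj (L X) \<star> mobj (L X)) \<Zcomp> madd (L X)"
    and CD1_zero: "X \<in> Obj C \<Longrightarrow> D (mzero (L X)) = Proj0 C (One C) (One C) \<Zcomp> mzero (L X)"
    and CD2_add: "f \<in> Hom C X Y \<Longrightarrow> a \<in> Hom C W (mobj (L X)) \<Longrightarrow> b \<in> Hom C W (mobj (L X)) \<Longrightarrow>
      c \<in> Hom C W X \<Longrightarrow>
      \<langle>plus_map C (L X) a b, c\<rangle> \<Zcomp> D f = plus_map C (L Y) (\<langle>a, c\<rangle> \<Zcomp> D f) (\<langle>b, c\<rangle> \<Zcomp> D f)"
    and CD2_zero: "f \<in> Hom C X Y \<Longrightarrow> a \<in> Hom C W X \<Longrightarrow>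
      \<langle>zero_map C (L X) W, a\<rangle> \<Zcomp> D f = zero_map C (L Y) W"
    and CD3_0: "X \<in> Obj C \<Longrightarrow> Y \<in> Obj C \<Longrightarrow>
      D (Proj0 C X Y) =
        Proj0 C (mobj (L (X \<star> Y))) (X \<star> Y) \<Zcomp> Proj0 C (mobj (L X)) (mobj (L Y))"
    and CD3_1: "X \<in> Obj C \<Longrightarrow> Y \<in> Obj C \<Longrightarrow>
      D (Proj1 C X Y) =
        Proj0 C (mobj (L (X \<star> Y))) (X \<star> Y) \<Zcomp> Proj1 C (mobj (L X)) (mobj (L Y))"
    and CD4: "f \<in> Hom C X Y \<Longrightarrow> g \<in> Hom C X Z \<Longrightarrow> D \<langle>f, g\<rangle> = \<langle>D f, D g\<rangle>"
    and CD5: "f \<in> Hom C X Y \<Longrightarrow> g \<in> Hom C Y Z \<Longrightarrow>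
      D (f \<Zcomp> g) = \<langle>D f, Proj1 C (mobj (L X)) X \<Zcomp> f\<rangle> \<Zcomp> D g"
    and CD6: "f \<in> Hom C X Y \<Longrightarrow> a \<in> Hom C W (mobj (L X)) \<Longrightarrow> c \<in> Hom C W (mobj (L X)) \<Longrightarrow>
      d \<in> Hom C W X \<Longrightarrow>
      \<langle>\<langle>a, zero_map C (L X) W\<rangle>, \<langle>c, d\<rangle>\<rangle> \<Zcomp> D (D f) = \<langle>a, d\<rangle> \<Zcomp> D f"
    and CD7: "f \<in> Hom C X Y \<Longrightarrow> b \<in> Hom C W (mobj (L X)) \<Longrightarrow> c \<in> Hom C W (mobj (L X)) \<Longrightarrow>
      d \<in> Hom C W X \<Longrightarrow>
      \<langle>\<langle>zero_map C (L X) W, b\<rangle>, \<langle>c, d\<rangle>\<rangle> \<Zcomp> D (D f) =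
        \<langle>\<langle>zero_map C (L X) W, c\<rangle>, \<langle>b, d\<rangle>\<rangle> \<Zcomp> D (D f)"


section \<open>The products \<open>A\<^sup>n \<times> X\<close>\<close>

text \<open>
  \<open>A\<^sup>n \<times> X\<close> is the right-nested product \<open>A \<times> (A \<times> (\<dots> \<times> X))\<close>, so that \<open>A\<^sup>0 \<times> X\<close> is \<open>X\<close> and
  \<open>A\<^sup>1 \<times> X\<close> is the binary product \<open>A \<times> X\<close>; the tuple \<open>\<langle>z\<^sub>0, \<dots>, z\<^sub>n\<^sub>-\<^sub>1, x\<rangle>\<close> is nested accordingly.
  The last index \<open>n\<close> gives the projection to \<open>X\<close>.
\<close>

primrec pow_prod :: "('o, 'm) cart \<Rightarrow> 'o \<Rightarrow> nat \<Rightarrow> 'o \<Rightarrow> 'o" where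
  "pow_prod C A 0 X = X"
| "pow_prod C A (Suc n) X = A \<star>\<^bsub>C\<^esub> pow_prod C A n X"

primrec proj :: "('o, 'm) cart \<Rightarrow> 'o \<Rightarrow> nat \<Rightarrow> 'o \<Rightarrow> nat \<Rightarrow> 'm" where
  "proj C A 0 X i = Id C X"
| "proj C A (Suc n) X i =
    (case i of
       0 \<Rightarrow> Proj0 C A (pow_prod C A n X)
     | Suc j \<Rightarrow> Proj1 C A (pow_prod C A n X) \<Zcomp>\<^bsub>C\<^esub> proj C A n X j)"

text \<open>\<open>apply_map C h zs x\<close> is \<open>h(z\<^sub>0, \<dots>, z\<^sub>n\<^sub>-\<^sub>1, x)\<close>.\<close>

definition apply_map :: "('o, 'm) cart \<Rightarrow> 'm \<Rightarrow> 'm list \<Rightarrow> 'm \<Rightarrow> 'm" where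
  "apply_map C h zs x = foldr (pair C) zs x \<Zcomp>\<^bsub>C\<^esub> h"

definition symmetric_map :: "('o, 'm) cart \<Rightarrow> 'm \<Rightarrow> 'o \<Rightarrow> nat \<Rightarrow> 'o \<Rightarrow> bool" where
  "symmetric_map C h A n X \<longleftrightarrow>
    (\<forall>\<sigma>. \<sigma> permutes {..<n} \<longrightarrow>
      apply_map C h (map (\<lambda>i. proj C A n X (\<sigma> i)) [0..<n]) (proj C A n X n) = h)"

text \<open>
  Additivity in each of the first \<open>n\<close> arguments, stated for generalized elements
  \<open>z\<^sub>i, a, b : W \<rightarrow> A\<close> and \<open>x : W \<rightarrow> X\<close>.
\<close>

definition additive_map ::
    "('o, 'm) cart \<Rightarrow> 'm \<Rightarrow> ('o, 'm) cmon \<Rightarrow> nat \<Rightarrow> 'o \<Rightarrow> ('o, 'm) cmon \<Rightarrow> bool" where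
  "additive_map C h M n X N \<longleftrightarrow>
    (\<forall>W\<in>Obj C. \<forall>zs x. length zs = n \<and> set zs \<subseteq> Hom C W (mobj M) \<and> x \<in> Hom C W X \<longrightarrow>
      (\<forall>i<n.
        (\<forall>a\<in>Hom C W (mobj M). \<forall>b\<in>Hom C W (mobj M).
          apply_map C h (zs[i := plus_map C M a b]) x =
            plus_map C N (apply_map C h (zs[i := a]) x) (apply_map C h (zs[i := b]) x)) \<and>
        apply_map C h (zs[i := zero_map C M W]) x = zero_map C N W))"


section \<open>The Faa di Bruno category\<close>

text \<open>
  A map is a sequence \<open>(f\<^sub>*, f\<^sub>1, f\<^sub>2, \<dots>)\<close> together with its domain and codomain; the coefficient
  with index \<open>0\<close> is \<open>f\<^sub>*\<close>.
\<close>

type_synonym ('o, 'm) faa_obj = "('o, 'm) cmon \<times> 'o"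

datatype ('o, 'm) faa_map =
  FaaMap (fdom: "('o, 'm) faa_obj") (fcod: "('o, 'm) faa_obj") (coeff: "nat \<Rightarrow> 'm")

definition is_faa_obj :: "('o, 'm) cart \<Rightarrow> ('o, 'm) faa_obj \<Rightarrow> bool" where
  "is_faa_obj C P \<longleftrightarrow> comm_monoid_in C (fst P) \<and> snd P \<in> Obj C"

definition is_faa_map :: "('o, 'm) cart \<Rightarrow> ('o, 'm) faa_map \<Rightarrow> bool" where
  "is_faa_map C f \<longleftrightarrow>
    (case (fdom f, fcod f) of ((M, X), (N, Y)) \<Rightarrow>
      is_faa_obj C (M, X) \<and> is_faa_obj C (N, Y) \<and>
      coeff f 0 \<in> Hom C X Y \<and>
      (\<forall>n\<ge>1. coeff f n \<in> Hom C (pow_prod C (mobj M) n X) (mobj N) \<and>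
             symmetric_map C (coeff f n) (mobj M) n X \<and>
             additive_map C (coeff f n) M n X N))"

definition linear_faa ::
    "('o, 'm) cart \<Rightarrow> ('o, 'm) faa_obj \<Rightarrow> ('o, 'm) faa_obj \<Rightarrow> 'm \<Rightarrow> 'm \<Rightarrow> ('o, 'm) faa_map" where
  "linear_faa C P Q g0 g1 = FaaMap P Q (\<lambda>n.
     if n = 0 then g0 else if n = 1 then g1
     else zero_map C (fst Q) (pow_prod C (mobj (fst P)) n (snd P)))"

definition faa_id :: "('o, 'm) cart \<Rightarrow> ('o, 'm) faa_obj \<Rightarrow> ('o, 'm) faa_map" where
  "faa_id C P = linear_faa C P P (Id C (snd P)) (Proj0 C (mobj (fst P)) (snd P))"

text \<open>
  Partitions of the index set \<open>{0, \<dots>, n - 1}\<close> replace those of \<open>{1, \<dots>, n}\<close>.  The blocks are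
  enumerated by increasing least element; as \<open>g\<^sub>k\<close> is symmetric, any other order gives the same map.
\<close>

definition faa_comp_coeff ::
    "('o, 'm) cart \<Rightarrow> ('o, 'm) faa_map \<Rightarrow> ('o, 'm) faa_map \<Rightarrow> nat \<Rightarrow> 'm" where
  "faa_comp_coeff C f g n =
    (if n = 0 then coeff f 0 \<Zcomp>\<^bsub>C\<^esub> coeff g 0
     else
       let A = mobj (fst (fdom f)); X = snd (fdom f);
           a = proj C A n X; x = proj C A n X n
       in sum_map C (fst (fcod g)) (pow_prod C A n X)
            (\<lambda>P. apply_map C (coeff g (card P))
                   (map (\<lambda>B. apply_map C (coeff f (card B)) (map a (sorted_list_of_set B)) x)
                     (sorted_key_list_of_set Min P))
                   (x \<Zcomp>\<^bsub>C\<^esub> coeff f 0))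
            {P. partition_on {0..<n} P})"

definition faa_comp ::
    "('o, 'm) cart \<Rightarrow> ('o, 'm) faa_map \<Rightarrow> ('o, 'm) faa_map \<Rightarrow> ('o, 'm) faa_map" where
  "faa_comp C f g = FaaMap (fdom f) (fcod g) (faa_comp_coeff C f g)"

definition faa_prod ::
    "('o, 'm) cart \<Rightarrow> ('o, 'm) faa_obj \<Rightarrow> ('o, 'm) faa_obj \<Rightarrow> ('o, 'm) faa_obj" where
  "faa_prod C P Q = (prod_cmon C (fst P) (fst Q), snd P \<star>\<^bsub>C\<^esub> snd Q)"

definition faa_proj0 ::
    "('o, 'm) cart \<Rightarrow> ('o, 'm) faa_obj \<Rightarrow> ('o, 'm) faa_obj \<Rightarrow> ('o, 'm) faa_map" where
  "faa_proj0 C P Q =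
    (let A = mobj (fst P); B = mobj (fst Q); X = snd P; Y = snd Q
     in linear_faa C (faa_prod C P Q) P (Proj0 C X Y)
          (Proj0 C (A \<star>\<^bsub>C\<^esub> B) (X \<star>\<^bsub>C\<^esub> Y) \<Zcomp>\<^bsub>C\<^esub> Proj0 C A B))"

definition faa_proj1 ::
    "('o, 'm) cart \<Rightarrow> ('o, 'm) faa_obj \<Rightarrow> ('o, 'm) faa_obj \<Rightarrow> ('o, 'm) faa_map" where
  "faa_proj1 C P Q =
    (let A = mobj (fst P); B = mobj (fst Q); X = snd P; Y = snd Q
     in linear_faa C (faa_prod C P Q) Q (Proj1 C X Y)
          (Proj0 C (A \<star>\<^bsub>C\<^esub> B) (X \<star>\<^bsub>C\<^esub> Y) \<Zcomp>\<^bsub>C\<^esub> Proj1 C A B))"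

definition Faa :: "('o, 'm) cart \<Rightarrow> (('o, 'm) faa_obj, ('o, 'm) faa_map) cart" where
  "Faa C =
    \<lparr>Obj = {P. is_faa_obj C P},
     Arr = {f. is_faa_map C f},
     Dom = fdom,
     Cod = fcod,
     Id = faa_id C,
     Comp = faa_comp C,
     Prod = faa_prod C,
     Proj0 = faa_proj0 C,
     Proj1 = faa_proj1 C,
     One = (one_cmon C, One C)\<rparr>"


section \<open>The differential structure on the Faa di Bruno category\<close>

definition Faa_L ::
    "('o, 'm) cart \<Rightarrow> ('o, 'm) faa_obj \<Rightarrow> (('o, 'm) faa_obj, ('o, 'm) faa_map) cmon" where
  "Faa_L C P =
    (let M = fst P; A = mobj M
     in CMon (M, A)
          (linear_faa C (Prod (Faa C) (M, A) (M, A)) (M, A)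
            (madd M) (Proj0 C (A \<star>\<^bsub>C\<^esub> A) (A \<star>\<^bsub>C\<^esub> A) \<Zcomp>\<^bsub>C\<^esub> madd M))
          (linear_faa C (One (Faa C)) (M, A)
            (mzero M) (Proj0 C (One C) (One C) \<Zcomp>\<^bsub>C\<^esub> mzero M)))"

text \<open>
  \<open>delta1 C f\<close> is \<open>[\<delta>(f)]\<^sub>1 : (A, A) \<times> (A, X) \<rightarrow> (B, B)\<close>.  The variables \<open>v\<^sup>1, w\<^sup>1, \<dots>, v\<^sup>r, w\<^sup>r\<close> of
  \<open>(A \<times> A)\<^sup>r \<times> (A \<times> X)\<close> are numbered from \<open>0\<close>.
\<close>

definition delta1_coeff :: "('o, 'm) cart \<Rightarrow> ('o, 'm) faa_map \<Rightarrow> nat \<Rightarrow> 'm" where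
  "delta1_coeff C f r =
    (if r = 0 then coeff f 1
     else
       let A = mobj (fst (fdom f)); X = snd (fdom f); N = fst (fcod f);
           p = proj C (A \<star>\<^bsub>C\<^esub> A) r (A \<star>\<^bsub>C\<^esub> X);
           v = (\<lambda>j. p j \<Zcomp>\<^bsub>C\<^esub> Proj0 C A A);
           w = (\<lambda>j. p j \<Zcomp>\<^bsub>C\<^esub> Proj1 C A A);
           a = p r \<Zcomp>\<^bsub>C\<^esub> Proj0 C A X;
           x = p r \<Zcomp>\<^bsub>C\<^esub> Proj1 C A X
       in plus_map C N
            (apply_map C (coeff f (Suc r)) (a # map w [0..<r]) x)
            (sum_map C N (pow_prod C (A \<star>\<^bsub>C\<^esub> A) r (A \<star>\<^bsub>C\<^esub> X))
              (\<lambda>j. apply_map C (coeff f r) (v j # map w ([0..<j] @ [Suc j..<r])) x)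
              {0..<r}))"

definition delta1 :: "('o, 'm) cart \<Rightarrow> ('o, 'm) faa_map \<Rightarrow> ('o, 'm) faa_map" where
  "delta1 C f =
    (let M = fst (fdom f); N = fst (fcod f)
     in FaaMap (Prod (Faa C) (M, mobj M) (fdom f)) (N, mobj N) (delta1_coeff C f))"

end

theory Submission
  imports Defs
begin

text \<open>
  A jet over a finite set \<open>S\<close> at \<open>(A, X)\<close> is a family of generalized elements indexed by the subsets of
  \<open>S\<close>, with value in \<open>X\<close> at the empty set and in \<open>A\<close> elsewhere.  A map \<open>f\<close> of the Faa di Bruno category
  acts on jets by \<open>f(c)\<^sub>T = \<Sum>\<^sub>P f\<^bsub>|P|\<^esub>((c\<^sub>B)\<^bsub>B \<in> P\<^esub>, c\<^sub>\<emptyset>)\<close>, the sum being over the partitions \<open>P\<close> of \<open>T\<close>; this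
  action determines \<open>f\<close>, it is functorial, and it preserves products.  A jet over \<open>S\<close> at
  \<open>(A, A) \<times> (A, X)\<close> is the same as a jet over \<open>S \<union> {z}\<close> at \<open>(A, X)\<close>, and under this identification
  \<open>D[f]\<close> acts on the former as \<open>f\<close> acts on the latter.  The axioms can then be read off from the action:
  [CD.5] is functoriality over \<open>S \<union> {z}\<close>, and [CD.7] is the symmetry in the two indices added by \<open>D[D[f]]\<close>.
\<close>

section \<open>Hom sets of Cartesian categories\<close>

text \<open>Coefficientwise, the axioms for \<open>delta1\<close> compare nested sums over
  partitions with two components in every argument. The action on jets reduces them to two facts
  about set partitions. A partition of \<open>S \<union> {z}\<close> is a partition \<open>P\<close>
  of \<open>S\<close> with \<open>{z}\<close> added as a block, or with \<open>z\<close> put into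
  one block of \<open>P\<close>: the first kind yields the term in
  \<open>f\<^sub>r\<^sub>+\<^sub>1\<close> of \<open>delta1_coeff\<close>, the second kind the terms
  in \<open>f\<^sub>r\<close>. And partitioning every block of a partition amounts to grouping the
  blocks of a finer one, which makes the action functorial. [CD.6] needs one more computation: if
  all coefficients with \<open>z\<close> but without \<open>y\<close> vanish, then only partitions
  whose block of \<open>z\<close> contains \<open>y\<close> count.

  The infinitesimals are distinct and have square zero, so every coefficient is read off directly;
  powers of a single infinitesimal would bring in factorials, by which a commutative monoid cannot
  divide. Indexing by subsets instead of positions makes the order of arguments and of blocks
  disappear; the symmetry of the coefficients enters where evaluation on a set is shown to be well
  defined.\<close>

context category
begin

lemma Hom_Dom: "f \<in> Hom C X Y \<Longrightarrow> X \<in> Obj C"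
  using Dom_Obj by (auto simp: Hom_def)

lemma Hom_Cod: "f \<in> Hom C X Y \<Longrightarrow> Y \<in> Obj C"
  using Cod_Obj by (auto simp: Hom_def)

end

context cartesian_category
begin

lemma bang_Hom: "X \<in> Obj C \<Longrightarrow> bang C X \<in> Hom C X (One C)"
  unfolding bang_def by (rule theI', rule One_terminal)

lemma One_eq: "f \<in> Hom C X (One C) \<Longrightarrow> g \<in> Hom C X (One C) \<Longrightarrow> f = g"
  using One_terminal Hom_Dom by blast

lemma bang_eq: "f \<in> Hom C X (One C) \<Longrightarrow> bang C X = f"
  using One_eq bang_Hom Hom_Dom by blast

lemma pair_properties:
  assumes "f \<in> Hom C W X" "g \<in> Hom C W Y"
  shows "\<langle>f, g\<rangle> \<in> Hom C W (X \<star> Y) \<and> \<langle>f, g\<rangle> \<Zcomp> Proj0 C X Y = f \<and> \<langle>f, g\<rangle> \<Zcomp> Proj1 C X Y = g"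
proof -
  have "Dom C f = W" "Cod C f = X" "Cod C g = Y"
    using assms by (auto simp: Hom_def)
  then show ?thesis
    unfolding pair_def using theI'[OF Prod_universal[OF assms]] by simp
qed

lemma pair_Hom: "f \<in> Hom C W X \<Longrightarrow> g \<in> Hom C W Y \<Longrightarrow> \<langle>f, g\<rangle> \<in> Hom C W (X \<star> Y)"
  and pair_Proj0: "f \<in> Hom C W X \<Longrightarrow> g \<in> Hom C W Y \<Longrightarrow> \<langle>f, g\<rangle> \<Zcomp> Proj0 C X Y = f"
  and pair_Proj1: "f \<in> Hom C W X \<Longrightarrow> g \<in> Hom C W Y \<Longrightarrow> \<langle>f, g\<rangle> \<Zcomp> Proj1 C X Y = g"
  using pair_properties by blast+

lemmas Hom_intros = Comp_Hom pair_Hom Proj0_Hom Proj1_Hom Id_Hom bang_Hom One_Obj Prod_Obj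

lemma Prod_eqI:
  assumes "h \<in> Hom C W (X \<star> Y)" "k \<in> Hom C W (X \<star> Y)" "X \<in> Obj C" "Y \<in> Obj C"
    and "h \<Zcomp> Proj0 C X Y = k \<Zcomp> Proj0 C X Y" "h \<Zcomp> Proj1 C X Y = k \<Zcomp> Proj1 C X Y"
  shows "h = k"
proof -
  have "h \<Zcomp> Proj0 C X Y \<in> Hom C W X" "h \<Zcomp> Proj1 C X Y \<in> Hom C W Y"
    using assms by (auto intro: Hom_intros)
  from Prod_universal[OF this] show ?thesis
    using assms by metis
qed

lemma pair_eta:
  assumes "h \<in> Hom C W (X \<star> Y)" "X \<in> Obj C" "Y \<in> Obj C"
  shows "\<langle>h \<Zcomp> Proj0 C X Y, h \<Zcomp> Proj1 C X Y\<rangle> = h"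
proof -
  have h: "h \<Zcomp> Proj0 C X Y \<in> Hom C W X" "h \<Zcomp> Proj1 C X Y \<in> Hom C W Y"
    using assms by (auto intro: Hom_intros)
  show ?thesis
    by (rule Prod_eqI[OF pair_Hom[OF h] assms]) (simp_all add: pair_Proj0[OF h] pair_Proj1[OF h])
qed

lemma comp_pair:
  assumes "u \<in> Hom C V W" "f \<in> Hom C W X" "g \<in> Hom C W Y"
  shows "u \<Zcomp> \<langle>f, g\<rangle> = \<langle>u \<Zcomp> f, u \<Zcomp> g\<rangle>"
proof -
  have o: "X \<in> Obj C" "Y \<in> Obj C"
    using assms Hom_Cod by blast+
  have uf: "u \<Zcomp> f \<in> Hom C V X" and ug: "u \<Zcomp> g \<in> Hom C V Y"
    using assms by (auto intro: Hom_intros)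
  have p: "\<langle>f, g\<rangle> \<in> Hom C W (X \<star> Y)"
    using assms pair_Hom by blast
  show ?thesis
  proof (rule Prod_eqI[OF Comp_Hom[OF assms(1) p] pair_Hom[OF uf ug] o])
    show "(u \<Zcomp> \<langle>f, g\<rangle>) \<Zcomp> Proj0 C X Y = \<langle>u \<Zcomp> f, u \<Zcomp> g\<rangle> \<Zcomp> Proj0 C X Y"
      using Comp_assoc[OF assms(1) p Proj0_Hom[OF o]] pair_Proj0[OF assms(2,3)] pair_Proj0[OF uf ug]
      by simp
    show "(u \<Zcomp> \<langle>f, g\<rangle>) \<Zcomp> Proj1 C X Y = \<langle>u \<Zcomp> f, u \<Zcomp> g\<rangle> \<Zcomp> Proj1 C X Y"
      using Comp_assoc[OF assms(1) p Proj1_Hom[OF o]] pair_Proj1[OF assms(2,3)] pair_Proj1[OF uf ug]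
      by simp
  qed
qed

lemma comp_bang:
  assumes "u \<in> Hom C V W"
  shows "u \<Zcomp> bang C W = bang C V"
  using assms by (metis One_eq Comp_Hom bang_Hom Hom_Dom Hom_Cod)

subsection \<open>Commutative monoids of maps\<close>

lemma comm_monoid_in_Obj: "comm_monoid_in C M \<Longrightarrow> mobj M \<in> Obj C"
  and madd_Hom: "comm_monoid_in C M \<Longrightarrow> madd M \<in> Hom C (mobj M \<star> mobj M) (mobj M)"
  and mzero_Hom: "comm_monoid_in C M \<Longrightarrow> mzero M \<in> Hom C (One C) (mobj M)"
  by (auto simp: comm_monoid_in_def Let_def)

text \<open>The primed versions assume the types of addition and zero and no laws, so that they
  serve for the product, terminal and differential monoids while the laws of these are still to be
  proved.\<close>

lemma plus_map_Hom':
  assumes "madd M \<in> Hom C (mobj M \<star> mobj M) (mobj M)"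
    and "f \<in> Hom C W (mobj M)" "g \<in> Hom C W (mobj M)"
  shows "plus_map C M f g \<in> Hom C W (mobj M)"
  unfolding plus_map_def using assms by (auto intro: Hom_intros)

lemma comp_plus_map':
  assumes "madd M \<in> Hom C (mobj M \<star> mobj M) (mobj M)"
    and "u \<in> Hom C V W" "f \<in> Hom C W (mobj M)" "g \<in> Hom C W (mobj M)"
  shows "u \<Zcomp> plus_map C M f g = plus_map C M (u \<Zcomp> f) (u \<Zcomp> g)"
  unfolding plus_map_def
  using Comp_assoc[OF assms(2) pair_Hom[OF assms(3,4)] assms(1)] comp_pair[OF assms(2-4)] by simp

lemma zero_map_Hom':
  "mzero M \<in> Hom C (One C) (mobj M) \<Longrightarrow> W \<in> Obj C \<Longrightarrow> zero_map C M W \<in> Hom C W (mobj M)"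
  unfolding zero_map_def by (auto intro: Hom_intros)

lemma comp_zero_map':
  assumes "mzero M \<in> Hom C (One C) (mobj M)" "u \<in> Hom C V W"
  shows "u \<Zcomp> zero_map C M W = zero_map C M V"
  unfolding zero_map_def
  using Comp_assoc[OF assms(2) bang_Hom[OF Hom_Cod[OF assms(2)]] assms(1)] comp_bang[OF assms(2)]
  by simp

lemmas plus_map_Hom = plus_map_Hom'[OF madd_Hom]
lemmas comp_plus_map = comp_plus_map'[OF madd_Hom]
lemmas zero_map_Hom = zero_map_Hom'[OF mzero_Hom]
lemmas comp_zero_map = comp_zero_map'[OF mzero_Hom]

text \<open>The monoid axiom is an equation between maps out of
  \<open>(A \<star> A) \<star> A\<close> built from projections; precomposition with the tuple
  \<open>?t\<close> specializes it to arbitrary maps.\<close>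

lemma plus_map_assoc:
  assumes "comm_monoid_in C M"
    and f: "f \<in> Hom C W (mobj M)" and g: "g \<in> Hom C W (mobj M)" and h: "h \<in> Hom C W (mobj M)"
  shows "plus_map C M (plus_map C M f g) h = plus_map C M f (plus_map C M g h)"
proof -
  let ?A = "mobj M"
  let ?p0 = "Proj0 C ?A ?A" and ?p1 = "Proj1 C ?A ?A"
  let ?q0 = "Proj0 C (?A \<star> ?A) ?A" and ?q1 = "Proj1 C (?A \<star> ?A) ?A"
  let ?t = "\<langle>\<langle>f, g\<rangle>, h\<rangle>"
  have A: "?A \<in> Obj C" and AA: "?A \<star> ?A \<in> Obj C"
    using assms(1) comm_monoid_in_Obj Prod_Obj by blast+
  have fg: "\<langle>f, g\<rangle> \<in> Hom C W (?A \<star> ?A)"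
    using f g by (rule pair_Hom)
  have t: "?t \<in> Hom C W ((?A \<star> ?A) \<star> ?A)"
    using fg h by (rule pair_Hom)
  have q: "?q0 \<Zcomp> ?p0 \<in> Hom C ((?A \<star> ?A) \<star> ?A) ?A" "?q0 \<Zcomp> ?p1 \<in> Hom C ((?A \<star> ?A) \<star> ?A) ?A"
    "?q1 \<in> Hom C ((?A \<star> ?A) \<star> ?A) ?A"
    by (rule Hom_intros A)+
  have tq: "?t \<Zcomp> (?q0 \<Zcomp> ?p0) = f" "?t \<Zcomp> (?q0 \<Zcomp> ?p1) = g" "?t \<Zcomp> ?q1 = h"
    using Comp_assoc[OF t Proj0_Hom[OF AA A] Proj0_Hom[OF A A]]
      Comp_assoc[OF t Proj0_Hom[OF AA A] Proj1_Hom[OF A A]]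
    by (simp_all add: pair_Proj0[OF fg h] pair_Proj1[OF fg h] pair_Proj0[OF f g] pair_Proj1[OF f g])
  have e: "plus_map C M (plus_map C M (?q0 \<Zcomp> ?p0) (?q0 \<Zcomp> ?p1)) ?q1
      = plus_map C M (?q0 \<Zcomp> ?p0) (plus_map C M (?q0 \<Zcomp> ?p1) ?q1)"
    using assms(1) by (simp add: comm_monoid_in_def Let_def)
  note m = assms(1)
  show ?thesis
    using arg_cong[OF e, of "\<lambda>k. ?t \<Zcomp> k"]
      comp_plus_map[OF m t plus_map_Hom[OF m q(1,2)] q(3)] comp_plus_map[OF m t q(1,2)]
      comp_plus_map[OF m t q(1) plus_map_Hom[OF m q(2,3)]] comp_plus_map[OF m t q(2,3)]
    by (simp add: tq)
qed

lemma plus_map_comm: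
  assumes m: "comm_monoid_in C M"
    and f: "f \<in> Hom C W (mobj M)" and g: "g \<in> Hom C W (mobj M)"
  shows "plus_map C M f g = plus_map C M g f"
proof -
  let ?A = "mobj M"
  let ?p0 = "Proj0 C ?A ?A" and ?p1 = "Proj1 C ?A ?A"
  have A: "?A \<in> Obj C"
    using m comm_monoid_in_Obj by blast
  have "plus_map C M ?p1 ?p0 = madd M"
    using m by (simp add: comm_monoid_in_def Let_def)
  then have "plus_map C M f g = \<langle>f, g\<rangle> \<Zcomp> plus_map C M ?p1 ?p0"
    by (simp add: plus_map_def)
  also have "\<dots> = plus_map C M g f"
    using comp_plus_map[OF m pair_Hom[OF f g] Proj1_Hom[OF A A] Proj0_Hom[OF A A]]
    by (simp add: pair_Proj0[OF f g] pair_Proj1[OF f g])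
  finally show ?thesis .
qed

lemma plus_map_zero_left:
  assumes m: "comm_monoid_in C M" and f: "f \<in> Hom C W (mobj M)"
  shows "plus_map C M (zero_map C M W) f = f"
proof -
  have A: "mobj M \<in> Obj C"
    using m comm_monoid_in_Obj by blast
  have "plus_map C M (zero_map C M (mobj M)) (Id C (mobj M)) = Id C (mobj M)"
    using m by (simp add: comm_monoid_in_def Let_def)
  then have "f \<Zcomp> plus_map C M (zero_map C M (mobj M)) (Id C (mobj M)) = f"
    using Comp_Id[OF f] by simp
  then show ?thesis
    using comp_plus_map[OF m f zero_map_Hom[OF m A] Id_Hom[OF A]] comp_zero_map[OF m f] Comp_Id[OF f]
    by simp
qed

lemma plus_map_zero_right:
  assumes m: "comm_monoid_in C M" and f: "f \<in> Hom C W (mobj M)"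
  shows "plus_map C M f (zero_map C M W) = f"
  using plus_map_comm[OF m f zero_map_Hom[OF m Hom_Dom[OF f]]] plus_map_zero_left[OF m f] by simp

lemma comm_monoid_hom_monoid:
  assumes m: "comm_monoid_in C M" and W: "W \<in> Obj C"
  shows "comm_monoid (hom_monoid C M W)"
  by (rule comm_monoidI)
    (use m W in \<open>auto simp: hom_monoid_def plus_map_zero_left plus_map_assoc
      intro: plus_map_Hom zero_map_Hom plus_map_comm\<close>)

text \<open>The converse passage: laws for all generalized elements give the axioms, by taking
  projections and identities as elements. Monoids in \<open>Faa C\<close> are recognized this way,
  since sums of maps there are compared through jets.\<close>

lemma comm_monoid_inI:
  assumes A: "mobj M \<in> Obj C"
    and a: "madd M \<in> Hom C (mobj M \<star> mobj M) (mobj M)" and z: "mzero M \<in> Hom C (One C) (mobj M)"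
    and assoc: "\<And>W f g h. f \<in> Hom C W (mobj M) \<Longrightarrow> g \<in> Hom C W (mobj M) \<Longrightarrow>
      h \<in> Hom C W (mobj M) \<Longrightarrow>
      plus_map C M (plus_map C M f g) h = plus_map C M f (plus_map C M g h)"
    and comm: "\<And>W f g. f \<in> Hom C W (mobj M) \<Longrightarrow> g \<in> Hom C W (mobj M) \<Longrightarrow>
      plus_map C M f g = plus_map C M g f"
    and zero: "\<And>W f. f \<in> Hom C W (mobj M) \<Longrightarrow> plus_map C M (zero_map C M W) f = f"
  shows "comm_monoid_in C M"
proof -
  let ?A = "mobj M"
  let ?p0 = "Proj0 C ?A ?A" and ?p1 = "Proj1 C ?A ?A"
  let ?q0 = "Proj0 C (?A \<star> ?A) ?A" and ?q1 = "Proj1 C (?A \<star> ?A) ?A"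
  have AA: "?A \<star> ?A \<in> Obj C"
    using A Prod_Obj by blast
  have q: "?q0 \<Zcomp> ?p0 \<in> Hom C ((?A \<star> ?A) \<star> ?A) ?A" "?q0 \<Zcomp> ?p1 \<in> Hom C ((?A \<star> ?A) \<star> ?A) ?A"
    "?q1 \<in> Hom C ((?A \<star> ?A) \<star> ?A) ?A"
    by (rule Hom_intros A)+
  have p: "?p0 \<in> Hom C (?A \<star> ?A) ?A" "?p1 \<in> Hom C (?A \<star> ?A) ?A"
    using A by (auto intro: Hom_intros)
  \<comment> \<open>The commutativity axiom has the bare addition on its right side; this is the sum
    of the two projections because they pair to the identity.\<close>
  have "\<langle>?p0, ?p1\<rangle> = Id C (?A \<star> ?A)"
    by (rule Prod_eqI[OF pair_Hom[OF p] Id_Hom[OF AA] A A])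
      (simp_all add: pair_Proj0[OF p] pair_Proj1[OF p] Id_Comp[OF p(1)] Id_Comp[OF p(2)])
  then have "plus_map C M ?p0 ?p1 = madd M"
    by (simp add: plus_map_def Id_Comp[OF a])
  moreover have "plus_map C M (zero_map C M ?A) (Id C ?A) = Id C ?A"
    by (rule zero[OF Id_Hom[OF A]])
  ultimately show ?thesis
    unfolding comm_monoid_in_def Let_def
    using A a z assoc[OF q] comm[OF p] comm[OF zero_map_Hom'[OF z A] Id_Hom[OF A]] by simp
qed

end

subsection \<open>Finite sums of maps\<close>

locale cmon_in_cartesian = cartesian_category C for C :: "('o, 'm) cart" (structure) +
  fixes M :: "('o, 'm) cmon"
  assumes cmon: "comm_monoid_in C M"
begin

lemmas Obj_mobj = comm_monoid_in_Obj[OF cmon]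

context
  fixes W :: 'o
  assumes W: "W \<in> Obj C"
begin

interpretation hm: comm_monoid "hom_monoid C M W"
  by (rule comm_monoid_hom_monoid[OF cmon W])

lemma hm_simps: "carrier (hom_monoid C M W) = Hom C W (mobj M)"
  "monoid.mult (hom_monoid C M W) = plus_map C M" "one (hom_monoid C M W) = zero_map C M W"
  by (simp_all add: hom_monoid_def)

lemma sum_empty: "sum_map C M W f {} = zero_map C M W"
  using hm.finprod_empty by (simp add: sum_map_def hm_simps)

lemma sum_closed: "(\<And>i. i \<in> I \<Longrightarrow> f i \<in> Hom C W (mobj M)) \<Longrightarrow> sum_map C M W f I \<in> Hom C W (mobj M)"
  using hm.finprod_closed[of f I] by (simp add: sum_map_def hm_simps)

lemma sum_insert:
  "finite I \<Longrightarrow> i \<notin> I \<Longrightarrow> (\<And>j. j \<in> I \<Longrightarrow> f j \<in> Hom C W (mobj M)) \<Longrightarrow> f i \<in> Hom C W (mobj M) \<Longrightarrow>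
    sum_map C M W f (insert i I) = plus_map C M (f i) (sum_map C M W f I)"
  using hm.finprod_insert[of I i f] by (simp add: sum_map_def hm_simps)

lemma sum_singleton: "f i \<in> Hom C W (mobj M) \<Longrightarrow> sum_map C M W f {i} = f i"
  using sum_insert[of "{}" i f] by (simp add: sum_empty plus_map_zero_right[OF cmon])

lemma sum_cong:
  "I = J \<Longrightarrow> (\<And>i. i \<in> J \<Longrightarrow> g i \<in> Hom C W (mobj M)) \<Longrightarrow> (\<And>i. i \<in> J \<Longrightarrow> f i = g i) \<Longrightarrow>
    sum_map C M W f I = sum_map C M W g J"
  using hm.finprod_cong'[of I J g f] by (simp add: sum_map_def hm_simps)

lemma sum_zero: "(\<And>i. i \<in> I \<Longrightarrow> f i = zero_map C M W) \<Longrightarrow> sum_map C M W f I = zero_map C M W"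
  using hm.finprod_one_eqI[of I f] by (simp add: sum_map_def hm_simps)

lemma sum_plus:
  "(\<And>i. i \<in> I \<Longrightarrow> f i \<in> Hom C W (mobj M)) \<Longrightarrow> (\<And>i. i \<in> I \<Longrightarrow> g i \<in> Hom C W (mobj M)) \<Longrightarrow>
    sum_map C M W (\<lambda>i. plus_map C M (f i) (g i)) I
      = plus_map C M (sum_map C M W f I) (sum_map C M W g I)"
  using hm.finprod_multf[of f I g] by (simp add: sum_map_def hm_simps)

lemma sum_Un_disjoint:
  "finite I \<Longrightarrow> finite J \<Longrightarrow> I \<inter> J = {} \<Longrightarrow> (\<And>i. i \<in> I \<union> J \<Longrightarrow> f i \<in> Hom C W (mobj M)) \<Longrightarrow>
    sum_map C M W f (I \<union> J) = plus_map C M (sum_map C M W f I) (sum_map C M W f J)"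
  using hm.finprod_Un_disjoint[of I J f] by (simp add: sum_map_def hm_simps)

lemma sum_reindex:
  "inj_on h I \<Longrightarrow> (\<And>i. i \<in> I \<Longrightarrow> f (h i) \<in> Hom C W (mobj M)) \<Longrightarrow>
    sum_map C M W f (h ` I) = sum_map C M W (\<lambda>i. f (h i)) I"
  using hm.finprod_reindex[of f h I] by (simp add: sum_map_def hm_simps Pi_iff)

lemma sum_neutral_right:
  "finite I \<Longrightarrow> J \<subseteq> I \<Longrightarrow> (\<And>i. i \<in> I - J \<Longrightarrow> f i = zero_map C M W) \<Longrightarrow>
    (\<And>i. i \<in> I \<Longrightarrow> f i \<in> Hom C W (mobj M)) \<Longrightarrow> sum_map C M W f I = sum_map C M W f J"
  using hm.finprod_mono_neutral_cong_right[of I J f f] by (simp add: sum_map_def hm_simps)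

lemma sum_Sigma:
  assumes "finite I" "\<And>i. i \<in> I \<Longrightarrow> finite (K i)"
    and "\<And>i j. i \<in> I \<Longrightarrow> j \<in> K i \<Longrightarrow> f (i, j) \<in> Hom C W (mobj M)"
  shows "sum_map C M W (\<lambda>i. sum_map C M W (\<lambda>j. f (i, j)) (K i)) I = sum_map C M W f (Sigma I K)"
  using assms
proof (induction I)
  case empty
  then show ?case
    by (simp add: sum_empty)
next
  case (insert i I)
  have S: "Sigma (insert i I) K = Pair i ` K i \<union> Sigma I K"
    by auto
  have "sum_map C M W f (Pair i ` K i) = sum_map C M W (\<lambda>j. f (i, j)) (K i)"
    using insert by (intro sum_reindex) (auto simp: inj_on_def)
  moreover have "sum_map C M W f (Sigma (insert i I) K)
      = plus_map C M (sum_map C M W f (Pair i ` K i)) (sum_map C M W f (Sigma I K))"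
    unfolding S using insert by (intro sum_Un_disjoint) auto
  moreover have "sum_map C M W (\<lambda>i. sum_map C M W (\<lambda>j. f (i, j)) (K i)) (insert i I)
      = plus_map C M (sum_map C M W (\<lambda>j. f (i, j)) (K i))
          (sum_map C M W (\<lambda>i. sum_map C M W (\<lambda>j. f (i, j)) (K i)) I)"
    using insert by (intro sum_insert) (auto intro!: sum_closed)
  ultimately show ?case
    using insert by simp
qed

end

lemma comp_sum:
  assumes u: "u \<in> Hom C V W" and f: "\<And>i. i \<in> I \<Longrightarrow> f i \<in> Hom C W (mobj M)"
  shows "u \<Zcomp> sum_map C M W f I = sum_map C M V (\<lambda>i. u \<Zcomp> f i) I"
proof -
  have o: "V \<in> Obj C" "W \<in> Obj C"
    using u Hom_Dom Hom_Cod by blast+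
  show ?thesis
    using f
  proof (induction I rule: infinite_finite_induct)
    \<comment> \<open>By convention \<open>finprod\<close> over an infinite set is the unit, so both
      sides are zero maps.\<close>
    case (infinite I)
    then show ?case
      using comp_zero_map[OF cmon u] by (simp add: sum_map_def finprod_def hm_simps[OF o(1)] hm_simps[OF o(2)])
  next
    case empty
    then show ?case
      using comp_zero_map[OF cmon u] by (simp add: sum_empty o)
  next
    case (insert i I)
    have "u \<Zcomp> sum_map C M W f (insert i I) = u \<Zcomp> plus_map C M (f i) (sum_map C M W f I)"
      using insert by (simp add: sum_insert o)
    also have "\<dots> = plus_map C M (u \<Zcomp> f i) (u \<Zcomp> sum_map C M W f I)"
      using insert o by (intro comp_plus_map[OF cmon u]) (auto intro!: sum_closed)
    also have "\<dots> = sum_map C M V (\<lambda>i. u \<Zcomp> f i) (insert i I)"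
      using insert u o by (subst sum_insert) (auto intro!: Comp_Hom)
    finally show ?case .
  qed
qed

end

section \<open>Multivariable evaluation\<close>

context cartesian_category
begin

lemma pow_prod_Obj: "A \<in> Obj C \<Longrightarrow> X \<in> Obj C \<Longrightarrow> pow_prod C A n X \<in> Obj C"
  by (induction n) (auto intro: Prod_Obj)

lemma proj_last_Hom:
  "A \<in> Obj C \<Longrightarrow> X \<in> Obj C \<Longrightarrow> proj C A n X n \<in> Hom C (pow_prod C A n X) X"
  by (induction n) (auto intro: Id_Hom Comp_Hom Proj1_Hom pow_prod_Obj)

lemma proj_Hom:
  "A \<in> Obj C \<Longrightarrow> X \<in> Obj C \<Longrightarrow> i < n \<Longrightarrow> proj C A n X i \<in> Hom C (pow_prod C A n X) A"
proof (induction n arbitrary: i)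
  case (Suc n)
  then show ?case
    by (cases i) (auto intro: Comp_Hom Proj0_Hom Proj1_Hom pow_prod_Obj)
qed simp

lemma tuple_Hom:
  "set zs \<subseteq> Hom C W A \<Longrightarrow> x \<in> Hom C W X \<Longrightarrow>
    foldr (pair C) zs x \<in> Hom C W (pow_prod C A (length zs) X)"
  by (induction zs) (auto intro: pair_Hom)

lemma tuple_proj:
  assumes "set zs \<subseteq> Hom C W A" "x \<in> Hom C W X"
  shows "i < length zs \<Longrightarrow> foldr (pair C) zs x \<Zcomp> proj C A (length zs) X i = zs ! i"
    and "foldr (pair C) zs x \<Zcomp> proj C A (length zs) X (length zs) = x"
proof -
  have "(i < length zs \<longrightarrow> foldr (pair C) zs x \<Zcomp> proj C A (length zs) X i = zs ! i) \<and>
      foldr (pair C) zs x \<Zcomp> proj C A (length zs) X (length zs) = x" for i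
    using assms
  proof (induction zs arbitrary: i)
    case Nil
    then show ?case
      by (simp add: Comp_Id)
  next
    case (Cons z zs)
    let ?t = "foldr (pair C) zs x" and ?n = "length zs"
    have z: "z \<in> Hom C W A" and t: "?t \<in> Hom C W (pow_prod C A ?n X)"
      using Cons.prems tuple_Hom by auto
    have o: "A \<in> Obj C" "X \<in> Obj C"
      using Cons.prems z Hom_Cod by auto
    then have po: "pow_prod C A ?n X \<in> Obj C"
      by (rule pow_prod_Obj)
    have "\<langle>z, ?t\<rangle> \<Zcomp> (Proj1 C A (pow_prod C A ?n X) \<Zcomp> k) = ?t \<Zcomp> k"
      if "k \<in> Hom C (pow_prod C A ?n X) Z" for k Z
      using Comp_assoc[OF pair_Hom[OF z t] Proj1_Hom[OF o(1) po] that] pair_Proj1[OF z t] by simp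
    note r = this[OF proj_Hom[OF o]] this[OF proj_last_Hom[OF o]]
    from Cons have IH: "j < ?n \<longrightarrow> ?t \<Zcomp> proj C A ?n X j = zs ! j" "?t \<Zcomp> proj C A ?n X ?n = x" for j
      by auto
    show ?case
      using IH r pair_Proj0[OF z t] by (auto split: nat.split)
  qed
  then show "i < length zs \<Longrightarrow> foldr (pair C) zs x \<Zcomp> proj C A (length zs) X i = zs ! i"
    and "foldr (pair C) zs x \<Zcomp> proj C A (length zs) X (length zs) = x"
    by auto
qed

lemma pow_prod_eqI:
  assumes "A \<in> Obj C" "X \<in> Obj C"
    and "h \<in> Hom C W (pow_prod C A n X)" "k \<in> Hom C W (pow_prod C A n X)"
    and "\<And>i. i \<le> n \<Longrightarrow> h \<Zcomp> proj C A n X i = k \<Zcomp> proj C A n X i"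
  shows "h = k"
  using assms(3-)
proof (induction n arbitrary: h k)
  case 0
  then show ?case
    by (metis Comp_Id le_refl pow_prod.simps(1) proj.simps(1))
next
  case (Suc n)
  let ?P = "pow_prod C A n X"
  have P: "?P \<in> Obj C"
    using assms pow_prod_Obj by blast
  have hk: "h \<in> Hom C W (A \<star> ?P)" "k \<in> Hom C W (A \<star> ?P)"
    using Suc.prems by auto
  have "h \<Zcomp> Proj1 C A ?P = k \<Zcomp> Proj1 C A ?P"
  proof (rule Suc.IH)
    show "h \<Zcomp> Proj1 C A ?P \<in> Hom C W ?P" "k \<Zcomp> Proj1 C A ?P \<in> Hom C W ?P"
      using hk P assms(1) by (auto intro: Hom_intros)
    fix i assume "i \<le> n"
    then have "i < n \<or> i = n" by auto
    then have "\<exists>Z. proj C A n X i \<in> Hom C ?P Z"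
      using proj_Hom[OF assms(1,2)] proj_last_Hom[OF assms(1,2)] by blast
    then show "(h \<Zcomp> Proj1 C A ?P) \<Zcomp> proj C A n X i = (k \<Zcomp> Proj1 C A ?P) \<Zcomp> proj C A n X i"
      using Suc.prems(3)[of "Suc i"] \<open>i \<le> n\<close> Comp_assoc[OF hk(1) Proj1_Hom[OF assms(1) P]]
        Comp_assoc[OF hk(2) Proj1_Hom[OF assms(1) P]] by auto
  qed
  moreover have "h \<Zcomp> Proj0 C A ?P = k \<Zcomp> Proj0 C A ?P"
    using Suc.prems(3)[of 0] by simp
  ultimately show ?case
    using Prod_eqI[OF hk assms(1) P] by blast
qed

lemma apply_map_Hom:
  "set zs \<subseteq> Hom C W A \<Longrightarrow> x \<in> Hom C W X \<Longrightarrow> h \<in> Hom C (pow_prod C A (length zs) X) B \<Longrightarrow>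
    apply_map C h zs x \<in> Hom C W B"
  unfolding apply_map_def by (rule Comp_Hom[OF tuple_Hom])

lemma comp_tuple:
  assumes "u \<in> Hom C V W" "set zs \<subseteq> Hom C W A" "x \<in> Hom C W X"
  shows "u \<Zcomp> foldr (pair C) zs x = foldr (pair C) (map (\<lambda>z. u \<Zcomp> z) zs) (u \<Zcomp> x)"
  using assms(2,3)
proof (induction zs)
  case (Cons z zs)
  then show ?case
    using comp_pair[OF assms(1), of z A "foldr (pair C) zs x"] tuple_Hom[of zs W A x X] by auto
qed simp

lemma comp_apply_map:
  assumes "u \<in> Hom C V W" "set zs \<subseteq> Hom C W A" "x \<in> Hom C W X"
    and "h \<in> Hom C (pow_prod C A (length zs) X) B"
  shows "u \<Zcomp> apply_map C h zs x = apply_map C h (map (\<lambda>z. u \<Zcomp> z) zs) (u \<Zcomp> x)"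
  using Comp_assoc[OF assms(1) tuple_Hom[OF assms(2,3)] assms(4)] comp_tuple[OF assms(1-3)]
  by (simp add: apply_map_def)

lemma tuple_projs:
  assumes "A \<in> Obj C" "X \<in> Obj C"
  shows "foldr (pair C) (map (proj C A n X) [0..<n]) (proj C A n X n) = Id C (pow_prod C A n X)"
proof (rule pow_prod_eqI[OF assms])
  let ?zs = "map (proj C A n X) [0..<n]"
  have zs: "set ?zs \<subseteq> Hom C (pow_prod C A n X) A"
    using proj_Hom[OF assms] by auto
  note x = proj_last_Hom[OF assms, of n]
  show "foldr (pair C) ?zs (proj C A n X n) \<in> Hom C (pow_prod C A n X) (pow_prod C A n X)"
    using tuple_Hom[OF zs x] by simp
  show "Id C (pow_prod C A n X) \<in> Hom C (pow_prod C A n X) (pow_prod C A n X)"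
    by (rule Id_Hom[OF pow_prod_Obj[OF assms]])
  fix i assume "i \<le> n"
  then consider "i < n" | "i = n" by linarith
  then show "foldr (pair C) ?zs (proj C A n X n) \<Zcomp> proj C A n X i
      = Id C (pow_prod C A n X) \<Zcomp> proj C A n X i"
    using tuple_proj(1)[OF zs x, of i] tuple_proj(2)[OF zs x]
      Id_Comp[OF x] Id_Comp[OF proj_Hom[OF assms]] by cases auto
qed

lemma apply_map_projs:
  assumes "A \<in> Obj C" "X \<in> Obj C" "h \<in> Hom C (pow_prod C A n X) B"
  shows "apply_map C h (map (proj C A n X) [0..<n]) (proj C A n X n) = h"
  unfolding apply_map_def tuple_projs[OF assms(1,2)] by (rule Id_Comp[OF assms(3)])

text \<open>Symmetry is stated at the projections, which are the universal arguments; precomposition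
  with the tuple \<open>?t\<close> carries it to all arguments.\<close>

lemma symmetric_map_apply:
  assumes sym: "symmetric_map C h A n X" and h: "h \<in> Hom C (pow_prod C A n X) B"
    and \<sigma>: "\<sigma> permutes {..<n}"
    and a: "\<And>i. i < n \<Longrightarrow> a i \<in> Hom C W A" and x: "x \<in> Hom C W X"
  shows "apply_map C h (map (\<lambda>i. a (\<sigma> i)) [0..<n]) x = apply_map C h (map a [0..<n]) x"
proof (cases "n = 0")
  \<comment> \<open>An argument \<open>a i\<close> exists for \<open>n > 0\<close> only, and it is
    what shows \<open>A\<close> to be an object; for \<open>n = 0\<close> both lists are
    empty.\<close>
  case False
  have A: "A \<in> Obj C" and X: "X \<in> Obj C"
    using False a x Hom_Cod by blast+
  let ?t = "foldr (pair C) (map a [0..<n]) x"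
  have as: "set (map a [0..<n]) \<subseteq> Hom C W A"
    using a by auto
  have t: "?t \<in> Hom C W (pow_prod C A n X)"
    using tuple_Hom[OF as x] by simp
  have \<sigma>n: "\<sigma> i < n" if "i < n" for i
    using permutes_in_image[OF \<sigma>, of i] that by simp
  have "?t \<Zcomp> h = ?t \<Zcomp> apply_map C h (map (\<lambda>i. proj C A n X (\<sigma> i)) [0..<n]) (proj C A n X n)"
    using sym \<sigma> by (simp add: symmetric_map_def)
  also have "\<dots> = apply_map C h (map (\<lambda>z. ?t \<Zcomp> z) (map (\<lambda>i. proj C A n X (\<sigma> i)) [0..<n]))
      (?t \<Zcomp> proj C A n X n)"
    using h \<sigma>n by (intro comp_apply_map[OF t _ proj_last_Hom[OF A X]]) (auto intro!: proj_Hom[OF A X])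
  also have "map (\<lambda>z. ?t \<Zcomp> z) (map (\<lambda>i. proj C A n X (\<sigma> i)) [0..<n]) = map (\<lambda>i. a (\<sigma> i)) [0..<n]"
    using tuple_proj(1)[OF as x] \<sigma>n by auto
  also have "?t \<Zcomp> proj C A n X n = x"
    using tuple_proj(2)[OF as x] by simp
  finally show ?thesis
    by (simp add: apply_map_def)
qed simp

lemma additive_mapD:
  assumes "additive_map C h M n X N" "length zs = n" "set zs \<subseteq> Hom C W (mobj M)" "x \<in> Hom C W X"
    and "i < n"
  shows "a \<in> Hom C W (mobj M) \<Longrightarrow> b \<in> Hom C W (mobj M) \<Longrightarrow>
      apply_map C h (zs[i := plus_map C M a b]) x =
        plus_map C N (apply_map C h (zs[i := a]) x) (apply_map C h (zs[i := b]) x)"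
    and "apply_map C h (zs[i := zero_map C M W]) x = zero_map C N W"
  using assms Hom_Dom[OF assms(4)] unfolding additive_map_def by blast+

end

subsection \<open>Maps of the Faa di Bruno category\<close>

lemma Faa_simps [simp]:
  "Obj (Faa C) = {P. is_faa_obj C P}"
  "Id (Faa C) = faa_id C"
  "Comp (Faa C) = faa_comp C"
  "Prod (Faa C) = faa_prod C"
  "Proj0 (Faa C) = faa_proj0 C"
  "Proj1 (Faa C) = faa_proj1 C"
  "One (Faa C) = (one_cmon C, One C)"
  "Dom (Faa C) = fdom"
  "Cod (Faa C) = fcod"
  by (simp_all add: Faa_def)

lemma Faa_Hom_iff: "f \<in> Hom (Faa C) P Q \<longleftrightarrow> is_faa_map C f \<and> fdom f = P \<and> fcod f = Q"
  by (simp add: Hom_def Faa_def)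

lemma Faa_HomD:
  assumes "f \<in> Hom (Faa C) (M, X) (N, Y)"
  shows "comm_monoid_in C M" "X \<in> Obj C" "comm_monoid_in C N" "Y \<in> Obj C"
    "coeff f 0 \<in> Hom C X Y"
    "1 \<le> n \<Longrightarrow> coeff f n \<in> Hom C (pow_prod C (mobj M) n X) (mobj N)"
    "1 \<le> n \<Longrightarrow> symmetric_map C (coeff f n) (mobj M) n X"
    "1 \<le> n \<Longrightarrow> additive_map C (coeff f n) M n X N"
    "fdom f = (M, X)" "fcod f = (N, Y)"
  using assms by (auto simp: Faa_Hom_iff is_faa_map_def is_faa_obj_def)

text \<open>
  The symmetry of the coefficients makes \<open>f\<^sub>n\<close> a function of families indexed by an arbitrary
  \<open>n\<close>-element set; for the empty set this is \<open>f\<^sub>*\<close>.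
\<close>

definition faa_app :: "('o, 'm) cart \<Rightarrow> ('o, 'm) faa_map \<Rightarrow> 'i set \<Rightarrow> ('i \<Rightarrow> 'm) \<Rightarrow> 'm \<Rightarrow> 'm" where
  "faa_app C f S a x =
    apply_map C (coeff f (card S)) (map a (SOME xs. distinct xs \<and> set xs = S)) x"

lemma faa_app_empty:
  fixes a :: "'i \<Rightarrow> 'm"
  shows "faa_app C f {} a x = x \<Zcomp>\<^bsub>C\<^esub> coeff f 0"
proof -
  have "(SOME xs :: 'i list. distinct xs \<and> set xs = {}) = []"
    by (rule some_equality) auto
  then show ?thesis
    unfolding faa_app_def by (simp only:) (simp add: apply_map_def)
qed

lemma faa_app_cong:
  assumes "finite S" "\<And>i. i \<in> S \<Longrightarrow> a i = b i"
  shows "faa_app C f S a x = faa_app C f S b x"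
proof -
  let ?L = "SOME xs. distinct xs \<and> set xs = S"
  have "set ?L = S"
    using someI_ex[of "\<lambda>xs. distinct xs \<and> set xs = S"] finite_distinct_list[OF assms(1)] by blast
  then have "map a ?L = map b ?L"
    using assms(2) by (intro map_cong) auto
  then show ?thesis
    unfolding faa_app_def by (simp only:)
qed

context cartesian_category
begin

context
  fixes f M X N Y
  assumes f: "f \<in> Hom (Faa C) (M, X) (N, Y)"
begin

lemmas fD = Faa_HomD[OF f]

lemma coeff_Hom:
  assumes "n = 0 \<Longrightarrow> B = Y" "0 < n \<Longrightarrow> B = mobj N"
  shows "coeff f n \<in> Hom C (pow_prod C (mobj M) n X) B"
  using fD(5) fD(6)[of n] assms by (cases "n = 0") (auto simp: Suc_le_eq)

text \<open>Two enumerations of a finite set differ by a permutation of positions, so the symmetry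
  of the coefficient removes the choice hidden in \<open>faa_app\<close>.\<close>

lemma faa_app_set:
  assumes xs: "distinct xs" and a: "\<And>i. i \<in> set xs \<Longrightarrow> a i \<in> Hom C W (mobj M)"
    and x: "x \<in> Hom C W X"
  shows "faa_app C f (set xs) a x = apply_map C (coeff f (length xs)) (map a xs) x"
proof (cases "xs = []")
  case True
  then show ?thesis
    by (simp add: faa_app_empty apply_map_def)
next
  case False
  define ys where "ys = (SOME ys. distinct ys \<and> set ys = set xs)"
  have "distinct ys \<and> set ys = set xs"
    unfolding ys_def by (rule someI[of _ xs]) (simp add: xs)
  then have "mset ys = mset xs"
    using xs set_eq_iff_mset_eq_distinct by blast
  then obtain p where p: "p permutes {..<length xs}" "permute_list p xs = ys"
    by (rule mset_eq_permutation)
  have pn: "p i < length xs" if "i < length xs" for i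
    using permutes_in_image[OF p(1), of i] that by simp
  have "map a ys = map (\<lambda>i. a (xs ! p i)) [0..<length xs]"
    unfolding p(2)[symmetric] permute_list_def by simp
  moreover have "map (\<lambda>i. a (xs ! i)) [0..<length xs] = map a xs"
    by (rule nth_equalityI) auto
  moreover have "apply_map C (coeff f (length xs)) (map (\<lambda>i. a (xs ! p i)) [0..<length xs]) x
      = apply_map C (coeff f (length xs)) (map (\<lambda>i. a (xs ! i)) [0..<length xs]) x"
    using False a by (intro symmetric_map_apply[OF fD(7) fD(6) p(1) _ x]) (auto simp: Suc_le_eq)
  ultimately show ?thesis
    unfolding faa_app_def ys_def[symmetric] by (simp add: distinct_card xs)
qed

lemma faa_app_lessThan:
  assumes "\<And>i. i < n \<Longrightarrow> a i \<in> Hom C W (mobj M)" and "x \<in> Hom C W X"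
  shows "faa_app C f {0..<n} a x = apply_map C (coeff f n) (map a [0..<n]) x"
  using faa_app_set[of "[0..<n]" a W x] assms by simp

lemma faa_app_Hom:
  assumes "finite S" "\<And>i. i \<in> S \<Longrightarrow> a i \<in> Hom C W (mobj M)" "x \<in> Hom C W X"
    and "S = {} \<Longrightarrow> B = Y" "S \<noteq> {} \<Longrightarrow> B = mobj N"
  shows "faa_app C f S a x \<in> Hom C W B"
proof -
  obtain xs where xs: "distinct xs" "set xs = S"
    using finite_distinct_list[OF assms(1)] by blast
  have "apply_map C (coeff f (length xs)) (map a xs) x \<in> Hom C W B"
    using assms xs by (intro apply_map_Hom[of _ _ "mobj M" _ X]) (auto intro!: coeff_Hom)
  then show ?thesis
    using faa_app_set[OF xs(1) _ assms(3), of a] xs(2) assms(2) by simp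
qed

lemma comp_faa_app:
  assumes u: "u \<in> Hom C V W" and S: "finite S" and a: "\<And>i. i \<in> S \<Longrightarrow> a i \<in> Hom C W (mobj M)"
    and x: "x \<in> Hom C W X"
  shows "u \<Zcomp> faa_app C f S a x = faa_app C f S (\<lambda>i. u \<Zcomp> a i) (u \<Zcomp> x)"
proof -
  obtain xs where xs: "distinct xs" "set xs = S"
    using finite_distinct_list[OF S] by blast
  have "faa_app C f S (\<lambda>i. u \<Zcomp> a i) (u \<Zcomp> x)
      = apply_map C (coeff f (length xs)) (map (\<lambda>i. u \<Zcomp> a i) xs) (u \<Zcomp> x)"
    using faa_app_set[OF xs(1), of "\<lambda>i. u \<Zcomp> a i" V "u \<Zcomp> x"] xs(2) u a x by (auto intro: Comp_Hom)
  moreover have "faa_app C f S a x = apply_map C (coeff f (length xs)) (map a xs) x"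
    using faa_app_set[OF xs(1) _ x, of a] xs(2) a by simp
  moreover have "coeff f (length xs) \<in> Hom C (pow_prod C (mobj M) (length (map a xs)) X)
      (if xs = [] then Y else mobj N)"
    by (simp only: length_map, rule coeff_Hom) auto
  then have "u \<Zcomp> apply_map C (coeff f (length xs)) (map a xs) x
      = apply_map C (coeff f (length xs)) (map (\<lambda>z. u \<Zcomp> z) (map a xs)) (u \<Zcomp> x)"
    using xs a by (intro comp_apply_map[OF u _ x]) auto
  ultimately show ?thesis
    by (simp add: comp_def)
qed

text \<open>Applied with sets of blocks as index sets, this identifies terms of the action that
  belong to different partitions.\<close>

lemma faa_app_reindex:
  assumes h: "inj_on h S" and S: "finite S" and a: "\<And>i. i \<in> S \<Longrightarrow> a (h i) \<in> Hom C W (mobj M)"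
    and x: "x \<in> Hom C W X"
  shows "faa_app C f (h ` S) a x = faa_app C f S (\<lambda>i. a (h i)) x"
proof -
  obtain xs where xs: "distinct xs" "set xs = S"
    using finite_distinct_list[OF S] by blast
  have "faa_app C f (set (map h xs)) a x = apply_map C (coeff f (length (map h xs))) (map a (map h xs)) x"
    using h xs a by (intro faa_app_set[OF _ _ x]) (auto simp: distinct_map)
  moreover have "faa_app C f (set xs) (\<lambda>i. a (h i)) x
      = apply_map C (coeff f (length xs)) (map (\<lambda>i. a (h i)) xs) x"
    using xs a by (intro faa_app_set[OF _ _ x]) auto
  ultimately show ?thesis
    using xs(2) by (simp add: comp_def)
qed

section \<open>Multi-additivity of evaluation on a finite set\<close>

lemma faa_app_plus:
  assumes S: "finite S" "i \<in> S"
    and a: "\<And>j. j \<in> S \<Longrightarrow> a j \<in> Hom C W (mobj M)" "\<And>j. j \<in> S \<Longrightarrow> b j \<in> Hom C W (mobj M)"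
    and x: "x \<in> Hom C W X"
    and c: "c i = plus_map C M (a i) (b i)" "\<And>j. j \<in> S \<Longrightarrow> j \<noteq> i \<Longrightarrow> a j = c j"
      "\<And>j. j \<in> S \<Longrightarrow> j \<noteq> i \<Longrightarrow> b j = c j"
  shows "faa_app C f S c x = plus_map C N (faa_app C f S a x) (faa_app C f S b x)"
proof -
  obtain xs where xs: "distinct xs" "set xs = S"
    using finite_distinct_list[OF S(1)] by blast
  then obtain k where k: "k < length xs" "xs ! k = i"
    using S(2) by (metis in_set_conv_nth)
  let ?zs = "map c xs"
  have upd: "map d xs = ?zs[k := d i]" if "\<And>j. j \<in> S \<Longrightarrow> j \<noteq> i \<Longrightarrow> d j = c j" for d
    using that xs k by (intro nth_equalityI) (auto simp: nth_list_update nth_eq_iff_index_eq)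
  have "c j \<in> Hom C W (mobj M)" if "j \<in> S" for j
    using that c a plus_map_Hom[OF fD(1)] by metis
  moreover have "Suc 0 \<le> length xs"
    using k by simp
  ultimately have "apply_map C (coeff f (length xs)) (?zs[k := plus_map C M (a i) (b i)]) x
      = plus_map C N (apply_map C (coeff f (length xs)) (?zs[k := a i]) x)
          (apply_map C (coeff f (length xs)) (?zs[k := b i]) x)"
    using k a S xs by (intro additive_mapD(1)[OF fD(8) _ _ x]) auto
  then show ?thesis
    using upd[of a] upd[of b] upd[of c] c a xs
      faa_app_set[OF xs(1) _ x, of a] faa_app_set[OF xs(1) _ x, of b] faa_app_set[OF xs(1) _ x, of c]
      \<open>\<And>j. j \<in> S \<Longrightarrow> c j \<in> Hom C W (mobj M)\<close>
    by simp
qed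

lemma faa_app_zero:
  assumes S: "finite S" "i \<in> S" and a: "\<And>j. j \<in> S \<Longrightarrow> a j \<in> Hom C W (mobj M)"
    and x: "x \<in> Hom C W X" and i: "a i = zero_map C M W"
  shows "faa_app C f S a x = zero_map C N W"
proof -
  obtain xs where xs: "distinct xs" "set xs = S"
    using finite_distinct_list[OF S(1)] by blast
  then obtain k where k: "k < length xs" "xs ! k = i"
    using S(2) by (metis in_set_conv_nth)
  have "(map a xs)[k := zero_map C M W] = map a xs"
    using i k by (metis length_map list_update_id nth_map)
  moreover have "apply_map C (coeff f (length xs)) ((map a xs)[k := zero_map C M W]) x = zero_map C N W"
    using k a xs by (intro additive_mapD(2)[OF fD(8) _ _ x]) auto
  ultimately show ?thesis
    using faa_app_set[OF xs(1) _ x, of a] a xs by simp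
qed

lemma faa_app_sum_one:
  assumes S: "finite S" "i \<in> S" and K: "finite K"
    and a: "\<And>j. j \<in> S \<Longrightarrow> j \<noteq> i \<Longrightarrow> a j \<in> Hom C W (mobj M)"
    and b: "\<And>q. q \<in> K \<Longrightarrow> b q \<in> Hom C W (mobj M)"
    and x: "x \<in> Hom C W X"
  shows "faa_app C f S (a(i := sum_map C M W b K)) x
    = sum_map C N W (\<lambda>q. faa_app C f S (a(i := b q)) x) K"
proof -
  interpret M: cmon_in_cartesian C M
    by unfold_locales (rule fD)
  interpret N: cmon_in_cartesian C N
    by unfold_locales (rule fD)
  have W: "W \<in> Obj C"
    by (rule Hom_Dom[OF x])
  have cl: "faa_app C f S (a(i := d)) x \<in> Hom C W (mobj N)" if "d \<in> Hom C W (mobj M)" for d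
    using that a S x by (intro faa_app_Hom) auto
  show ?thesis
    using K b
  proof (induction K)
    case empty
    show ?case
      using a S x W zero_map_Hom[OF fD(1) W]
      by (simp add: M.sum_empty N.sum_empty) (rule faa_app_zero[of S i], auto)
  next
    case (insert q K)
    have s: "sum_map C M W b K \<in> Hom C W (mobj M)"
      using insert by (intro M.sum_closed[OF W]) auto
    have "faa_app C f S (a(i := sum_map C M W b (insert q K))) x
        = plus_map C N (faa_app C f S (a(i := b q)) x) (faa_app C f S (a(i := sum_map C M W b K)) x)"
      using insert s a S x by (intro faa_app_plus[of S i]) (auto simp: M.sum_insert[OF W])
    also have "faa_app C f S (a(i := sum_map C M W b K)) x
        = sum_map C N W (\<lambda>q. faa_app C f S (a(i := b q)) x) K"
      using insert by blast
    also have "plus_map C N (faa_app C f S (a(i := b q)) x) \<dots>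
        = sum_map C N W (\<lambda>q. faa_app C f S (a(i := b q)) x) (insert q K)"
      using insert cl by (intro N.sum_insert[OF W, symmetric]) auto
    finally show ?case .
  qed
qed

text \<open>Distributivity: a multi-additive map at sums in every argument expands into one term for
  each choice of a summand per argument. For empty \<open>S\<close> the value lies in
  \<open>Y\<close>, where there is no addition, whence \<open>S \<noteq> {}\<close>.\<close>

lemma faa_app_sum:
  assumes S: "finite S" and K: "\<And>i. i \<in> S \<Longrightarrow> finite (K i)"
    and b: "\<And>i q. i \<in> S \<Longrightarrow> q \<in> K i \<Longrightarrow> b i q \<in> Hom C W (mobj M)"
    and x: "x \<in> Hom C W X" and "S \<noteq> {}"
  shows "faa_app C f S (\<lambda>i. sum_map C M W (b i) (K i)) x
    = sum_map C N W (\<lambda>\<sigma>. faa_app C f S (\<lambda>i. b i (\<sigma> i)) x) (PiE S K)"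
proof -
  interpret M: cmon_in_cartesian C M
    by unfold_locales (rule fD)
  interpret N: cmon_in_cartesian C N
    by unfold_locales (rule fD)
  have W: "W \<in> Obj C"
    by (rule Hom_Dom[OF x])
  let ?s = "\<lambda>i. sum_map C M W (b i) (K i)"
  have s: "?s i \<in> Hom C W (mobj M)" if "i \<in> S" for i
    using that b by (intro M.sum_closed[OF W]) auto
  \<comment> \<open>The induction expands the arguments in \<open>T\<close> and leaves the full sums
    at the others; \<open>T = S\<close> is the claim.\<close>
  have "faa_app C f S ?s x
      = sum_map C N W (\<lambda>\<sigma>. faa_app C f S (\<lambda>i. if i \<in> T then b i (\<sigma> i) else ?s i) x) (PiE T K)"
    if "T \<subseteq> S" for T
    using finite_subset[OF that S] that
  proof (induction T)
    case empty
    have "faa_app C f S ?s x \<in> Hom C W (mobj N)"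
      using s S x \<open>S \<noteq> {}\<close> by (intro faa_app_Hom) auto
    then show ?case
      by (simp add: N.sum_singleton[OF W])
  next
    case (insert k T)
    have kT: "k \<in> S" "T \<subseteq> S" "k \<notin> T"
      using insert by auto
    let ?F = "\<lambda>\<sigma>. \<lambda>i. if i \<in> T then b i (\<sigma> i) else ?s i"
    let ?G = "\<lambda>\<sigma>. faa_app C f S (\<lambda>i. if i \<in> insert k T then b i (\<sigma> i) else ?s i) x"
    have F: "?F \<sigma> i \<in> Hom C W (mobj M)" if "\<sigma> \<in> PiE T K" "i \<in> S" for \<sigma> i
      using that s b kT by (auto simp: PiE_iff)
    have 1: "faa_app C f S (?F \<sigma>) x = sum_map C N W (\<lambda>q. faa_app C f S ((?F \<sigma>)(k := b k q)) x) (K k)"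
      if "\<sigma> \<in> PiE T K" for \<sigma>
    proof -
      \<comment> \<open>As \<open>k\<close> lies outside \<open>T\<close>, position \<open>k\<close>
        still carries its full sum and may be written as an update.\<close>
      have "?F \<sigma> = (?F \<sigma>)(k := sum_map C M W (b k) (K k))"
        using kT by auto
      then have "faa_app C f S (?F \<sigma>) x
          = faa_app C f S ((?F \<sigma>)(k := sum_map C M W (b k) (K k))) x"
        by (rule arg_cong)
      also have "\<dots> = sum_map C N W (\<lambda>q. faa_app C f S ((?F \<sigma>)(k := b k q)) x) (K k)"
        using F[OF that] K b kT by (intro faa_app_sum_one[OF S kT(1) _ _ _ x]) auto
      finally show ?thesis .
    qed
    have 2: "faa_app C f S ((?F \<sigma>)(k := b k q)) x = ?G (\<sigma>(k := q))" for \<sigma> q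
      using kT by (intro arg_cong[where f = "\<lambda>a. faa_app C f S a x"]) auto
    have G: "?G \<sigma> \<in> Hom C W (mobj N)" if "\<sigma> \<in> PiE (insert k T) K" for \<sigma>
      using that s b kT S x \<open>S \<noteq> {}\<close> by (intro faa_app_Hom) (auto simp: PiE_iff)
    have upd: "\<sigma>(k := q) \<in> PiE (insert k T) K" if "\<sigma> \<in> PiE T K" "q \<in> K k" for \<sigma> q
      using that by (auto simp: PiE_iff extensional_def)
    \<comment> \<open>The uncurried summand turns the two nested sums into one sum over pairs, which
      can be reindexed by the choice functions on \<open>insert k T\<close>.\<close>
    define H where "H = (\<lambda>(\<sigma>, q). ?G (\<sigma>(k := q)))"
    have H: "H p \<in> Hom C W (mobj N)" if p: "p \<in> PiE T K \<times> K k" for p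
    proof -
      obtain \<sigma> q where p: "p = (\<sigma>, q)" "\<sigma> \<in> PiE T K" "q \<in> K k"
        using p by blast
      show ?thesis
        unfolding H_def p(1) prod.case by (rule G[OF upd[OF p(2,3)]])
    qed
    have "faa_app C f S ?s x = sum_map C N W
        (\<lambda>\<sigma>. sum_map C N W (\<lambda>q. H (\<sigma>, q)) (K k)) (PiE T K)"
      unfolding insert.IH[OF kT(2)]
    proof (rule N.sum_cong[OF W refl])
      fix \<sigma> assume \<sigma>: "\<sigma> \<in> PiE T K"
      show "faa_app C f S (?F \<sigma>) x = sum_map C N W (\<lambda>q. H (\<sigma>, q)) (K k)"
        unfolding H_def prod.case 1[OF \<sigma>] 2 ..
      show "sum_map C N W (\<lambda>q. H (\<sigma>, q)) (K k) \<in> Hom C W (mobj N)"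
        using H \<sigma> by (intro N.sum_closed[OF W]) blast
    qed
    also have "\<dots> = sum_map C N W H (PiE T K \<times> K k)"
      using insert.hyps(1) kT K H by (intro N.sum_Sigma[OF W]) (blast intro: finite_PiE)+
    also have "\<dots> = sum_map C N W (\<lambda>p. ?G ((\<lambda>(\<sigma>, q). \<sigma>(k := q)) p)) (PiE T K \<times> K k)"
      unfolding H_def
      by (rule arg_cong[where f = "\<lambda>h. sum_map C N W h (PiE T K \<times> K k)"], rule ext) (simp only: prod.case prod.inject split: prod.split, simp)
    also have "\<dots> = sum_map C N W ?G ((\<lambda>(\<sigma>, q). \<sigma>(k := q)) ` (PiE T K \<times> K k))"
    proof (rule N.sum_reindex[OF W, symmetric])
      show "inj_on (\<lambda>(\<sigma>, q). \<sigma>(k := q)) (PiE T K \<times> K k)"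
      \<comment> \<open>A choice function on \<open>T\<close> has the default value at
        \<open>k\<close>, so no information is lost by overwriting it there.\<close>
      proof (rule inj_onI, clarify)
        fix \<sigma> q \<tau> r assume st: "\<sigma> \<in> PiE T K" "\<tau> \<in> PiE T K" and e: "\<sigma>(k := q) = \<tau>(k := r)"
        have "\<sigma> i = \<tau> i" for i
          using fun_cong[OF e, of i] PiE_arb[OF st(1) kT(3)] PiE_arb[OF st(2) kT(3)]
          by (cases "i = k") simp_all
        then have "\<sigma> = \<tau>"
          by (rule ext)
        moreover have "q = r"
          using fun_cong[OF e, of k] by simp
        ultimately show "\<sigma> = \<tau> \<and> q = r" ..
      qed
      fix p assume "p \<in> PiE T K \<times> K k"
      then show "?G ((\<lambda>(\<sigma>, q). \<sigma>(k := q)) p) \<in> Hom C W (mobj N)"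
        using H[of p] unfolding H_def by (cases p) (simp only: prod.case)+
    qed
    also have "(\<lambda>(\<sigma>, q). \<sigma>(k := q)) ` (PiE T K \<times> K k) = PiE (insert k T) K"
      unfolding PiE_insert_eq by force
    finally show ?case .
  qed
  from this[OF order_refl] have "faa_app C f S ?s x
      = sum_map C N W (\<lambda>\<sigma>. faa_app C f S (\<lambda>i. if i \<in> S then b i (\<sigma> i) else ?s i) x) (PiE S K)" .
  also have "\<dots> = sum_map C N W (\<lambda>\<sigma>. faa_app C f S (\<lambda>i. b i (\<sigma> i)) x) (PiE S K)"
  proof (rule N.sum_cong[OF W refl])
    fix \<sigma> assume \<sigma>: "\<sigma> \<in> PiE S K"
    show "faa_app C f S (\<lambda>i. if i \<in> S then b i (\<sigma> i) else ?s i) x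
        = faa_app C f S (\<lambda>i. b i (\<sigma> i)) x"
      by (rule faa_app_cong[OF S]) simp
    show "faa_app C f S (\<lambda>i. b i (\<sigma> i)) x \<in> Hom C W (mobj N)"
      using \<sigma> \<open>S \<noteq> {}\<close> by (intro faa_app_Hom[OF S _ x]) (auto intro: b)
  qed
  finally show ?thesis .
qed

end

text \<open>Lists with one updated entry are awkward for coefficients built from sums over subsets.
  Here symmetry and additivity are tested on families of arguments instead; the family of
  projections recovers \<open>symmetric_map\<close>.\<close>

lemma Faa_HomI:
  assumes M: "comm_monoid_in C M" and X: "X \<in> Obj C" and N: "comm_monoid_in C N" and Y: "Y \<in> Obj C"
    and c0: "c 0 \<in> Hom C X Y"
    and cn: "\<And>n. 1 \<le> n \<Longrightarrow> c n \<in> Hom C (pow_prod C (mobj M) n X) (mobj N)"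
    and sym: "\<And>n \<sigma> W a x. 1 \<le> n \<Longrightarrow> \<sigma> permutes {0..<n} \<Longrightarrow>
      (\<And>i. i < n \<Longrightarrow> a i \<in> Hom C W (mobj M)) \<Longrightarrow> x \<in> Hom C W X \<Longrightarrow>
      apply_map C (c n) (map (\<lambda>i. a (\<sigma> i)) [0..<n]) x = apply_map C (c n) (map a [0..<n]) x"
    and plus: "\<And>n W a b d x i. i < n \<Longrightarrow> (\<And>j. j < n \<Longrightarrow> a j \<in> Hom C W (mobj M)) \<Longrightarrow>
      (\<And>j. j < n \<Longrightarrow> b j \<in> Hom C W (mobj M)) \<Longrightarrow> (\<And>j. j < n \<Longrightarrow> d j \<in> Hom C W (mobj M)) \<Longrightarrow>
      x \<in> Hom C W X \<Longrightarrow> d i = plus_map C M (a i) (b i) \<Longrightarrow> (\<And>j. j \<noteq> i \<Longrightarrow> a j = d j) \<Longrightarrow>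
      (\<And>j. j \<noteq> i \<Longrightarrow> b j = d j) \<Longrightarrow>
      apply_map C (c n) (map d [0..<n]) x
        = plus_map C N (apply_map C (c n) (map a [0..<n]) x) (apply_map C (c n) (map b [0..<n]) x)"
    and zero: "\<And>n W a x i. i < n \<Longrightarrow> (\<And>j. j < n \<Longrightarrow> a j \<in> Hom C W (mobj M)) \<Longrightarrow>
      x \<in> Hom C W X \<Longrightarrow> a i = zero_map C M W \<Longrightarrow>
      apply_map C (c n) (map a [0..<n]) x = zero_map C N W"
  shows "FaaMap (M, X) (N, Y) c \<in> Hom (Faa C) (M, X) (N, Y)"
proof -
  note A = comm_monoid_in_Obj[OF M]
  have "symmetric_map C (c n) (mobj M) n X" if n: "1 \<le> n" for n
    unfolding symmetric_map_def
  proof (intro allI impI)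
    fix \<sigma> assume "\<sigma> permutes {..<n}"
    then have "\<sigma> permutes {0..<n}"
      by (simp add: atLeast0LessThan)
    from sym[OF n this, of "proj C (mobj M) n X", OF proj_Hom[OF A X] proj_last_Hom[OF A X]]
    show "apply_map C (c n) (map (\<lambda>i. proj C (mobj M) n X (\<sigma> i)) [0..<n]) (proj C (mobj M) n X n) = c n"
      using apply_map_projs[OF A X cn[OF n]] by simp
  qed
  moreover have "additive_map C (c n) M n X N" if "1 \<le> n" for n
    unfolding additive_map_def
  proof (intro ballI allI impI conjI)
    fix W zs x i
    assume W: "W \<in> Obj C" and i: "i < n"
      and *: "length zs = n \<and> set zs \<subseteq> Hom C W (mobj M) \<and> x \<in> Hom C W X"
    have upd: "zs[i := v] = map ((\<lambda>j. zs ! j)(i := v)) [0..<n]" for v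
      using * i by (intro nth_equalityI) (auto simp: nth_list_update)
    have z: "zs ! j \<in> Hom C W (mobj M)" if "j < n" for j
      using * that by (auto simp: subset_iff)
    show "apply_map C (c n) (zs[i := zero_map C M W]) x = zero_map C N W"
      unfolding upd using z * zero_map_Hom[OF M W] by (intro zero[OF i]) auto
    fix a b assume "a \<in> Hom C W (mobj M)" "b \<in> Hom C W (mobj M)"
    then show "apply_map C (c n) (zs[i := plus_map C M a b]) x =
        plus_map C N (apply_map C (c n) (zs[i := a]) x) (apply_map C (c n) (zs[i := b]) x)"
      unfolding upd using z * plus_map_Hom[OF M] by (intro plus[OF i]) auto
  qed
  ultimately show ?thesis
    using M X N Y c0 cn by (simp add: Faa_Hom_iff is_faa_map_def is_faa_obj_def)
qed

end

section \<open>Set partitions\<close>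

abbreviation parts :: "'i set \<Rightarrow> 'i set set set" where
  "parts S \<equiv> {P. partition_on S P}"

lemma partition_on_finite_block: "partition_on S P \<Longrightarrow> finite S \<Longrightarrow> B \<in> P \<Longrightarrow> finite B"
  by (metis Union_upper finite_subset partition_onD1)

lemma partition_on_block_subset: "partition_on S P \<Longrightarrow> B \<in> P \<Longrightarrow> B \<subseteq> S"
  using partition_onD1 by blast

lemma partition_on_block_nonempty: "partition_on S P \<Longrightarrow> B \<in> P \<Longrightarrow> B \<noteq> {}"
  using partition_onD3 by blast

lemma partition_on_block_eq:
  "partition_on S P \<Longrightarrow> B \<in> P \<Longrightarrow> B' \<in> P \<Longrightarrow> i \<in> B \<Longrightarrow> i \<in> B' \<Longrightarrow> B = B'"
  using partition_onD2[of S P] by (auto simp: disjoint_def)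

lemma partition_on_blockI:
  assumes "\<Union>P = S" "\<And>p. p \<in> P \<Longrightarrow> p \<noteq> {}"
    and "\<And>p q i. p \<in> P \<Longrightarrow> q \<in> P \<Longrightarrow> i \<in> p \<Longrightarrow> i \<in> q \<Longrightarrow> p = q"
  shows "partition_on S P"
proof (rule partition_onI)
  show "\<Union>P = S" "{} \<notin> P"
    using assms by auto
  show "disjnt p q" if "p \<in> P" "q \<in> P" "p \<noteq> q" for p q
    using assms(3)[OF that(1,2)] that(3) by (auto simp: disjnt_iff)
qed

lemma partition_on_eq_empty: "partition_on S P \<Longrightarrow> P = {} \<longleftrightarrow> S = {}"
  using partition_onD1[of S P] partition_onD3[of S P] by auto

lemma partition_on_insert_singleton:
  assumes "z \<notin> S" "partition_on S P"
  shows "partition_on (insert z S) (insert {z} P)"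
proof -
  have "disjnt {z} (\<Union>P)"
    using assms partition_onD1[OF assms(2)] by (simp add: disjnt_def)
  moreover have "insert z S - {z} = S"
    using assms by simp
  ultimately show ?thesis
    using assms by (simp add: partition_on_insert)
qed

lemma partition_on_insert_into_block:
  assumes "z \<notin> S" "partition_on S P" "B \<in> P"
  shows "partition_on (insert z S) (insert (insert z B) (P - {B}))"
proof (rule partition_on_blockI)
  show "\<Union>(insert (insert z B) (P - {B})) = insert z S"
    using assms partition_onD1[OF assms(2)] by blast
  show "p \<noteq> {}" if "p \<in> insert (insert z B) (P - {B})" for p
    using that partition_on_block_nonempty[OF assms(2)] by blast
  have zP: "z \<notin> q" if "q \<in> P" for q
    using that assms(1) partition_on_block_subset[OF assms(2)] by blast
  have eq: "q = B" if "q \<in> P" "i \<in> q" "i \<in> B" for q i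
    using that partition_on_block_eq[OF assms(2) _ assms(3)] by blast
  have neq: False if "q \<in> P - {B}" "i \<in> insert z B" "i \<in> q" for q i
    using that zP[of q] eq[of q i] by auto
  have eq': "p = q" if "p \<in> P - {B}" "q \<in> P - {B}" "i \<in> p" "i \<in> q" for p q i
    using that partition_on_block_eq[OF assms(2)] by blast
  show "p = q" if "p \<in> insert (insert z B) (P - {B})" "q \<in> insert (insert z B) (P - {B})"
    "i \<in> p" "i \<in> q" for p q i
    using that(1,2) neq[OF _ _ that(3)] neq[OF _ _ that(4)] eq'[OF _ _ that(3,4)] that(3,4)
    by (elim insertE) simp_all
qed

text \<open>Deleting \<open>z\<close> from a partition of \<open>insert z S\<close> leaves a
  partition of \<open>S\<close>: the block of \<open>z\<close> either vanishes or shrinks to some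
  block \<open>B\<close>. The two cases are the two images on the right.\<close>

lemma parts_insert:
  assumes z: "z \<notin> S"
  shows "parts (insert z S) = insert {z} ` parts S \<union>
    (\<lambda>(P, B). insert (insert z B) (P - {B})) ` (SIGMA P : parts S. P)" (is "_ = ?R")
proof
  show "?R \<subseteq> parts (insert z S)"
    using partition_on_insert_singleton[OF z] partition_on_insert_into_block[OF z] by auto
  show "parts (insert z S) \<subseteq> ?R"
  proof clarify
    fix Q assume Q: "partition_on (insert z S) Q" "Q \<notin> (\<lambda>(P, B). insert (insert z B) (P - {B})) ` (SIGMA P : parts S. P)"
    obtain B where B: "B \<in> Q" "z \<in> B"
      using partition_onD1[OF Q(1)] by blast
    have zB: "z \<notin> B'" if "B' \<in> Q - {B}" for B'
      using partition_on_block_eq[OF Q(1)] B that by blast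
    have "partition_on S (insert (B - {z}) (Q - {B}))" if "B \<noteq> {z}"
    proof (rule partition_on_blockI)
      have "\<Union>(insert (B - {z}) (Q - {B})) = \<Union>Q - {z}"
        using B(1) zB by blast
      then show "\<Union>(insert (B - {z}) (Q - {B})) = S"
        using partition_onD1[OF Q(1)] z by auto
      show "p \<noteq> {}" if "p \<in> insert (B - {z}) (Q - {B})" for p
        using that \<open>B \<noteq> {z}\<close> B partition_on_block_nonempty[OF Q(1)] by blast
      show "p = q" if "p \<in> insert (B - {z}) (Q - {B})" "q \<in> insert (B - {z}) (Q - {B})"
        "i \<in> p" "i \<in> q" for p q i
        using that B(1) partition_on_block_eq[OF Q(1)] by (metis (no_types, lifting) Diff_iff insert_iff)
    qed
    moreover have "Q = insert (insert z (B - {z})) (insert (B - {z}) (Q - {B}) - {B - {z}})"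
      if "B \<noteq> {z}"
    proof -
      \<comment> \<open>A nonempty part of \<open>B\<close> cannot be another block of
        \<open>Q\<close>; so removing the shrunken block below removes nothing else.\<close>
      have "B - {z} \<notin> Q - {B}"
        using that B partition_on_block_eq[OF Q(1)] by blast
      moreover have "insert z (B - {z}) = B"
        using B by blast
      ultimately show ?thesis
        using B by auto
    qed
    ultimately have "B = {z}"
      using Q(2) by (force simp: image_iff)
    moreover have "partition_on S (Q - {{z}})"
    proof (rule partition_on_blockI)
      have "\<Union>(Q - {{z}}) = \<Union>Q - {z}"
        using zB \<open>B = {z}\<close> by blast
      then show "\<Union>(Q - {{z}}) = S"
        using partition_onD1[OF Q(1)] z by auto
      show "p \<noteq> {}" if "p \<in> Q - {{z}}" for p
        using that partition_on_block_nonempty[OF Q(1)] by blast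
      show "p = q" if "p \<in> Q - {{z}}" "q \<in> Q - {{z}}" "i \<in> p" "i \<in> q" for p q i
        using that partition_on_block_eq[OF Q(1)] by blast
    qed
    moreover have "Q = insert {z} (Q - {{z}})"
      using B \<open>B = {z}\<close> by blast
    ultimately show "Q \<in> insert {z} ` parts S"
      by blast
  qed
qed

lemma inj_on_insert_singleton:
  assumes "z \<notin> S"
  shows "inj_on (insert {z}) (parts S)"
proof (rule inj_onI)
  fix P Q assume "P \<in> parts S" "Q \<in> parts S" and e: "insert {z} P = insert {z} Q"
  then have "{z} \<notin> P" "{z} \<notin> Q"
    using assms partition_on_block_subset[of S P "{z}"] partition_on_block_subset[of S Q "{z}"] by auto
  then show "P = Q"
    using e by (metis insert_ident)
qed

text \<open>No block of \<open>P\<close> contains \<open>z\<close>, so the block with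
  \<open>z\<close> in the image reveals \<open>B\<close>, and the rest of the image reveals the
  other blocks.\<close>

lemma inj_on_insert_into_block:
  assumes z: "z \<notin> S"
  shows "inj_on (\<lambda>(P, B). insert (insert z B) (P - {B})) (SIGMA P : parts S. P)"
proof (rule inj_onI, clarify)
  fix P B Q D
  assume P: "partition_on S P" "B \<in> P" and Q: "partition_on S Q" "D \<in> Q"
    and e: "insert (insert z B) (P - {B}) = insert (insert z D) (Q - {D})"
  have zP: "z \<notin> T" if "T \<in> P" for T
    using that partition_on_block_subset[OF P(1)] z by blast
  have zQ: "z \<notin> T" if "T \<in> Q" for T
    using that partition_on_block_subset[OF Q(1)] z by blast
  have "insert z B \<in> insert (insert z D) (Q - {D})"
    using e by blast
  then have "insert z B = insert z D"
    using zQ by blast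
  then have BD: "B = D"
    using zP[OF P(2)] zQ[OF Q(2)] by (metis insert_ident)
  have "insert z B \<notin> P - {B}" "insert z B \<notin> Q - {B}"
    using zP zQ by blast+
  then have "P - {B} = Q - {B}"
    using e unfolding BD by (metis insert_ident)
  then show "P = Q \<and> B = D"
    using P(2) Q(2) BD by blast
qed

text \<open>The block of \<open>z\<close> is \<open>{z}\<close> on one side and strictly larger on
  the other, because blocks are nonempty. Hence the two images in \<open>parts_insert\<close> are
  disjoint and a sum over their union splits.\<close>

lemma insert_singleton_neq_insert_into_block:
  assumes "z \<notin> S" "partition_on S P" "partition_on S Q" "B \<in> Q"
  shows "insert {z} P \<noteq> insert (insert z B) (Q - {B})"
proof
  assume e: "insert {z} P = insert (insert z B) (Q - {B})"
  have "insert z B \<in> insert {z} P"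
    unfolding e by simp
  moreover have "insert z B \<notin> P"
    using assms(1) partition_on_block_subset[OF assms(2), of "insert z B"] by auto
  ultimately have "insert z B = {z}"
    by blast
  moreover have "B \<noteq> {}" "z \<notin> B"
    using assms(1) partition_on_block_subset[OF assms(3,4)] partition_on_block_nonempty[OF assms(3,4)]
    by auto
  ultimately show False
    by blast
qed

section \<open>Refinements of a partition\<close>

lemma partition_on_Union_refinement:
  assumes P: "partition_on S P" and \<sigma>: "\<And>B. B \<in> P \<Longrightarrow> partition_on B (\<sigma> B)"
  shows "partition_on S (\<Union>(\<sigma> ` P))" and "partition_on (\<Union>(\<sigma> ` P)) (\<sigma> ` P)"
proof -
  have sub: "D \<subseteq> B \<and> D \<noteq> {}" if "D \<in> \<sigma> B" "B \<in> P" for D B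
    using that partition_on_block_subset[OF \<sigma>] partition_on_block_nonempty[OF \<sigma>] by blast
  show "partition_on S (\<Union>(\<sigma> ` P))"
  proof (rule partition_on_blockI)
    show "\<Union>(\<Union>(\<sigma> ` P)) = S"
      using partition_onD1[OF P] partition_onD1[OF \<sigma>] by blast
    show "p \<noteq> {}" if "p \<in> \<Union>(\<sigma> ` P)" for p
      using that sub by blast
    show "p = q" if pq: "p \<in> \<Union>(\<sigma> ` P)" "q \<in> \<Union>(\<sigma> ` P)" "i \<in> p" "i \<in> q" for p q i
    proof -
      obtain B D where BD: "B \<in> P" "p \<in> \<sigma> B" "D \<in> P" "q \<in> \<sigma> D"
        using pq by blast
      then have "i \<in> B" "i \<in> D"
        using pq sub by blast+
      then have "B = D"
        using partition_on_block_eq[OF P] BD by blast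
      then show ?thesis
        using partition_on_block_eq[OF \<sigma>[OF BD(1)]] BD pq by blast
    qed
  qed
  show "partition_on (\<Union>(\<sigma> ` P)) (\<sigma> ` P)"
  proof (rule partition_on_blockI)
    show "p \<noteq> {}" if "p \<in> \<sigma> ` P" for p
      using that partition_on_eq_empty[OF \<sigma>] partition_on_block_nonempty[OF P] by blast
    show "p = q" if pq: "p \<in> \<sigma> ` P" "q \<in> \<sigma> ` P" "r \<in> p" "r \<in> q" for p q r
    proof -
      obtain B D where BD: "B \<in> P" "p = \<sigma> B" "D \<in> P" "q = \<sigma> D"
        using pq by blast
      have "\<exists>i. i \<in> r" "r \<subseteq> B" "r \<subseteq> D"
        using sub[of r] pq BD by auto
      then have "B = D"
        using partition_on_block_eq[OF P BD(1,3)] by blast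
      then show ?thesis
        using BD by simp
    qed
  qed simp
qed

text \<open>The union of the chosen partitions is a finer partition \<open>Q\<close>; the set of
  them records which blocks of \<open>Q\<close> come from the same coarse block. Conversely, a class
  \<open>D\<close> of blocks of \<open>Q\<close> gives back the coarse block
  \<open>\<Union>D\<close>. This is the combinatorial content of functoriality.\<close>

lemma bij_betw_refinements:
  "bij_betw (\<lambda>(P, \<sigma>). (\<Union>(\<sigma> ` P), \<sigma> ` P)) (SIGMA P : parts S. PiE P parts)
    (SIGMA Q : parts S. parts Q)"
  unfolding bij_betw_def
proof
  show "inj_on (\<lambda>(P, \<sigma>). (\<Union>(\<sigma> ` P), \<sigma> ` P)) (SIGMA P : parts S. PiE P parts)"
  proof (rule inj_onI, clarify)
    fix P \<sigma> Q \<tau>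
    assume \<sigma>: "\<sigma> \<in> PiE P parts" and \<tau>: "\<tau> \<in> PiE Q parts" and e: "\<sigma> ` P = \<tau> ` Q"
    have s: "\<Union>(\<sigma> B) = B" if "B \<in> P" for B
      using \<sigma> that partition_onD1 by (auto simp: PiE_iff)
    have t: "\<Union>(\<tau> B) = B" if "B \<in> Q" for B
      using \<tau> that partition_onD1 by (auto simp: PiE_iff)
    \<comment> \<open>Each block is the union of its own partition, so the coarse partition can be
      recovered from the image of the choice function.\<close>
    have "P = Union ` \<sigma> ` P" "Q = Union ` \<tau> ` Q"
      using s t by (force simp: image_iff)+
    then have PQ: "P = Q"
      using e by simp
    moreover have "\<sigma> B = \<tau> B" for B
    proof (cases "B \<in> P")
      case True
      then obtain D where "D \<in> Q" "\<sigma> B = \<tau> D"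
        using e by blast
      then show ?thesis
        using s[OF True] t by metis
    next
      case False
      then show ?thesis
        using PQ PiE_arb[OF \<sigma>] PiE_arb[OF \<tau>] by metis
    qed
    ultimately show "P = Q \<and> \<sigma> = \<tau>"
      by blast
  qed
  show "(\<lambda>(P, \<sigma>). (\<Union>(\<sigma> ` P), \<sigma> ` P)) ` (SIGMA P : parts S. PiE P parts)
    = (SIGMA Q : parts S. parts Q)" (is "?L = ?R")
  proof
    show "?L \<subseteq> ?R"
      using partition_on_Union_refinement by (fastforce simp: PiE_iff)
    show "?R \<subseteq> ?L"
    proof clarify
      fix Q R assume Q: "partition_on S Q" and R: "partition_on Q R"
      have sub: "D \<in> R \<Longrightarrow> B \<in> D \<Longrightarrow> B \<in> Q" for D B
        using partition_onD1[OF R] by blast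
      have block: "D = E" if "D \<in> R" "E \<in> R" "i \<in> \<Union>D" "i \<in> \<Union>E" for D E i
        using that sub partition_on_block_eq[OF Q] partition_on_block_eq[OF R] by (metis UnionE)
      have ne: "\<exists>i. i \<in> \<Union>D" if "D \<in> R" for D
        using partition_on_block_nonempty[OF R that] partition_on_block_nonempty[OF Q sub[OF that]]
        by blast
      \<comment> \<open>Distinct classes have disjoint nonempty unions, so a coarse block determines
        its class and \<open>inv_into\<close> gives the choice function; its restriction to
        \<open>P\<close> puts it into \<open>PiE\<close>.\<close>
      have inj: "inj_on Union R"
        using block ne by (intro inj_onI) metis
      define P where "P = Union ` R"
      define \<sigma> where "\<sigma> = restrict (inv_into R Union) P"
      have \<sigma>: "\<sigma> (\<Union>D) = D" if "D \<in> R" for D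
        using that inj by (simp add: \<sigma>_def P_def)
      have "partition_on S P"
      proof (rule partition_on_blockI)
        show "\<Union>P = S"
          unfolding P_def using partition_onD1[OF Q] partition_onD1[OF R] by blast
        show "p \<noteq> {}" if "p \<in> P" for p
          using that ne unfolding P_def by blast
        show "p = q" if "p \<in> P" "q \<in> P" "i \<in> p" "i \<in> q" for p q i
          using that block unfolding P_def by blast
      qed
      moreover have "partition_on (\<Union>D) D" if "D \<in> R" for D
        using sub[OF that] partition_on_block_eq[OF Q] partition_on_block_nonempty[OF Q]
        by (intro partition_on_blockI) blast+
      then have "\<sigma> \<in> PiE P parts"
        using \<sigma> by (auto simp: PiE_iff P_def \<sigma>_def)
      moreover have "\<sigma> ` P = R"
        using \<sigma> by (force simp: P_def image_iff)
      moreover have "\<Union>R = Q"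
        using partition_onD1[OF R] by simp
      ultimately show "(Q, R) \<in> ?L"
        by (auto simp: image_iff intro!: bexI[of _ "(P, \<sigma>)"])
    qed
  qed
qed

section \<open>Sums over the partitions of a finite set\<close>

context cmon_in_cartesian
begin

text \<open>The sum is arranged by the partition that remains when \<open>z\<close> is deleted. The
  two parts of each summand are shaped like the two parts of \<open>delta1_coeff\<close>, with
  blocks in the place of arguments.\<close>

lemma sum_parts_insert:
  assumes W: "W \<in> Obj C" and S: "finite S" "z \<notin> S"
    and F: "\<And>Q. partition_on (insert z S) Q \<Longrightarrow> F Q \<in> Hom C W (mobj M)"
  shows "sum_map C M W F (parts (insert z S)) = sum_map C M W
    (\<lambda>P. plus_map C M (F (insert {z} P)) (sum_map C M W (\<lambda>B. F (insert (insert z B) (P - {B}))) P))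
    (parts S)"
proof -
  let ?g = "\<lambda>(P, B). insert (insert z B) (P - {B})"
  let ?I = "insert {z} ` parts S" and ?J = "?g ` (SIGMA P : parts S. P)"
  have fin: "finite (parts S)" "\<And>P. P \<in> parts S \<Longrightarrow> finite P"
    using S(1) finitely_many_partition_on finite_elements by auto
  have F1: "F (insert {z} P) \<in> Hom C W (mobj M)" if "P \<in> parts S" for P
    using that F[OF partition_on_insert_singleton[OF S(2)]] by blast
  have F2: "F (insert (insert z B) (P - {B})) \<in> Hom C W (mobj M)" if "P \<in> parts S" "B \<in> P" for P B
    using that F[OF partition_on_insert_into_block[OF S(2)]] by blast
  have "sum_map C M W F (?I \<union> ?J) = plus_map C M (sum_map C M W F ?I) (sum_map C M W F ?J)"
  proof (rule sum_Un_disjoint[OF W])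
    show "finite ?I" "finite ?J"
      using fin by auto
    show "?I \<inter> ?J = {}"
      using insert_singleton_neq_insert_into_block[OF S(2)] by fastforce
    show "F Q \<in> Hom C W (mobj M)" if "Q \<in> ?I \<union> ?J" for Q
      using that F1 F2 by auto
  qed
  moreover have "sum_map C M W F ?I = sum_map C M W (\<lambda>P. F (insert {z} P)) (parts S)"
    using F1 by (intro sum_reindex[OF W inj_on_insert_singleton[OF S(2)]])
  moreover have "sum_map C M W F ?J = sum_map C M W (\<lambda>p. F (?g p)) (SIGMA P : parts S. P)"
    using F2 by (intro sum_reindex[OF W inj_on_insert_into_block[OF S(2)]]) auto
  moreover have "\<dots> = sum_map C M W (\<lambda>P. sum_map C M W (\<lambda>B. F (?g (P, B))) P) (parts S)"
    using F2 fin by (intro sum_Sigma[OF W, symmetric]) auto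
  ultimately have "sum_map C M W F (?I \<union> ?J)
      = plus_map C M (sum_map C M W (\<lambda>P. F (insert {z} P)) (parts S))
          (sum_map C M W (\<lambda>P. sum_map C M W (\<lambda>B. F (insert (insert z B) (P - {B}))) P) (parts S))"
    by simp
  also have "\<dots> = sum_map C M W (\<lambda>P. plus_map C M (F (insert {z} P))
      (sum_map C M W (\<lambda>B. F (insert (insert z B) (P - {B}))) P)) (parts S)"
    using F1 F2 by (intro sum_plus[OF W, symmetric]) (auto intro!: sum_closed[OF W])
  finally show ?thesis
    unfolding parts_insert[OF S(2)] .
qed

text \<open>The summand depends on the grouping of the finer blocks alone, that is, on the second
  component under \<open>bij_betw_refinements\<close>; so the coarse partition disappears on
  reindexing.\<close>

lemma sum_refinements:
  assumes W: "W \<in> Obj C" and S: "finite S"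
    and F: "\<And>Q R. partition_on S Q \<Longrightarrow> partition_on Q R \<Longrightarrow> F R \<in> Hom C W (mobj M)"
  shows "sum_map C M W (\<lambda>P. sum_map C M W (\<lambda>\<sigma>. F (\<sigma> ` P)) (PiE P parts)) (parts S)
    = sum_map C M W (\<lambda>Q. sum_map C M W F (parts Q)) (parts S)"
proof -
  let ?h = "\<lambda>(P, \<sigma>). (\<Union>(\<sigma> ` P), \<sigma> ` P)"
  let ?X = "SIGMA P : parts S. PiE P parts" and ?Y = "SIGMA Q : parts S. parts Q"
  have fin: "finite (parts S)" "\<And>P. P \<in> parts S \<Longrightarrow> finite P"
    using S finitely_many_partition_on finite_elements by auto
  have finB: "finite B" if "P \<in> parts S" "B \<in> P" for P B
    using that S partition_on_finite_block by blast
  have bij: "?h ` ?X = ?Y" "inj_on ?h ?X"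
    using bij_betw_refinements[of S] unfolding bij_betw_def by blast+
  have h: "snd (?h p) = snd p ` fst p" for p
    by (cases p) simp
  have F': "F (snd p) \<in> Hom C W (mobj M)" if "p \<in> ?Y" for p
    using that F by auto
  have F'': "F (snd p ` fst p) \<in> Hom C W (mobj M)" if "p \<in> ?X" for p
    using F'[of "?h p"] bij(1) that unfolding h by blast
  have "sum_map C M W (\<lambda>Q. sum_map C M W F (parts Q)) (parts S) = sum_map C M W (\<lambda>p. F (snd p)) ?Y"
    using sum_Sigma[OF W fin(1), of parts "\<lambda>p. F (snd p)"] F fin(2) by (simp add: finitely_many_partition_on)
  also have "\<dots> = sum_map C M W (\<lambda>p. F (snd (?h p))) ?X"
    unfolding bij(1)[symmetric] using F' bij by (intro sum_reindex[OF W bij(2)]) blast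
  also have "\<dots> = sum_map C M W (\<lambda>p. F (snd p ` fst p)) ?X"
    unfolding h ..
  also have "\<dots> = sum_map C M W (\<lambda>P. sum_map C M W (\<lambda>\<sigma>. F (\<sigma> ` P)) (PiE P parts)) (parts S)"
  proof -
    have "finite (PiE P parts)" if "P \<in> parts S" for P
      using that fin(2) finB finitely_many_partition_on by (intro finite_PiE) blast+
    moreover have "F (\<sigma> ` P) \<in> Hom C W (mobj M)" if "P \<in> parts S" "\<sigma> \<in> PiE P parts" for P \<sigma>
      using F''[of "(P, \<sigma>)"] that by simp
    ultimately show ?thesis
      using sum_Sigma[OF W fin(1), of "\<lambda>P. PiE P parts" "\<lambda>p. F (snd p ` fst p)"] by simp
  qed
  finally show ?thesis ..
qed

end

section \<open>Jets\<close>

text \<open>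
  A jet over a set \<open>S\<close> of indices models a point whose coordinates are polynomials in infinitesimals
  \<open>\<epsilon>\<^sub>i\<close>, \<open>i \<in> S\<close>, with \<open>\<epsilon>\<^sub>i\<^sup>2 = 0\<close>: the base point lies in \<open>X\<close>, and the coefficient of the
  monomial \<open>\<Prod>\<^bsub>i \<in> T\<^esub> \<epsilon>\<^sub>i\<close>, for \<open>T\<close> nonempty, lies in \<open>A\<close>.
\<close>

definition jets :: "('o, 'm) cart \<Rightarrow> 'o \<Rightarrow> ('o, 'm) faa_obj \<Rightarrow> 'i set \<Rightarrow> ('i set \<Rightarrow> 'm) set" where
  "jets C W P S = {c. \<forall>T. T \<subseteq> S \<longrightarrow> c T \<in> Hom C W (if T = {} then snd P else mobj (fst P))}"

text \<open>The only partition of the empty set is the empty one, but its term lies in the base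
  object, where there is no addition; hence the separate case. The source of the sum is read off the
  base point.\<close>

definition jet_map :: "('o, 'm) cart \<Rightarrow> ('o, 'm) faa_map \<Rightarrow> ('i set \<Rightarrow> 'm) \<Rightarrow> 'i set \<Rightarrow> 'm" where
  "jet_map C f c S = (if S = {} then c {} \<Zcomp>\<^bsub>C\<^esub> coeff f 0
     else sum_map C (fst (fcod f)) (Dom C (c {})) (\<lambda>P. faa_app C f P c (c {})) {P. partition_on S P})"

lemma jetsI:
  "c {} \<in> Hom C W X \<Longrightarrow> (\<And>T. T \<subseteq> S \<Longrightarrow> T \<noteq> {} \<Longrightarrow> c T \<in> Hom C W (mobj M)) \<Longrightarrow>
    c \<in> jets C W (M, X) S"
  by (simp add: jets_def)

lemma jets_point:
  assumes "c \<in> jets C W (M, X) S"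
  shows "c {} \<in> Hom C W X"
proof -
  have "c {} \<in> Hom C W (if {} = ({} :: 'a set) then snd (M, X) else mobj (fst (M, X)))"
    using assms empty_subsetI unfolding jets_def by blast
  then show ?thesis
    by simp
qed

lemma jets_Hom:
  assumes "c \<in> jets C W (M, X) S" "T \<subseteq> S" "T \<noteq> {}"
  shows "c T \<in> Hom C W (mobj M)"
proof -
  have "c T \<in> Hom C W (if T = {} then snd (M, X) else mobj (fst (M, X)))"
    using assms(1,2) unfolding jets_def by blast
  then show ?thesis
    using assms(3) by simp
qed

lemma jets_mono: "c \<in> jets C W P S \<Longrightarrow> T \<subseteq> S \<Longrightarrow> c \<in> jets C W P T"
  by (auto simp: jets_def)

lemma jets_block:
  "c \<in> jets C W (M, X) S \<Longrightarrow> partition_on S P \<Longrightarrow> B \<in> P \<Longrightarrow> c B \<in> Hom C W (mobj M)"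
  using jets_Hom partition_on_block_subset partition_on_block_nonempty by metis

context cartesian_category
begin

lemma jets_Obj: "c \<in> jets C W (M, X) S \<Longrightarrow> W \<in> Obj C"
  by (rule Hom_Dom[OF jets_point])

context
  fixes f M X N Y
  assumes f: "f \<in> Hom (Faa C) (M, X) (N, Y)"
begin

interpretation N: cmon_in_cartesian C N
  by unfold_locales (rule Faa_HomD(3)[OF f])

lemma jet_map_nonempty:
  assumes "c \<in> jets C W (M, X) S" "S \<noteq> {}"
  shows "jet_map C f c S = sum_map C N W (\<lambda>P. faa_app C f P c (c {})) (parts S)"
proof -
  have "Dom C (c {}) = W"
    using jets_point[OF assms(1)] by (simp add: Hom_def)
  then show ?thesis
    using assms(2) Faa_HomD(10)[OF f] by (simp add: jet_map_def)
qed

lemma jet_term_Hom: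
  assumes "c \<in> jets C W (M, X) S" "finite S" "S \<noteq> {}" "partition_on S P"
  shows "faa_app C f P c (c {}) \<in> Hom C W (mobj N)"
  using assms finite_elements[OF assms(2,4)] partition_on_eq_empty[OF assms(4)]
    jets_block[OF assms(1,4)] jets_point[OF assms(1)]
  by (intro faa_app_Hom[OF f]) auto

lemma jet_map_jets:
  assumes c: "c \<in> jets C W (M, X) S" and S: "finite S"
  shows "jet_map C f c \<in> jets C W (N, Y) S"
proof (rule jetsI)
  show "jet_map C f c {} \<in> Hom C W Y"
    using jets_point[OF c] Faa_HomD(5)[OF f] by (auto simp: jet_map_def intro: Comp_Hom)
  fix T assume T: "T \<subseteq> S" "T \<noteq> {}"
  show "jet_map C f c T \<in> Hom C W (mobj N)"
    using jet_term_Hom[OF jets_mono[OF c T(1)] finite_subset[OF T(1) S] T(2)]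
    unfolding jet_map_nonempty[OF jets_mono[OF c T(1)] T(2)]
    by (intro N.sum_closed[OF jets_Obj[OF c]]) auto
qed

lemma jet_map_cong:
  assumes d: "d \<in> jets C W (M, X) S"
    and S: "finite S" and e: "\<And>T. T \<subseteq> S \<Longrightarrow> c T = d T"
  shows "jet_map C f c S = jet_map C f d S"
proof (cases "S = {}")
  case False
  have c: "c \<in> jets C W (M, X) S"
    using d e by (simp add: jets_def)
  have "faa_app C f P c (c {}) = faa_app C f P d (d {})" if P: "partition_on S P" for P
    using e[of "{}"] e[OF partition_on_block_subset[OF P]] finite_elements[OF S P]
    by (auto intro: faa_app_cong)
  then show ?thesis
    unfolding jet_map_nonempty[OF c False] jet_map_nonempty[OF d False]
    using jet_term_Hom[OF d S False] by (intro N.sum_cong[OF jets_Obj[OF c]]) auto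
qed (simp add: jet_map_def e)

lemma comp_jets:
  assumes u: "u \<in> Hom C V W" and c: "c \<in> jets C W (K, Z) S"
  shows "(\<lambda>T. u \<Zcomp> c T) \<in> jets C V (K, Z) S"
  using Comp_Hom[OF u jets_point[OF c]] Comp_Hom[OF u jets_Hom[OF c]] by (intro jetsI)

text \<open>Naturality in the parameter object: the action on a jet built from projections
  determines it on jets with arbitrary arguments, by precomposition with a tuple.\<close>

lemma comp_jet_map:
  assumes u: "u \<in> Hom C V W" and c: "c \<in> jets C W (M, X) S" and S: "finite S"
  shows "u \<Zcomp> jet_map C f c S = jet_map C f (\<lambda>T. u \<Zcomp> c T) S"
proof (cases "S = {}")
  case True
  then show ?thesis
    using Comp_assoc[OF u jets_point[OF c] Faa_HomD(5)[OF f]] by (simp add: jet_map_def)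
next
  case False
  note uc = comp_jets[OF u c]
  have "u \<Zcomp> jet_map C f c S = sum_map C N V (\<lambda>P. u \<Zcomp> faa_app C f P c (c {})) (parts S)"
    unfolding jet_map_nonempty[OF c False]
    using jet_term_Hom[OF c S False] by (intro N.comp_sum[OF u]) auto
  also have "\<dots> = sum_map C N V (\<lambda>P. faa_app C f P (\<lambda>T. u \<Zcomp> c T) (u \<Zcomp> c {})) (parts S)"
    using comp_faa_app[OF f u finite_elements[OF S] jets_block[OF c] jets_point[OF c]]
      jet_term_Hom[OF uc S False]
    by (intro N.sum_cong[OF jets_Obj[OF uc]]) auto
  finally show ?thesis
    unfolding jet_map_nonempty[OF uc False] .
qed

section \<open>Relabelling of the indices of a jet\<close>

lemma image_parts:
  assumes h: "inj_on h S"
  shows "parts (h ` S) = (`) ((`) h) ` parts S"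
proof -
  have im: "partition_on (h' ` T) ((`) h' ` P)" if "inj_on h' T" "partition_on T P" for h' :: "'x \<Rightarrow> 'y" and T P
  proof -
    have "{} \<notin> (`) h' ` P"
      using partition_onD3[OF that(2)] by auto
    then show ?thesis
      using partition_on_inj_image[OF that(2,1)] by simp
  qed
  have "P \<in> (`) ((`) h) ` parts S" if P: "partition_on (h ` S) P" for P
  proof -
    let ?g = "inv_into S h"
    have "partition_on (?g ` h ` S) ((`) ?g ` P)"
    proof -
      have "{} \<notin> (`) ?g ` P"
        using partition_onD3[OF P] by auto
      then show ?thesis
        using partition_on_inj_image[OF P inj_on_inv_into[OF order_refl]] by simp
    qed
    moreover have "?g ` h ` S = S"
      using h by (auto simp: image_image)
    moreover have "h ` ?g ` B = B" if "B \<in> P" for B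
    proof -
      have "B \<subseteq> h ` S"
        using partition_on_block_subset[OF P that] .
      then show ?thesis
        by (auto simp: image_image f_inv_into_f subset_iff image_iff)
    qed
    then have "P = (`) ((`) h) ((`) ?g ` P)"
      by (force simp: image_iff)
    ultimately show ?thesis
      by (metis image_eqI mem_Collect_eq)
  qed
  then show ?thesis
    using im[OF h] by blast
qed

lemma jet_map_reindex:
  assumes h: "inj_on h S" and S: "finite S" and c: "c \<in> jets C W (M, X) (h ` S)"
  shows "jet_map C f c (h ` S) = jet_map C f (\<lambda>T. c (h ` T)) S"
proof (cases "S = {}")
  case True
  then show ?thesis
    by (simp add: jet_map_def)
next
  case False
  have ch: "(\<lambda>T. c (h ` T)) \<in> jets C W (M, X) S"
    using jets_point[OF c] by (intro jetsI jets_Hom[OF c]) auto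
  have inj: "inj_on ((`) ((`) h)) (parts S)"
  proof -
    have "inj_on ((`) h) (Pow S)"
      using h by (rule inj_on_image_Pow)
    then have "inj_on ((`) ((`) h)) (Pow (Pow S))"
      by (rule inj_on_image_Pow)
    then show ?thesis
      by (rule inj_on_subset) (auto dest: partition_on_block_subset)
  qed
  have injP: "inj_on ((`) h) P" if "P \<in> parts S" for P
    by (rule inj_on_subset[OF inj_on_image_Pow[OF h]]) (use that partition_on_block_subset in blast)
  have e: "faa_app C f ((`) h ` P) c (c {}) = faa_app C f P (\<lambda>T. c (h ` T)) (c (h ` {}))"
    if "P \<in> parts S" for P
    using faa_app_reindex[OF f injP[OF that], where a = c and W = W, OF _ _ jets_point[OF c]] that finite_elements[OF S] jets_block[OF ch]
      jets_point[OF c] by simp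
  have "jet_map C f c (h ` S) = sum_map C N W (\<lambda>P. faa_app C f P c (c {})) ((`) ((`) h) ` parts S)"
    using jet_map_nonempty[OF c] False by (simp add: image_parts[OF h])
  also have "\<dots> = sum_map C N W (\<lambda>P. faa_app C f ((`) h ` P) c (c {})) (parts S)"
    using e jet_term_Hom[OF ch S False] by (intro N.sum_reindex[OF jets_Obj[OF c] inj]) auto
  also have "\<dots> = sum_map C N W (\<lambda>P. faa_app C f P (\<lambda>T. c (h ` T)) (c (h ` {}))) (parts S)"
    using e jet_term_Hom[OF ch S False] by (intro N.sum_cong[OF jets_Obj[OF c]]) auto
  finally show ?thesis
    unfolding jet_map_nonempty[OF ch False] .
qed

text \<open>Exactly one block of each partition contains \<open>i\<close>, so every term of the
  action is additive in the coefficients at sets containing \<open>i\<close>, taken together. With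
  the index of the differential as \<open>i\<close> this yields [CD.2]; it also gives the additivity
  of composite coefficients.\<close>

lemma jet_map_plus:
  assumes S: "finite S" "i \<in> S"
    and c: "c \<in> jets C W (M, X) S" and a: "a \<in> jets C W (M, X) S" and b: "b \<in> jets C W (M, X) S"
    and plus: "\<And>T. T \<subseteq> S \<Longrightarrow> i \<in> T \<Longrightarrow> c T = plus_map C M (a T) (b T)"
    and eq: "\<And>T. T \<subseteq> S \<Longrightarrow> i \<notin> T \<Longrightarrow> a T = c T" "\<And>T. T \<subseteq> S \<Longrightarrow> i \<notin> T \<Longrightarrow> b T = c T"
  shows "jet_map C f c S = plus_map C N (jet_map C f a S) (jet_map C f b S)"
proof -
  have ne: "S \<noteq> {}"
    using S by blast
  have pt: "a {} = c {}" "b {} = c {}"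
    using eq by auto
  have *: "faa_app C f P c (c {}) = plus_map C N (faa_app C f P a (a {})) (faa_app C f P b (b {}))"
    if P: "P \<in> parts S" for P
  proof -
    obtain B where B: "B \<in> P" "i \<in> B"
      using P S partition_onD1 by blast
    have P': "partition_on S P"
      using P by simp
    have sub: "D \<subseteq> S" if "D \<in> P" for D
      using partition_on_block_subset[OF P' that] .
    have iD: "i \<notin> D" if "D \<in> P" "D \<noteq> B" for D
      using partition_on_block_eq[OF P' that(1) B(1) _ B(2)] that(2) by blast
    show ?thesis
      unfolding pt
    proof (rule faa_app_plus[OF f finite_elements[OF S(1) P'] B(1) _ _ jets_point[OF c]])
      show "c B = plus_map C M (a B) (b B)"
        using plus[OF sub[OF B(1)] B(2)] .
      fix D assume D: "D \<in> P"
      show "a D \<in> Hom C W (mobj M)" "b D \<in> Hom C W (mobj M)"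
        using jets_block[OF a P' D] jets_block[OF b P' D] .
      assume "D \<noteq> B"
      then show "a D = c D" "b D = c D"
        using eq[OF sub[OF D] iD[OF D]] by auto
    qed
  qed
  have "jet_map C f c S = sum_map C N W
      (\<lambda>P. plus_map C N (faa_app C f P a (a {})) (faa_app C f P b (b {}))) (parts S)"
    unfolding jet_map_nonempty[OF c ne]
    using * jet_term_Hom[OF c S(1) ne] by (intro N.sum_cong[OF jets_Obj[OF c]]) auto
  also have "\<dots> = plus_map C N (jet_map C f a S) (jet_map C f b S)"
    unfolding jet_map_nonempty[OF a ne] jet_map_nonempty[OF b ne]
    using jet_term_Hom[OF a S(1) ne] jet_term_Hom[OF b S(1) ne]
    by (intro N.sum_plus[OF jets_Obj[OF c]]) auto
  finally show ?thesis .
qed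

lemma jet_map_zero:
  assumes S: "finite S" "i \<in> S" and c: "c \<in> jets C W (M, X) S"
    and zero: "\<And>T. T \<subseteq> S \<Longrightarrow> i \<in> T \<Longrightarrow> c T = zero_map C M W"
  shows "jet_map C f c S = zero_map C N W"
proof -
  have ne: "S \<noteq> {}"
    using S by blast
  have "faa_app C f P c (c {}) = zero_map C N W" if P: "P \<in> parts S" for P
  proof -
    obtain B where B: "B \<in> P" "i \<in> B"
      using P S partition_onD1 by blast
    have "B \<subseteq> S"
      using P B partition_on_block_subset by blast
    then show ?thesis
      using P B zero finite_elements[OF S(1)] jets_block[OF c] jets_point[OF c]
      by (intro faa_app_zero[OF f, of P B]) auto
  qed
  then show ?thesis
    unfolding jet_map_nonempty[OF c ne] by (intro N.sum_zero[OF jets_Obj[OF c]])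
qed

section \<open>Recovery of a map from its action on jets\<close>

lemma linear_jet:
  assumes a: "\<And>i. i \<in> S \<Longrightarrow> a i \<in> Hom C W (mobj M)" and x: "x \<in> Hom C W X"
  shows "(\<lambda>T. if T = {} then x else if \<exists>i\<in>S. T = {i} then a (the_elem T) else zero_map C M W)
    \<in> jets C W (M, X) S"
  using assms zero_map_Hom[OF Faa_HomD(1)[OF f] Hom_Dom[OF x]] by (intro jetsI) (auto split: if_splits)

text \<open>The jet has order one: the singletons carry the arguments and larger sets carry zero. A
  partition with a block that is not a singleton contributes zero, which leaves the partition into
  singletons and its single term.\<close>

lemma faa_app_eq_jet_map:
  assumes S: "finite S" and a: "\<And>i. i \<in> S \<Longrightarrow> a i \<in> Hom C W (mobj M)" and x: "x \<in> Hom C W X"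
  shows "faa_app C f S a x = jet_map C f
    (\<lambda>T. if T = {} then x else if \<exists>i\<in>S. T = {i} then a (the_elem T) else zero_map C M W) S"
    (is "_ = jet_map C f ?c S")
proof (cases "S = {}")
  case True
  then show ?thesis
    by (simp add: faa_app_empty jet_map_def)
next
  case False
  let ?P = "(\<lambda>i. {i}) ` S"
  have c: "?c \<in> jets C W (M, X) S"
    using a x by (rule linear_jet)
  have "faa_app C f Q ?c (?c {}) = zero_map C N W" if Q: "Q \<in> parts S - {?P}" for Q
  proof -
    have "\<exists>B\<in>Q. \<not> (\<exists>i\<in>S. B = {i})"
    proof (rule ccontr)
      assume n: "\<not> ?thesis"
      then have "Q \<subseteq> ?P"
        by blast
      moreover have "{i} \<in> Q" if i: "i \<in> S" for i
      proof -
        have "S = \<Union>Q"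
          using Q by (intro partition_onD1) simp
        then obtain B where B: "B \<in> Q" "i \<in> B"
          using i by blast
        then obtain j where "B = {j}"
          using n by meson
        then show ?thesis
          using B by simp
      qed
      ultimately show False
        using Q by blast
    qed
    then obtain B where B: "B \<in> Q" "\<not> (\<exists>i\<in>S. B = {i})"
      by blast
    have "B \<noteq> {}"
      using B(1) Q partition_on_block_nonempty by blast
    have Q': "partition_on S Q"
      using Q by simp
    show ?thesis
    proof (rule faa_app_zero[OF f finite_elements[OF S Q'] B(1) jets_block[OF c Q'] jets_point[OF c]])
      show "?c B = zero_map C M W"
        using B(2) \<open>B \<noteq> {}\<close> by simp
    qed
  qed
  then have "jet_map C f ?c S = sum_map C N W (\<lambda>P. faa_app C f P ?c (?c {})) {?P}"
    unfolding jet_map_nonempty[OF c False]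
    using finitely_many_partition_on[OF S] partition_on_singletons[of S] jet_term_Hom[OF c S False]
    by (intro N.sum_neutral_right[OF jets_Obj[OF c]]) auto
  also have "\<dots> = faa_app C f ?P ?c (?c {})"
    using jet_term_Hom[OF c S False partition_on_singletons]
    by (intro N.sum_singleton[OF jets_Obj[OF c]])
  also have "\<dots> = faa_app C f S (\<lambda>i. ?c {i}) x"
    using S a x by (subst faa_app_reindex[OF f, where W = W]) auto
  also have "\<dots> = faa_app C f S a x"
    using S by (intro faa_app_cong) auto
  finally show ?thesis ..
qed

lemma faa_map_eta: "f = FaaMap (M, X) (N, Y) (coeff f)"
  using Faa_HomD(9,10)[OF f] by (cases f) simp

end

text \<open>The index type in the hypothesis has to be fixed. The type \<open>nat\<close> is large
  enough: coefficient \<open>n\<close> is read off over \<open>{0..<n}\<close>, and there is a fresh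
  index outside every finite set when a differential adds one.\<close>

lemma Faa_eqI:
  assumes f: "f \<in> Hom (Faa C) (M, X) (N, Y)" and g: "g \<in> Hom (Faa C) (M, X) (N, Y)"
    and eq: "\<And>W S (c :: nat set \<Rightarrow> 'm). c \<in> jets C W (M, X) S \<Longrightarrow> finite S \<Longrightarrow>
      jet_map C f c S = jet_map C g c S"
  shows "f = g"
proof -
  have "coeff f n = coeff g n" for n
  proof -
    let ?B = "if n = 0 then Y else mobj N"
    have A: "mobj M \<in> Obj C" and X: "X \<in> Obj C"
      using Faa_HomD[OF f] comm_monoid_in_Obj by blast+
    let ?a = "proj C (mobj M) n X"
    have a: "?a i \<in> Hom C (pow_prod C (mobj M) n X) (mobj M)" if "i < n" for i
      using proj_Hom[OF A X that] .
    note x = proj_last_Hom[OF A X, of n]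
    have ap: "coeff h n = faa_app C h {0..<n} ?a (?a n)" if h: "h \<in> Hom (Faa C) (M, X) (N, Y)" for h
      using apply_map_projs[OF A X coeff_Hom[OF h, of n ?B]] faa_app_lessThan[OF h a x] by simp
    \<comment> \<open>The order-one jet with the projections as arguments is the universal one: over
      \<open>{0..<n}\<close> the action on it returns the coefficient itself.\<close>
    have l: "(\<lambda>T. if T = {} then ?a n else if \<exists>i\<in>{0..<n}. T = {i} then ?a (the_elem T)
        else zero_map C M (pow_prod C (mobj M) n X)) \<in> jets C (pow_prod C (mobj M) n X) (M, X) {0..<n}"
      using a by (intro linear_jet[OF f _ x]) simp
    have "coeff f n = faa_app C f {0..<n} ?a (?a n)"
      by (rule ap[OF f])
    also have "\<dots> = faa_app C g {0..<n} ?a (?a n)"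
      using faa_app_eq_jet_map[OF f _ _ x, of "{0..<n}" ?a] faa_app_eq_jet_map[OF g _ _ x, of "{0..<n}" ?a]
        eq[OF l] a by simp
    also have "\<dots> = coeff g n"
      by (rule ap[OF g, symmetric])
    finally show ?thesis .
  qed
  then have "coeff f = coeff g"
    by blast
  then show ?thesis
    using faa_map_eta[OF f] faa_map_eta[OF g] by metis
qed

end

subsection \<open>Composition\<close>

text \<open>Injectivity of the key is asked on the set to be sorted only: \<open>Min\<close> is not
  injective on all finite sets, but it is on the blocks of a partition.\<close>

lemma (in linorder) sorted_key_list_of_set_inj:
  assumes "inj_on f A" "finite A"
  shows "set (sorted_key_list_of_set f A) = A" "distinct (sorted_key_list_of_set f A)"
    "length (sorted_key_list_of_set f A) = card A"
proof -
  interpret folding_insort_key "(\<le>)" "(<)" A f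
    using assms(1) by unfold_locales
  show "set (sorted_key_list_of_set f A) = A" "distinct (sorted_key_list_of_set f A)"
    "length (sorted_key_list_of_set f A) = card A"
    using assms(2) distinct_if_distinct_map[OF distinct_sorted_key_list_of_set[OF subset_refl]]
    by simp_all
qed

context cartesian_category
begin

context
  fixes f g M X N Y K Z
  assumes f: "f \<in> Hom (Faa C) (M, X) (N, Y)" and g: "g \<in> Hom (Faa C) (N, Y) (K, Z)"
begin

interpretation K: cmon_in_cartesian C K
  by unfold_locales (rule Faa_HomD(3)[OF g])

text \<open>For fixed arguments the values of \<open>f\<close> on all subfamilies form a jet, and
  the formula for the composite is nothing but the action of \<open>g\<close> on this jet.\<close>

lemma faa_app_jets:
  assumes S: "finite S" and a: "\<And>i. i \<in> S \<Longrightarrow> a i \<in> Hom C W (mobj M)" and x: "x \<in> Hom C W X"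
  shows "(\<lambda>B. faa_app C f B a x) \<in> jets C W (N, Y) S"
proof (rule jetsI)
  show "faa_app C f {} a x \<in> Hom C W Y"
    using x by (intro faa_app_Hom[OF f]) auto
  show "faa_app C f T a x \<in> Hom C W (mobj N)" if "T \<subseteq> S" "T \<noteq> {}" for T
    using that a x finite_subset[OF that(1) S] by (intro faa_app_Hom[OF f]) auto
qed

lemma faa_comp_coeff_eq:
  assumes n: "0 < n"
  shows "faa_comp_coeff C f g n = jet_map C g
    (\<lambda>B. faa_app C f B (proj C (mobj M) n X) (proj C (mobj M) n X n)) {0..<n}"
proof -
  let ?a = "proj C (mobj M) n X" and ?W = "pow_prod C (mobj M) n X" and ?S = "{0..<n}"
  have A: "mobj M \<in> Obj C" and X: "X \<in> Obj C"
    using Faa_HomD[OF f] comm_monoid_in_Obj by blast+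
  have a: "?a i \<in> Hom C ?W (mobj M)" if "i \<in> ?S" for i
    using proj_Hom[OF A X] that by simp
  have x: "?a n \<in> Hom C ?W X"
    by (rule proj_last_Hom[OF A X])
  let ?c = "\<lambda>B. faa_app C f B ?a (?a n)"
  have c: "?c \<in> jets C ?W (N, Y) ?S"
    by (rule faa_app_jets[OF _ a x]) simp_all
  have ne: "?S \<noteq> {}"
    using n by simp
  have "apply_map C (coeff g (card P))
      (map (\<lambda>B. apply_map C (coeff f (card B)) (map ?a (sorted_list_of_set B)) (?a n))
        (sorted_key_list_of_set Min P)) (?a n \<Zcomp> coeff f 0) = faa_app C g P ?c (?c {})"
    if P: "partition_on ?S P" for P
  proof -
    have fin: "finite P" "finite B" if "B \<in> P" for B
      using finite_elements[OF _ P] partition_on_finite_block[OF P _ that] by simp_all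
    have finP: "finite P"
      using finite_elements[OF _ P] by simp
    \<comment> \<open>Disjoint blocks have different least elements, so sorting by
      \<open>Min\<close> lists every block exactly once.\<close>
    have "inj_on Min P"
    proof (rule inj_onI)
      fix B D assume BD: "B \<in> P" "D \<in> P" and e: "Min B = Min D"
      have "Min B \<in> B" "Min D \<in> D"
        using BD fin(2) partition_on_block_nonempty[OF P] by (auto intro!: Min_in)
      then show "B = D"
        using partition_on_block_eq[OF P BD] e by simp
    qed
    note L = sorted_key_list_of_set_inj[OF this finP]
    let ?L = "sorted_key_list_of_set Min P"
    have "apply_map C (coeff f (card B)) (map ?a (sorted_list_of_set B)) (?a n) = ?c B"
      if B: "B \<in> P" for B
    proof -
      have "set (sorted_list_of_set B) = B" "length (sorted_list_of_set B) = card B"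
        using fin(2)[OF B] by auto
      moreover have "B \<subseteq> ?S"
        using partition_on_block_subset[OF P B] .
      ultimately show ?thesis
        using faa_app_set[OF f, of "sorted_list_of_set B" ?a ?W "?a n"] a[OF subsetD] x by simp
    qed
    then have m: "map (\<lambda>B. apply_map C (coeff f (card B)) (map ?a (sorted_list_of_set B)) (?a n)) ?L
        = map ?c ?L"
      using L(1) by auto
    show ?thesis
      unfolding m using faa_app_set[OF g L(2), of ?c ?W "?c {}"] L jets_block[OF c P] jets_point[OF c]
      by (simp add: faa_app_empty)
  qed
  then have "faa_comp_coeff C f g n = sum_map C K ?W (\<lambda>P. faa_app C g P ?c (?c {})) (parts ?S)"
    using n Faa_HomD(9,10)[OF f] Faa_HomD(10)[OF g] jet_term_Hom[OF g c _ ne]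
    unfolding faa_comp_coeff_def Let_def
    by (simp, intro K.sum_cong[OF jets_Obj[OF c]]) auto
  then show ?thesis
    unfolding jet_map_nonempty[OF g c ne] .
qed

text \<open>The value at the projections is transported by the tuple \<open>?t\<close>, after which
  the positions are renamed to the entries of \<open>xs\<close>. The right side depends on the set
  of entries only.\<close>

lemma apply_faa_comp_coeff:
  assumes xs: "distinct xs" and a: "\<And>i. i \<in> set xs \<Longrightarrow> a i \<in> Hom C W (mobj M)"
    and x: "x \<in> Hom C W X"
  shows "apply_map C (faa_comp_coeff C f g (length xs)) (map a xs) x
    = jet_map C g (\<lambda>B. faa_app C f B a x) (set xs)"
proof (cases "xs = []")
  case True
  then show ?thesis
    using Comp_assoc[OF x Faa_HomD(5)[OF f] Faa_HomD(5)[OF g]]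
    by (simp add: faa_comp_coeff_def apply_map_def jet_map_def faa_app_empty)
next
  case False
  define n where "n = length xs"
  let ?p = "proj C (mobj M) n X" and ?V = "pow_prod C (mobj M) n X" and ?S = "{0..<n}"
  let ?t = "foldr (pair C) (map a xs) x"
  have n: "0 < n"
    using False by (simp add: n_def)
  have A: "mobj M \<in> Obj C" and X: "X \<in> Obj C"
    using Faa_HomD[OF f] comm_monoid_in_Obj by blast+
  have p: "?p i \<in> Hom C ?V (mobj M)" if "i \<in> ?S" for i
    using proj_Hom[OF A X] that by simp
  have pn: "?p n \<in> Hom C ?V X"
    by (rule proj_last_Hom[OF A X])
  have as: "set (map a xs) \<subseteq> Hom C W (mobj M)"
    using a by auto
  have t: "?t \<in> Hom C W ?V"
    using tuple_Hom[OF as x] by (simp add: n_def)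
  have tp: "?t \<Zcomp> ?p i = a (xs ! i)" if "i \<in> ?S" for i
    using tuple_proj(1)[OF as x, of i] that by (simp add: n_def)
  have tpn: "?t \<Zcomp> ?p n = x"
    using tuple_proj(2)[OF as x] by (simp add: n_def)
  have inj: "inj_on (nth xs) ?S"
    using xs by (intro inj_on_nth) (auto simp: n_def)
  have S: "set xs = nth xs ` ?S"
    by (auto simp: n_def set_conv_nth)
  have c: "(\<lambda>B. faa_app C f B ?p (?p n)) \<in> jets C ?V (N, Y) ?S"
    by (rule faa_app_jets[OF _ p pn]) simp_all
  have d: "(\<lambda>B. faa_app C f B a x) \<in> jets C W (N, Y) (nth xs ` ?S)"
    by (rule faa_app_jets[OF _ a x]) (simp_all add: S)
  have e: "?t \<Zcomp> faa_app C f T ?p (?p n) = faa_app C f (nth xs ` T) a x" if T: "T \<subseteq> ?S" for T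
  proof -
    have fin: "finite T"
      using T by (rule finite_subset) simp
    have "?t \<Zcomp> faa_app C f T ?p (?p n) = faa_app C f T (\<lambda>i. ?t \<Zcomp> ?p i) x"
      using comp_faa_app[OF f t fin p[OF subsetD[OF T]] pn] tpn by simp
    also have "\<dots> = faa_app C f T (\<lambda>i. a (xs ! i)) x"
      using tp T by (intro faa_app_cong[OF fin]) auto
    also have "\<dots> = faa_app C f (nth xs ` T) a x"
      using a T S by (intro faa_app_reindex[OF f inj_on_subset[OF inj T] fin _ x, symmetric]) auto
    finally show ?thesis .
  qed
  have "apply_map C (faa_comp_coeff C f g (length xs)) (map a xs) x
      = ?t \<Zcomp> jet_map C g (\<lambda>B. faa_app C f B ?p (?p n)) ?S"
    unfolding apply_map_def using faa_comp_coeff_eq[OF n] by (simp add: n_def)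
  also have "\<dots> = jet_map C g (\<lambda>T. ?t \<Zcomp> faa_app C f T ?p (?p n)) ?S"
    by (rule comp_jet_map[OF g t c]) simp
  also have "\<dots> = jet_map C g (\<lambda>T. faa_app C f (nth xs ` T) a x) ?S"
    using comp_jets[OF g t c] e by (intro jet_map_cong[OF g, symmetric]) auto
  also have "\<dots> = jet_map C g (\<lambda>B. faa_app C f B a x) (set xs)"
    unfolding S by (rule jet_map_reindex[OF g inj _ d, symmetric]) simp
  finally show ?thesis .
qed

text \<open>Permuted arguments list the same index set in another order, whence symmetry. For
  additivity in argument \<open>i\<close>, the values of \<open>f\<close> on subfamilies containing
  \<open>i\<close> are additive and the others do not change, so \<open>jet_map_plus\<close> applies
  to \<open>g\<close>.\<close>

lemma faa_comp_Hom: "faa_comp C f g \<in> Hom (Faa C) (M, X) (K, Z)"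
proof -
  have "FaaMap (M, X) (K, Z) (faa_comp_coeff C f g) \<in> Hom (Faa C) (M, X) (K, Z)"
  proof (rule Faa_HomI)
    note fD = Faa_HomD[OF f] and gD = Faa_HomD[OF g]
    have A: "mobj M \<in> Obj C"
      using fD comm_monoid_in_Obj by blast
    show "comm_monoid_in C M" "X \<in> Obj C" "comm_monoid_in C K" "Z \<in> Obj C"
      using fD gD by auto
    show "faa_comp_coeff C f g 0 \<in> Hom C X Z"
      using Comp_Hom[OF fD(5) gD(5)] by (simp add: faa_comp_coeff_def)
    have ap: "apply_map C (faa_comp_coeff C f g n) (map a [0..<n]) x
        = jet_map C g (\<lambda>B. faa_app C f B a x) {0..<n}"
      if "\<And>i. i < n \<Longrightarrow> a i \<in> Hom C W (mobj M)" "x \<in> Hom C W X" for n a x W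
      using apply_faa_comp_coeff[of "[0..<n]" a W x] that by simp
    show "faa_comp_coeff C f g n \<in> Hom C (pow_prod C (mobj M) n X) (mobj K)" if "1 \<le> n" for n
    proof -
      have "(\<lambda>B. faa_app C f B (proj C (mobj M) n X) (proj C (mobj M) n X n))
          \<in> jets C (pow_prod C (mobj M) n X) (N, Y) {0..<n}"
        by (rule faa_app_jets) (simp_all add: proj_Hom proj_last_Hom A fD(2))
      from jets_Hom[OF jet_map_jets[OF g this], of "{0..<n}"] show ?thesis
        using faa_comp_coeff_eq[of n] that by simp
    qed
    fix n :: nat and W a x
    assume a: "\<And>i. i < n \<Longrightarrow> a i \<in> Hom C W (mobj M)" and x: "x \<in> Hom C W X"
    show "apply_map C (faa_comp_coeff C f g n) (map (\<lambda>i. a (\<sigma> i)) [0..<n]) x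
        = apply_map C (faa_comp_coeff C f g n) (map a [0..<n]) x" if \<sigma>: "\<sigma> permutes {0..<n}" for \<sigma> :: "nat \<Rightarrow> nat"
    proof -
      have s: "set (map \<sigma> [0..<n]) = {0..<n}" "distinct (map \<sigma> [0..<n])"
        using permutes_image[OF \<sigma>] permutes_inj_on[OF \<sigma>] by (simp_all add: distinct_map)
      then show ?thesis
        using apply_faa_comp_coeff[OF s(2), of a W x] ap[of n a W x, OF a x] a x by (simp add: comp_def)
    qed
    have fa: "(\<lambda>B. faa_app C f B d x) \<in> jets C W (N, Y) {0..<n}"
      if "\<And>i. i < n \<Longrightarrow> d i \<in> Hom C W (mobj M)" for d
      using that by (intro faa_app_jets[OF _ _ x]) auto
    fix i assume i: "i < n"
    have sub: "finite T" "\<And>j. j \<in> T \<Longrightarrow> j < n" if "T \<subseteq> {0..<n}" for T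
      using that finite_subset[OF that] by auto
    show "apply_map C (faa_comp_coeff C f g n) (map a [0..<n]) x = zero_map C K W"
      if z: "a i = zero_map C M W"
    proof -
      have "jet_map C g (\<lambda>B. faa_app C f B a x) {0..<n} = zero_map C K W"
      proof (rule jet_map_zero[OF g _ _ fa[of a, OF a], of i])
        show "faa_app C f T a x = zero_map C N W" if "T \<subseteq> {0..<n}" "i \<in> T" for T
          using sub[OF that(1)] by (intro faa_app_zero[OF f _ that(2), of a W x]) (auto simp: z intro: a x)
      qed (use i in auto)
      then show ?thesis
        using ap[of n a W x, OF a x] by simp
    qed
    fix b d
    assume b: "\<And>i. i < n \<Longrightarrow> b i \<in> Hom C W (mobj M)" and d: "\<And>i. i < n \<Longrightarrow> d i \<in> Hom C W (mobj M)"
      and e: "d i = plus_map C M (a i) (b i)" "\<And>j. j \<noteq> i \<Longrightarrow> a j = d j" "\<And>j. j \<noteq> i \<Longrightarrow> b j = d j"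
    show "apply_map C (faa_comp_coeff C f g n) (map d [0..<n]) x
        = plus_map C K (apply_map C (faa_comp_coeff C f g n) (map a [0..<n]) x)
            (apply_map C (faa_comp_coeff C f g n) (map b [0..<n]) x)"
    proof -
      have "jet_map C g (\<lambda>B. faa_app C f B d x) {0..<n}
        = plus_map C K (jet_map C g (\<lambda>B. faa_app C f B a x) {0..<n})
            (jet_map C g (\<lambda>B. faa_app C f B b x) {0..<n})"
      proof (rule jet_map_plus[OF g _ _ fa[of d, OF d] fa[of a, OF a] fa[of b, OF b], of i])
        show "faa_app C f T d x = plus_map C N (faa_app C f T a x) (faa_app C f T b x)"
          if "T \<subseteq> {0..<n}" "i \<in> T" for T
          using sub[OF that(1)] a b e by (intro faa_app_plus[OF f _ that(2) _ _ x]) auto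
        show "faa_app C f T a x = faa_app C f T d x" "faa_app C f T b x = faa_app C f T d x"
          if "T \<subseteq> {0..<n}" "i \<notin> T" for T
          using that(2) by (auto intro!: faa_app_cong sub(1)[OF that(1)] e(2,3))
      qed (use i in auto)
      then show ?thesis
        using ap[of n a W x, OF a x] ap[of n b W x, OF b x] ap[of n d W x, OF d x] by simp
    qed
  qed
  then show ?thesis
    using Faa_HomD(9)[OF f] Faa_HomD(10)[OF g] by (simp add: faa_comp_def)
qed

lemma faa_app_comp:
  assumes S: "finite S" and a: "\<And>i. i \<in> S \<Longrightarrow> a i \<in> Hom C W (mobj M)" and x: "x \<in> Hom C W X"
  shows "faa_app C (faa_comp C f g) S a x = jet_map C g (\<lambda>B. faa_app C f B a x) S"
proof -
  obtain xs where xs: "distinct xs" "set xs = S"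
    using finite_distinct_list[OF S] by blast
  show ?thesis
    using faa_app_set[OF faa_comp_Hom xs(1) _ x, of a] apply_faa_comp_coeff[OF xs(1) _ x, of a] a xs
    by (simp add: faa_comp_def)
qed

text \<open>
  Expanding \<open>g\<close> on the sums \<open>f(c)\<^sub>B\<close> by multi-additivity gives a sum over partitions \<open>P\<close> together with
  a partition of each block of \<open>P\<close>; these are the pairs of a partition \<open>Q\<close> and a partition of \<open>Q\<close>.
\<close>

lemma jet_map_comp:
  assumes S: "finite S" and c: "c \<in> jets C W (M, X) S"
  shows "jet_map C (faa_comp C f g) c S = jet_map C g (jet_map C f c) S"
proof (cases "S = {}")
  case True
  then show ?thesis
    using Comp_assoc[OF jets_point[OF c] Faa_HomD(5)[OF f] Faa_HomD(5)[OF g]]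
    by (simp add: jet_map_def faa_comp_def faa_comp_coeff_def)
next
  case False
  have W: "W \<in> Obj C"
    by (rule jets_Obj[OF c])
  note x = jets_point[OF c]
  \<comment> \<open>The indices move up one level: for each partition \<open>Q\<close> of
    \<open>S\<close>, this is a jet over \<open>Q\<close>, with sets of blocks as the index sets of
    its coefficients.\<close>
  let ?d = "\<lambda>B. faa_app C f B c (c {})"
  let ?F = "\<lambda>R. faa_app C g R ?d (?d {})"
  have d: "?d \<in> jets C W (N, Y) Q" if Q: "partition_on S Q" for Q
    using jets_block[OF c Q] finite_elements[OF S Q] x by (intro faa_app_jets) auto
  have F: "?F R \<in> Hom C W (mobj K)" if Q: "partition_on S Q" and R: "partition_on Q R" for Q R
    using R Q False finite_elements[OF S Q] partition_on_eq_empty[OF Q]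
    by (intro jet_term_Hom[OF g d[OF Q]]) auto
  have "jet_map C (faa_comp C f g) c S
      = sum_map C K W (\<lambda>Q. faa_app C (faa_comp C f g) Q c (c {})) (parts S)"
    by (rule jet_map_nonempty[OF faa_comp_Hom c False])
  also have "\<dots> = sum_map C K W (\<lambda>Q. sum_map C K W ?F (parts Q)) (parts S)"
  proof (rule K.sum_cong[OF W refl])
    fix Q assume "Q \<in> parts S"
    then have Q: "partition_on S Q"
      by simp
    have "Q \<noteq> {}"
      using partition_on_eq_empty[OF Q] False by simp
    then show "faa_app C (faa_comp C f g) Q c (c {}) = sum_map C K W ?F (parts Q)"
      using faa_app_comp[OF finite_elements[OF S Q] jets_block[OF c Q] x]
        jet_map_nonempty[OF g d[OF Q]] by simp
    show "sum_map C K W ?F (parts Q) \<in> Hom C W (mobj K)"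
      using F[OF Q] by (intro K.sum_closed[OF W]) auto
  qed
  also have "\<dots> = sum_map C K W (\<lambda>P. sum_map C K W (\<lambda>\<sigma>. ?F (\<sigma> ` P)) (PiE P parts)) (parts S)"
    using F by (intro K.sum_refinements[OF W S, symmetric])
  also have "\<dots> = sum_map C K W (\<lambda>P. faa_app C g P (jet_map C f c) (jet_map C f c {})) (parts S)"
  proof (rule K.sum_cong[OF W refl])
    fix P assume "P \<in> parts S"
    then have P: "partition_on S P"
      by simp
    have fc: "jet_map C f c \<in> jets C W (N, Y) S"
      by (rule jet_map_jets[OF f c S])
    show "faa_app C g P (jet_map C f c) (jet_map C f c {}) \<in> Hom C W (mobj K)"
      by (rule jet_term_Hom[OF g fc S False P])
    have Pne: "P \<noteq> {}"
      using partition_on_eq_empty[OF P] False by simp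
    have finB: "finite B" and cB: "c \<in> jets C W (M, X) B" and Bne: "B \<noteq> {}" if "B \<in> P" for B
      using partition_on_finite_block[OF P S that] jets_mono[OF c partition_on_block_subset[OF P that]]
        partition_on_block_nonempty[OF P that] by auto
    have pt: "jet_map C f c {} = ?d {}"
      by (simp add: jet_map_def faa_app_empty)
    have "faa_app C g P (jet_map C f c) (?d {})
        = faa_app C g P (\<lambda>B. sum_map C N W ?d (parts B)) (?d {})"
      using finite_elements[OF S P] jet_map_nonempty[OF f cB Bne] by (intro faa_app_cong) auto
    also have "\<dots> = sum_map C K W (\<lambda>\<sigma>. faa_app C g P (\<lambda>B. ?d (\<sigma> B)) (?d {})) (PiE P parts)"
      using jet_term_Hom[OF f cB finB Bne] finitely_many_partition_on[OF finB] Pne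
      by (intro faa_app_sum[OF g finite_elements[OF S P] _ _ jets_point[OF d[OF P]]]) auto
    also have "\<dots> = sum_map C K W (\<lambda>\<sigma>. ?F (\<sigma> ` P)) (PiE P parts)"
    proof (rule K.sum_cong[OF W refl])
      fix \<sigma> assume \<sigma>: "\<sigma> \<in> PiE P parts"
      then have \<sigma>B: "partition_on B (\<sigma> B)" if "B \<in> P" for B
        using that by (auto simp: PiE_iff)
      \<comment> \<open>A block is the union of its partition, so different blocks have different
        partitions; arguments indexed by the blocks can therefore be indexed by their
        partitions.\<close>
      have inj: "inj_on \<sigma> P"
        using partition_onD1[OF \<sigma>B] by (intro inj_onI) metis
      have "?d (\<sigma> B) \<in> Hom C W (mobj N)" if "B \<in> P" for B
        by (rule jet_term_Hom[OF f cB finB Bne \<sigma>B]) (rule that)+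
      then show "faa_app C g P (\<lambda>B. ?d (\<sigma> B)) (?d {}) = ?F (\<sigma> ` P)"
        by (rule faa_app_reindex[OF g inj finite_elements[OF S P] _ jets_point[OF d[OF P]], symmetric])
      show "?F (\<sigma> ` P) \<in> Hom C W (mobj K)"
        by (rule F[OF partition_on_Union_refinement[OF P \<sigma>B]])
    qed
    finally show "sum_map C K W (\<lambda>\<sigma>. ?F (\<sigma> ` P)) (PiE P parts)
        = faa_app C g P (jet_map C f c) (jet_map C f c {})"
      unfolding pt ..
  qed
  also have "\<dots> = jet_map C g (jet_map C f c) S"
    by (rule jet_map_nonempty[OF g jet_map_jets[OF f c S] False, symmetric])
  finally show ?thesis .
qed

end

text \<open>Both sides act on jets as the three actions in succession, so no triple sum over
  partitions has to be compared.\<close>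

lemma faa_comp_assoc:
  assumes f: "f \<in> Hom (Faa C) (M, X) (N, Y)" and g: "g \<in> Hom (Faa C) (N, Y) (K, Z)"
    and h: "h \<in> Hom (Faa C) (K, Z) (L, V)"
  shows "faa_comp C (faa_comp C f g) h = faa_comp C f (faa_comp C g h)"
proof (rule Faa_eqI)
  note fg = faa_comp_Hom[OF f g] and gh = faa_comp_Hom[OF g h]
  show "faa_comp C (faa_comp C f g) h \<in> Hom (Faa C) (M, X) (L, V)"
    "faa_comp C f (faa_comp C g h) \<in> Hom (Faa C) (M, X) (L, V)"
    using faa_comp_Hom[OF fg h] faa_comp_Hom[OF f gh] .
  fix W S and c :: "nat set \<Rightarrow> 'm"
  assume c: "c \<in> jets C W (M, X) S" and S: "finite S"
  have "jet_map C h (jet_map C (faa_comp C f g) c) S = jet_map C h (jet_map C g (jet_map C f c)) S"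
    using jet_map_comp[OF f g _ jets_mono[OF c]] finite_subset[OF _ S]
      jet_map_jets[OF g jet_map_jets[OF f c S] S]
    by (intro jet_map_cong[OF h _ S]) auto
  then show "jet_map C (faa_comp C (faa_comp C f g) h) c S
      = jet_map C (faa_comp C f (faa_comp C g h)) c S"
    using jet_map_comp[OF fg h S c] jet_map_comp[OF f gh S c]
      jet_map_comp[OF g h S jet_map_jets[OF f c S]] by simp
qed

end

subsection \<open>Linear maps\<close>

definition cmon_hom :: "('o, 'm) cart \<Rightarrow> ('o, 'm) cmon \<Rightarrow> ('o, 'm) cmon \<Rightarrow> 'm \<Rightarrow> bool" where
  "cmon_hom C M N k \<longleftrightarrow> k \<in> Hom C (mobj M) (mobj N) \<and>
    (\<forall>W. \<forall>a\<in>Hom C W (mobj M). \<forall>b\<in>Hom C W (mobj M).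
      plus_map C M a b \<Zcomp>\<^bsub>C\<^esub> k = plus_map C N (a \<Zcomp>\<^bsub>C\<^esub> k) (b \<Zcomp>\<^bsub>C\<^esub> k)) \<and>
    (\<forall>W\<in>Obj C. zero_map C M W \<Zcomp>\<^bsub>C\<^esub> k = zero_map C N W)"

text \<open>The object in which the coefficient at \<open>T\<close> lives. It commutes with products
  (\<open>jobj_faa_prod\<close>), which spares a separate treatment of the base point.\<close>

definition jobj :: "('o, 'm) faa_obj \<Rightarrow> 'i set \<Rightarrow> 'o" where
  "jobj P T = (if T = {} then snd P else mobj (fst P))"

lemma jobj_simps [simp]: "jobj P {} = snd P" "T \<noteq> {} \<Longrightarrow> jobj P T = mobj (fst P)"
  by (simp_all add: jobj_def)

lemma jets_at: "c \<in> jets C W P S \<Longrightarrow> T \<subseteq> S \<Longrightarrow> c T \<in> Hom C W (jobj P T)"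
  unfolding jets_def jobj_def by blast

lemma jetsI': "(\<And>T. T \<subseteq> S \<Longrightarrow> c T \<in> Hom C W (jobj P T)) \<Longrightarrow> c \<in> jets C W P S"
  unfolding jets_def jobj_def by blast

context cartesian_category
begin

lemma cmon_hom_sum:
  assumes M: "comm_monoid_in C M" and N: "comm_monoid_in C N" and k: "cmon_hom C M N k"
    and W: "W \<in> Obj C" and a: "\<And>i. i \<in> I \<Longrightarrow> a i \<in> Hom C W (mobj M)"
  shows "sum_map C M W a I \<Zcomp> k = sum_map C N W (\<lambda>i. a i \<Zcomp> k) I"
proof -
  interpret M: cmon_in_cartesian C M
    by unfold_locales (rule M)
  interpret N: cmon_in_cartesian C N
    by unfold_locales (rule N)
  have kH: "k \<in> Hom C (mobj M) (mobj N)"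
    using k by (simp add: cmon_hom_def)
  show ?thesis
    using a
  proof (induction I rule: infinite_finite_induct)
    case (infinite I)
    then show ?case
      using k W by (simp add: sum_map_def finprod_def M.hm_simps[OF W] N.hm_simps[OF W] cmon_hom_def)
  next
    case empty
    then show ?case
      using k W by (simp add: M.sum_empty N.sum_empty cmon_hom_def)
  next
    case (insert i I)
    have s: "sum_map C M W a I \<in> Hom C W (mobj M)" "a i \<in> Hom C W (mobj M)"
      using insert by (auto intro!: M.sum_closed[OF W])
    have "sum_map C M W a (insert i I) \<Zcomp> k = plus_map C M (a i) (sum_map C M W a I) \<Zcomp> k"
      using insert W by (simp add: M.sum_insert)
    also have "\<dots> = plus_map C N (a i \<Zcomp> k) (sum_map C M W a I \<Zcomp> k)"
      using k s by (simp add: cmon_hom_def)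
    also have "\<dots> = sum_map C N W (\<lambda>i. a i \<Zcomp> k) (insert i I)"
      using insert Comp_Hom[OF _ kH] W by (subst N.sum_insert) auto
    finally show ?case .
  qed
qed

lemma jobj_Obj: "P \<in> Obj (Faa C) \<Longrightarrow> jobj P T \<in> Obj C"
  using comm_monoid_in_Obj by (auto simp: jobj_def is_faa_obj_def)

lemma Faa_Hom_Obj:
  assumes "f \<in> Hom (Faa C) P Q"
  shows "P \<in> Obj (Faa C)" "Q \<in> Obj (Faa C)"
  using assms by (auto simp: Faa_Hom_iff is_faa_map_def split: prod.splits)

lemma jet_map_at:
  assumes "f \<in> Hom (Faa C) P Q" "c \<in> jets C W P S" "finite S"
  shows "jet_map C f c S \<in> Hom C W (jobj Q S)"
  using assms jets_at[OF jet_map_jets[of f "fst P" "snd P" "fst Q" "snd Q" c W S] order_refl] by simp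

lemma jet_map_jets':
  assumes "f \<in> Hom (Faa C) P Q" "c \<in> jets C W P S" "finite S"
  shows "jet_map C f c \<in> jets C W Q S"
  using assms jet_map_jets[of f "fst P" "snd P" "fst Q" "snd Q" c W S] by simp

lemma jet_map_cong':
  assumes "f \<in> Hom (Faa C) P Q" "d \<in> jets C W P S" "finite S" "\<And>T. T \<subseteq> S \<Longrightarrow> c T = d T"
  shows "jet_map C f c S = jet_map C f d S"
  using assms jet_map_cong[of f "fst P" "snd P" "fst Q" "snd Q" d W S c] by simp

lemma jet_map_comp':
  assumes "f \<in> Hom (Faa C) P Q" "g \<in> Hom (Faa C) Q R" "finite S" "c \<in> jets C W P S"
  shows "jet_map C (faa_comp C f g) c S = jet_map C g (jet_map C f c) S"
  using assms jet_map_comp[of f "fst P" "snd P" "fst Q" "snd Q" g "fst R" "snd R" S c W] by simp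

lemma Faa_eqI':
  assumes "f \<in> Hom (Faa C) P Q" "g \<in> Hom (Faa C) P Q"
    and "\<And>W S (c :: nat set \<Rightarrow> 'm). c \<in> jets C W P S \<Longrightarrow> finite S \<Longrightarrow> jet_map C f c S = jet_map C g c S"
  shows "f = g"
  using assms Faa_eqI[of f "fst P" "snd P" "fst Q" "snd Q" g] by simp

text \<open>All coefficients past the first vanish, so on nonempty \<open>S\<close> only the
  partition \<open>{S}\<close> with one block contributes and \<open>k\<close> is applied
  coefficientwise. Identities, projections and the operations of \<open>Faa_L\<close> are all of
  this form.\<close>

lemma
  assumes M: "comm_monoid_in C M" and N: "comm_monoid_in C N" and X: "X \<in> Obj C" and Y: "Y \<in> Obj C"
    and k: "cmon_hom C M N k" and g0: "g0 \<in> Hom C X Y"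
  shows linear_faa_Hom:
      "linear_faa C (M, X) (N, Y) g0 (Proj0 C (mobj M) X \<Zcomp> k) \<in> Hom (Faa C) (M, X) (N, Y)"
    and jet_map_linear: "finite S \<Longrightarrow> c \<in> jets C W (M, X) S \<Longrightarrow>
      jet_map C (linear_faa C (M, X) (N, Y) g0 (Proj0 C (mobj M) X \<Zcomp> k)) c S
        = c S \<Zcomp> (if S = {} then g0 else k)"
proof -
  let ?f = "linear_faa C (M, X) (N, Y) g0 (Proj0 C (mobj M) X \<Zcomp> k)"
  have A: "mobj M \<in> Obj C"
    using M comm_monoid_in_Obj by blast
  have kH: "k \<in> Hom C (mobj M) (mobj N)"
    using k by (simp add: cmon_hom_def)
  have ap: "apply_map C (coeff ?f (length as)) as x
      = (if length as = 0 then x \<Zcomp> g0 else if length as = 1 then hd as \<Zcomp> k else zero_map C N W)"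
    if as: "set as \<subseteq> Hom C W (mobj M)" and x: "x \<in> Hom C W X" for as x W
  proof -
    consider "length as = 0" | "length as = 1" | "length as \<noteq> 0" "length as \<noteq> 1"
      by blast
    then show ?thesis
    proof cases
      case 1
      then show ?thesis
        by (simp add: apply_map_def linear_faa_def)
    next
      case 2
      then obtain a where a: "as = [a]"
        by (metis One_nat_def length_0_conv length_Suc_conv)
      then have "a \<in> Hom C W (mobj M)"
        using as by simp
      then show ?thesis
        using a Comp_assoc[OF pair_Hom[OF _ x] Proj0_Hom[OF A X] kH] pair_Proj0[OF _ x]
        by (simp add: apply_map_def linear_faa_def)
    next
      case 3
      then show ?thesis
        using comp_zero_map[OF N tuple_Hom[OF as x]] by (simp add: apply_map_def linear_faa_def)
    qed
  qed
  have "FaaMap (M, X) (N, Y) (coeff ?f) \<in> Hom (Faa C) (M, X) (N, Y)"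
  proof (rule Faa_HomI[OF M X N Y])
    show "coeff ?f 0 \<in> Hom C X Y"
      using g0 by (simp add: linear_faa_def)
    show "coeff ?f n \<in> Hom C (pow_prod C (mobj M) n X) (mobj N)" if "1 \<le> n" for n
    proof (cases "n = 1")
      case True
      then show ?thesis
        using Comp_Hom[OF Proj0_Hom[OF A X] kH] by (simp add: linear_faa_def)
    next
      case False
      then show ?thesis
        using that zero_map_Hom[OF N pow_prod_Obj[OF A X]] by (simp add: linear_faa_def)
    qed
    fix n :: nat and W a x
    assume a: "\<And>i. i < n \<Longrightarrow> a i \<in> Hom C W (mobj M)" and x: "x \<in> Hom C W X"
    have ap': "apply_map C (coeff ?f n) (map b [0..<n]) x
        = (if n = 0 then x \<Zcomp> g0 else if n = 1 then b 0 \<Zcomp> k else zero_map C N W)"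
      if "\<And>i. i < n \<Longrightarrow> b i \<in> Hom C W (mobj M)" for b
    proof -
      have "set (map b [0..<n]) \<subseteq> Hom C W (mobj M)"
        using that by auto
      moreover have "hd (map b [0..<n]) = b 0" if "n = 1"
        using that by simp
      ultimately show ?thesis
        using ap[of "map b [0..<n]" W x] x by auto
    qed
    show "apply_map C (coeff ?f n) (map (\<lambda>i. a (\<sigma> i)) [0..<n]) x = apply_map C (coeff ?f n) (map a [0..<n]) x"
      if \<sigma>: "\<sigma> permutes {0..<n}" for \<sigma> :: "nat \<Rightarrow> nat"
    proof -
      have \<sigma>n: "\<sigma> i < n" if "i < n" for i
        using permutes_in_image[OF \<sigma>, of i] that by simp
      have "\<sigma> 0 = 0" if "n = 1"
        using \<sigma>n[of 0] that by simp
      then show ?thesis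
        using ap'[of a] ap'[of "\<lambda>i. a (\<sigma> i)"] a \<sigma>n by auto
    qed
    fix i assume i: "i < n"
    show "apply_map C (coeff ?f n) (map a [0..<n]) x = zero_map C N W" if "a i = zero_map C M W"
      using ap'[of a] a i that k Hom_Dom[OF x] by (auto simp: cmon_hom_def)
    fix b d
    assume b: "\<And>i. i < n \<Longrightarrow> b i \<in> Hom C W (mobj M)" and d: "\<And>i. i < n \<Longrightarrow> d i \<in> Hom C W (mobj M)"
      and e: "d i = plus_map C M (a i) (b i)"
    show "apply_map C (coeff ?f n) (map d [0..<n]) x
        = plus_map C N (apply_map C (coeff ?f n) (map a [0..<n]) x) (apply_map C (coeff ?f n) (map b [0..<n]) x)"
      using ap'[of a, OF a] ap'[of b, OF b] ap'[of d, OF d] i e k a b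
        plus_map_zero_left[OF N zero_map_Hom[OF N Hom_Dom[OF x]]]
      by (auto simp: cmon_hom_def)
  qed
  then show f: "?f \<in> Hom (Faa C) (M, X) (N, Y)"
    by (simp add: linear_faa_def)
  assume S: "finite S" and c: "c \<in> jets C W (M, X) S"
  show "jet_map C ?f c S = c S \<Zcomp> (if S = {} then g0 else k)"
  proof (cases "S = {}")
    case True
    then show ?thesis
      by (simp add: jet_map_def linear_faa_def)
  next
    case False
    interpret N: cmon_in_cartesian C N
      by unfold_locales (rule N)
    have ap': "faa_app C ?f P c (c {}) = (if P = {S} then c S \<Zcomp> k else zero_map C N W)"
      if P: "partition_on S P" for P
    proof -
      obtain xs where xs: "distinct xs" "set xs = P"
        using finite_distinct_list[OF finite_elements[OF S P]] by blast
      have cx: "c B \<in> Hom C W (mobj M)" if "B \<in> set xs" for B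
        using jets_block[OF c P] that xs(2) by simp
      have 1: "faa_app C ?f P c (c {}) = (if length (map c xs) = 0 then c {} \<Zcomp> g0
          else if length (map c xs) = 1 then hd (map c xs) \<Zcomp> k else zero_map C N W)"
      proof -
        have "faa_app C ?f (set xs) c (c {}) = apply_map C (coeff ?f (length xs)) (map c xs) (c {})"
          using cx jets_point[OF c] by (rule faa_app_set[OF f xs(1)])
        moreover have "set (map c xs) \<subseteq> Hom C W (mobj M)"
          using cx by auto
        ultimately show ?thesis
          using ap[of "map c xs" W "c {}"] xs(2) jets_point[OF c] by simp
      qed
      have 2: "length xs \<noteq> 0"
        using partition_on_eq_empty[OF P] False xs by auto
      have 3: "length xs = 1 \<longleftrightarrow> P = {S}"
      proof
        assume "length xs = 1"
        then obtain B where "xs = [B]"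
          by (metis One_nat_def length_0_conv length_Suc_conv)
        then show "P = {S}"
          using partition_onD1[OF P] xs by auto
      next
        assume "P = {S}"
        then show "length xs = 1"
          using xs distinct_card[OF xs(1)] by simp
      qed
      have "hd xs = S" if "P = {S}"
        using that xs 2 by (metis hd_in_set length_0_conv singletonD)
      then show ?thesis
        using 1 2 3 by (auto simp: hd_map)
    qed
    have "jet_map C ?f c S = sum_map C N W (\<lambda>P. faa_app C ?f P c (c {})) {{S}}"
      unfolding jet_map_nonempty[OF f c False]
      using finitely_many_partition_on[OF S] partition_on_space[OF False] jet_term_Hom[OF f c S False] ap'
      by (intro N.sum_neutral_right[OF jets_Obj[OF c]]) auto
    also have "\<dots> = faa_app C ?f {S} c (c {})"
      by (intro N.sum_singleton[OF jets_Obj[OF c]] jet_term_Hom[OF f c S False partition_on_space[OF False]])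
    finally show ?thesis
      using ap'[OF partition_on_space[OF False]] False by simp
  qed
qed

lemma cmon_hom_Id:
  assumes M: "comm_monoid_in C M"
  shows "cmon_hom C M M (Id C (mobj M))"
  unfolding cmon_hom_def
  using Id_Hom[OF comm_monoid_in_Obj[OF M]] Comp_Id[OF plus_map_Hom[OF M]] Comp_Id[OF zero_map_Hom[OF M]]
  by (simp add: Comp_Id)

lemma faa_id_eq:
  assumes "comm_monoid_in C M" "X \<in> Obj C"
  shows "faa_id C (M, X) = linear_faa C (M, X) (M, X) (Id C X) (Proj0 C (mobj M) X \<Zcomp> Id C (mobj M))"
  unfolding faa_id_def using Comp_Id[OF Proj0_Hom[OF comm_monoid_in_Obj[OF assms(1)] assms(2)]] by simp

lemma faa_id_Hom:
  assumes "P \<in> Obj (Faa C)"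
  shows "faa_id C P \<in> Hom (Faa C) P P"
proof -
  obtain M X where P: "P = (M, X)" "comm_monoid_in C M" "X \<in> Obj C"
    using assms by (cases P) (auto simp: is_faa_obj_def)
  show ?thesis
    using linear_faa_Hom[OF P(2,2,3,3) cmon_hom_Id[OF P(2)] Id_Hom[OF P(3)]]
    by (simp add: P(1) faa_id_eq[OF P(2,3)])
qed

lemma jet_map_id:
  assumes "P \<in> Obj (Faa C)" and S: "finite S" and c: "c \<in> jets C W P S"
  shows "jet_map C (faa_id C P) c S = c S"
proof -
  obtain M X where P: "P = (M, X)" "comm_monoid_in C M" "X \<in> Obj C"
    using assms by (cases P) (auto simp: is_faa_obj_def)
  have "jet_map C (faa_id C P) c S = c S \<Zcomp> (if S = {} then Id C X else Id C (mobj M))"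
    using jet_map_linear[OF P(2,2,3,3) cmon_hom_Id[OF P(2)] Id_Hom[OF P(3)] S] c
    by (simp add: P(1) faa_id_eq[OF P(2,3)])
  then show ?thesis
    using Comp_Id[OF jets_at[OF c order_refl]] P(1) by (cases "S = {}") auto
qed

lemma category_Faa: "category (Faa C)"
proof
  show "Dom (Faa C) f \<in> Obj (Faa C)" "Cod (Faa C) f \<in> Obj (Faa C)" if "f \<in> Arr (Faa C)" for f
    using that Faa_Hom_Obj[of f "fdom f" "fcod f"] by (auto simp: Hom_def)
  show "Id (Faa C) P \<in> Hom (Faa C) P P" if "P \<in> Obj (Faa C)" for P
    using faa_id_Hom[OF that] by simp
  show comp: "f \<Zcomp>\<^bsub>Faa C\<^esub> g \<in> Hom (Faa C) P R" if "f \<in> Hom (Faa C) P Q" "g \<in> Hom (Faa C) Q R" for f g P Q R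
    using that faa_comp_Hom[of f "fst P" "snd P" "fst Q" "snd Q" g "fst R" "snd R"] by simp
  fix f P Q assume f: "f \<in> Hom (Faa C) P Q"
  note o = Faa_Hom_Obj[OF f]
  show "Id (Faa C) P \<Zcomp>\<^bsub>Faa C\<^esub> f = f"
  proof (rule Faa_eqI'[OF _ f])
    show "Id (Faa C) P \<Zcomp>\<^bsub>Faa C\<^esub> f \<in> Hom (Faa C) P Q"
      using comp[OF _ f] faa_id_Hom[OF o(1)] by simp
    fix W S and c :: "nat set \<Rightarrow> 'm" assume c: "c \<in> jets C W P S" and S: "finite S"
    show "jet_map C (Id (Faa C) P \<Zcomp>\<^bsub>Faa C\<^esub> f) c S = jet_map C f c S"
      using jet_map_comp'[OF faa_id_Hom[OF o(1)] f S c] jet_map_id[OF o(1) finite_subset[OF _ S] jets_mono[OF c]]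
        jet_map_cong'[OF f c S, of "jet_map C (faa_id C P) c"] by simp
  qed
  show "f \<Zcomp>\<^bsub>Faa C\<^esub> Id (Faa C) Q = f"
  proof (rule Faa_eqI'[OF _ f])
    show "f \<Zcomp>\<^bsub>Faa C\<^esub> Id (Faa C) Q \<in> Hom (Faa C) P Q"
      using comp[OF f] faa_id_Hom[OF o(2)] by simp
    fix W S and c :: "nat set \<Rightarrow> 'm" assume c: "c \<in> jets C W P S" and S: "finite S"
    show "jet_map C (f \<Zcomp>\<^bsub>Faa C\<^esub> Id (Faa C) Q) c S = jet_map C f c S"
      using jet_map_comp'[OF f faa_id_Hom[OF o(2)] S c] jet_map_id[OF o(2) S jet_map_jets'[OF f c S]] by simp
  qed
next
  fix f g h P Q R T
  assume "f \<in> Hom (Faa C) P Q" "g \<in> Hom (Faa C) Q R" "h \<in> Hom (Faa C) R T"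
  then show "(f \<Zcomp>\<^bsub>Faa C\<^esub> g) \<Zcomp>\<^bsub>Faa C\<^esub> h = f \<Zcomp>\<^bsub>Faa C\<^esub> (g \<Zcomp>\<^bsub>Faa C\<^esub> h)"
    using faa_comp_assoc[of f "fst P" "snd P" "fst Q" "snd Q" g "fst R" "snd R" h "fst T" "snd T"] by simp
qed

subsection \<open>Products\<close>

lemma one_cmon_comm_monoid: "comm_monoid_in C (one_cmon C)"
proof (rule comm_monoid_inI)
  show o: "mobj (one_cmon C) \<in> Obj C"
    "madd (one_cmon C) \<in> Hom C (mobj (one_cmon C) \<star> mobj (one_cmon C)) (mobj (one_cmon C))"
    "mzero (one_cmon C) \<in> Hom C (One C) (mobj (one_cmon C))"
    using One_Obj bang_Hom Prod_Obj by (auto simp: one_cmon_def)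
  note m = plus_map_Hom'[OF o(2)] and z = zero_map_Hom'[OF o(3)]
  have O: "mobj (one_cmon C) = One C"
    by (simp add: one_cmon_def)
  fix W f g h
  assume f: "f \<in> Hom C W (mobj (one_cmon C))"
  show "plus_map C (one_cmon C) (zero_map C (one_cmon C) W) f = f"
    by (rule One_eq[OF m[OF z[OF Hom_Dom[OF f]] f, unfolded O] f[unfolded O]])
  assume g: "g \<in> Hom C W (mobj (one_cmon C))"
  show "plus_map C (one_cmon C) f g = plus_map C (one_cmon C) g f"
    by (rule One_eq[OF m[OF f g, unfolded O] m[OF g f, unfolded O]])
  assume h: "h \<in> Hom C W (mobj (one_cmon C))"
  show "plus_map C (one_cmon C) (plus_map C (one_cmon C) f g) h
      = plus_map C (one_cmon C) f (plus_map C (one_cmon C) g h)"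
    by (rule One_eq[OF m[OF m[OF f g] h, unfolded O] m[OF f m[OF g h], unfolded O]])
qed

lemma mobj_prod_cmon: "mobj (prod_cmon C M N) = mobj M \<star> mobj N"
  by (simp add: prod_cmon_def Let_def)

context
  fixes M N
  assumes M: "comm_monoid_in C M" and N: "comm_monoid_in C N"
begin

lemma prod_cmon_typed:
  "madd (prod_cmon C M N) \<in> Hom C ((mobj M \<star> mobj N) \<star> (mobj M \<star> mobj N)) (mobj M \<star> mobj N)"
  "mzero (prod_cmon C M N) \<in> Hom C (One C) (mobj M \<star> mobj N)"
proof -
  note A = comm_monoid_in_Obj[OF M] comm_monoid_in_Obj[OF N]
  show "madd (prod_cmon C M N) \<in> Hom C ((mobj M \<star> mobj N) \<star> (mobj M \<star> mobj N)) (mobj M \<star> mobj N)"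
    unfolding prod_cmon_def Let_def cmon.sel
    by (rule pair_Hom plus_map_Hom[OF M] plus_map_Hom[OF N] Hom_intros A)+
  show "mzero (prod_cmon C M N) \<in> Hom C (One C) (mobj M \<star> mobj N)"
    unfolding prod_cmon_def Let_def cmon.sel by (rule pair_Hom mzero_Hom M N)+
qed

lemma plus_map_prod_cmon:
  assumes a: "a \<in> Hom C W (mobj M \<star> mobj N)" and b: "b \<in> Hom C W (mobj M \<star> mobj N)"
  shows "plus_map C (prod_cmon C M N) a b =
    \<langle>plus_map C M (a \<Zcomp> Proj0 C (mobj M) (mobj N)) (b \<Zcomp> Proj0 C (mobj M) (mobj N)),
      plus_map C N (a \<Zcomp> Proj1 C (mobj M) (mobj N)) (b \<Zcomp> Proj1 C (mobj M) (mobj N))\<rangle>"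
proof -
  let ?A = "mobj M" and ?B = "mobj N"
  note o = comm_monoid_in_Obj[OF M] comm_monoid_in_Obj[OF N]
  note AB = Prod_Obj[OF o]
  let ?p0 = "Proj0 C (?A \<star> ?B) (?A \<star> ?B)" and ?p1 = "Proj1 C (?A \<star> ?B) (?A \<star> ?B)"
  note t = pair_Hom[OF a b]
  have e: "\<langle>a, b\<rangle> \<Zcomp> (?p0 \<Zcomp> k) = a \<Zcomp> k" "\<langle>a, b\<rangle> \<Zcomp> (?p1 \<Zcomp> k) = b \<Zcomp> k"
    and pk: "?p0 \<Zcomp> k \<in> Hom C ((?A \<star> ?B) \<star> (?A \<star> ?B)) V" "?p1 \<Zcomp> k \<in> Hom C ((?A \<star> ?B) \<star> (?A \<star> ?B)) V"
    if k: "k \<in> Hom C (?A \<star> ?B) V" for k V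
    using Comp_assoc[OF t Proj0_Hom[OF AB AB] k] Comp_assoc[OF t Proj1_Hom[OF AB AB] k]
      pair_Proj0[OF a b] pair_Proj1[OF a b] Comp_Hom[OF Proj0_Hom[OF AB AB] k]
      Comp_Hom[OF Proj1_Hom[OF AB AB] k] by simp_all
  note P0 = Proj0_Hom[OF o] and P1 = Proj1_Hom[OF o]
  show ?thesis
    unfolding plus_map_def[of C "prod_cmon C M N"]
    unfolding prod_cmon_def Let_def cmon.sel
      comp_pair[OF t plus_map_Hom[OF M pk(1)[OF P0] pk(2)[OF P0]] plus_map_Hom[OF N pk(1)[OF P1] pk(2)[OF P1]]]
      comp_plus_map[OF M t pk(1)[OF P0] pk(2)[OF P0]] comp_plus_map[OF N t pk(1)[OF P1] pk(2)[OF P1]]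
      e[OF P0] e[OF P1] ..
qed

lemma zero_map_prod_cmon:
  assumes "W \<in> Obj C"
  shows "zero_map C (prod_cmon C M N) W = \<langle>zero_map C M W, zero_map C N W\<rangle>"
  unfolding zero_map_def prod_cmon_def Let_def cmon.sel
  by (rule comp_pair[OF bang_Hom[OF assms] mzero_Hom[OF M] mzero_Hom[OF N]])

lemma Proj_plus_prod_cmon:
  assumes a: "a \<in> Hom C W (mobj M \<star> mobj N)" and b: "b \<in> Hom C W (mobj M \<star> mobj N)"
  shows "plus_map C (prod_cmon C M N) a b \<Zcomp> Proj0 C (mobj M) (mobj N)
      = plus_map C M (a \<Zcomp> Proj0 C (mobj M) (mobj N)) (b \<Zcomp> Proj0 C (mobj M) (mobj N))"
    and "plus_map C (prod_cmon C M N) a b \<Zcomp> Proj1 C (mobj M) (mobj N)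
      = plus_map C N (a \<Zcomp> Proj1 C (mobj M) (mobj N)) (b \<Zcomp> Proj1 C (mobj M) (mobj N))"
proof -
  note o = comm_monoid_in_Obj[OF M] comm_monoid_in_Obj[OF N]
  note P0 = Comp_Hom[OF _ Proj0_Hom[OF o]] and P1 = Comp_Hom[OF _ Proj1_Hom[OF o]]
  note p = plus_map_Hom[OF M P0[OF a] P0[OF b]] plus_map_Hom[OF N P1[OF a] P1[OF b]]
  show "plus_map C (prod_cmon C M N) a b \<Zcomp> Proj0 C (mobj M) (mobj N)
      = plus_map C M (a \<Zcomp> Proj0 C (mobj M) (mobj N)) (b \<Zcomp> Proj0 C (mobj M) (mobj N))"
    "plus_map C (prod_cmon C M N) a b \<Zcomp> Proj1 C (mobj M) (mobj N)
      = plus_map C N (a \<Zcomp> Proj1 C (mobj M) (mobj N)) (b \<Zcomp> Proj1 C (mobj M) (mobj N))"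
    unfolding plus_map_prod_cmon[OF a b] by (rule pair_Proj0[OF p] pair_Proj1[OF p])+
qed

lemma Proj_zero_prod_cmon:
  assumes W: "W \<in> Obj C"
  shows "zero_map C (prod_cmon C M N) W \<Zcomp> Proj0 C (mobj M) (mobj N) = zero_map C M W"
    and "zero_map C (prod_cmon C M N) W \<Zcomp> Proj1 C (mobj M) (mobj N) = zero_map C N W"
  unfolding zero_map_prod_cmon[OF W]
  by (rule pair_Proj0[OF zero_map_Hom[OF M W] zero_map_Hom[OF N W]]
      pair_Proj1[OF zero_map_Hom[OF M W] zero_map_Hom[OF N W]])+

lemma prod_cmon_comm_monoid: "comm_monoid_in C (prod_cmon C M N)"
proof (rule comm_monoid_inI)
  note o = comm_monoid_in_Obj[OF M] comm_monoid_in_Obj[OF N]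
  show MN: "mobj (prod_cmon C M N) \<in> Obj C"
    using Prod_Obj[OF o] by (simp add: mobj_prod_cmon)
  show ty: "madd (prod_cmon C M N) \<in> Hom C (mobj (prod_cmon C M N) \<star> mobj (prod_cmon C M N)) (mobj (prod_cmon C M N))"
    "mzero (prod_cmon C M N) \<in> Hom C (One C) (mobj (prod_cmon C M N))"
    using prod_cmon_typed by (simp_all add: mobj_prod_cmon)
  note plus = plus_map_Hom'[OF ty(1), unfolded mobj_prod_cmon]
    and zero = zero_map_Hom'[OF ty(2), unfolded mobj_prod_cmon]
  note P0 = Comp_Hom[OF _ Proj0_Hom[OF o]] and P1 = Comp_Hom[OF _ Proj1_Hom[OF o]]
  fix W f g h
  assume "f \<in> Hom C W (mobj (prod_cmon C M N))"
  then have f: "f \<in> Hom C W (mobj M \<star> mobj N)"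
    by (simp add: mobj_prod_cmon)
  note W = Hom_Dom[OF f]
  show "plus_map C (prod_cmon C M N) (zero_map C (prod_cmon C M N) W) f = f"
    by (rule Prod_eqI[OF plus[OF zero[OF W] f] f o])
      (simp_all add: Proj_plus_prod_cmon[OF zero[OF W] f] Proj_zero_prod_cmon[OF W]
        plus_map_zero_left[OF M P0[OF f]] plus_map_zero_left[OF N P1[OF f]])
  assume "g \<in> Hom C W (mobj (prod_cmon C M N))"
  then have g: "g \<in> Hom C W (mobj M \<star> mobj N)"
    by (simp add: mobj_prod_cmon)
  show "plus_map C (prod_cmon C M N) f g = plus_map C (prod_cmon C M N) g f"
    by (rule Prod_eqI[OF plus[OF f g] plus[OF g f] o])
      (simp_all add: Proj_plus_prod_cmon[OF f g] Proj_plus_prod_cmon[OF g f]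
        plus_map_comm[OF M P0[OF f] P0[OF g]] plus_map_comm[OF N P1[OF f] P1[OF g]])
  assume "h \<in> Hom C W (mobj (prod_cmon C M N))"
  then have h: "h \<in> Hom C W (mobj M \<star> mobj N)"
    by (simp add: mobj_prod_cmon)
  show "plus_map C (prod_cmon C M N) (plus_map C (prod_cmon C M N) f g) h
      = plus_map C (prod_cmon C M N) f (plus_map C (prod_cmon C M N) g h)"
    by (rule Prod_eqI[OF plus[OF plus[OF f g] h] plus[OF f plus[OF g h]] o])
      (simp_all add: Proj_plus_prod_cmon[OF f g] Proj_plus_prod_cmon[OF g h]
        Proj_plus_prod_cmon[OF plus[OF f g] h] Proj_plus_prod_cmon[OF f plus[OF g h]]
        plus_map_assoc[OF M P0[OF f] P0[OF g] P0[OF h]] plus_map_assoc[OF N P1[OF f] P1[OF g] P1[OF h]])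
qed

lemma cmon_hom_Proj:
  "cmon_hom C (prod_cmon C M N) M (Proj0 C (mobj M) (mobj N))"
  "cmon_hom C (prod_cmon C M N) N (Proj1 C (mobj M) (mobj N))"
  unfolding cmon_hom_def mobj_prod_cmon
  using Proj_plus_prod_cmon Proj_zero_prod_cmon Proj0_Hom Proj1_Hom comm_monoid_in_Obj[OF M]
    comm_monoid_in_Obj[OF N] by auto

end

lemma faa_prod_Obj: "P \<in> Obj (Faa C) \<Longrightarrow> Q \<in> Obj (Faa C) \<Longrightarrow> faa_prod C P Q \<in> Obj (Faa C)"
  using prod_cmon_comm_monoid Prod_Obj by (auto simp: is_faa_obj_def faa_prod_def)

lemma jobj_faa_prod: "jobj (faa_prod C P Q) T = jobj P T \<star> jobj Q T"
  by (simp add: jobj_def faa_prod_def prod_cmon_def Let_def)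

context
  fixes P Q
  assumes P: "P \<in> Obj (Faa C)" and Q: "Q \<in> Obj (Faa C)"
begin

lemma cmons: "comm_monoid_in C (fst P)" "comm_monoid_in C (fst Q)" "snd P \<in> Obj C" "snd Q \<in> Obj C"
  using P Q by (auto simp: is_faa_obj_def)

lemma faa_proj_Hom:
  "faa_proj0 C P Q \<in> Hom (Faa C) (faa_prod C P Q) P"
  "faa_proj1 C P Q \<in> Hom (Faa C) (faa_prod C P Q) Q"
  using linear_faa_Hom[OF prod_cmon_comm_monoid[OF cmons(1,2)] cmons(1) Prod_Obj[OF cmons(3,4)] cmons(3)
      cmon_hom_Proj(1)[OF cmons(1,2)] Proj0_Hom[OF cmons(3,4)]]
    linear_faa_Hom[OF prod_cmon_comm_monoid[OF cmons(1,2)] cmons(2) Prod_Obj[OF cmons(3,4)] cmons(4)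
      cmon_hom_Proj(2)[OF cmons(1,2)] Proj1_Hom[OF cmons(3,4)]]
  by (simp_all add: faa_proj0_def faa_proj1_def faa_prod_def mobj_prod_cmon Let_def)

lemma jet_map_proj:
  assumes S: "finite S" and c: "c \<in> jets C W (faa_prod C P Q) S"
  shows "jet_map C (faa_proj0 C P Q) c S = c S \<Zcomp> Proj0 C (jobj P S) (jobj Q S)"
    and "jet_map C (faa_proj1 C P Q) c S = c S \<Zcomp> Proj1 C (jobj P S) (jobj Q S)"
  using jet_map_linear[OF prod_cmon_comm_monoid[OF cmons(1,2)] cmons(1) Prod_Obj[OF cmons(3,4)] cmons(3)
      cmon_hom_Proj(1)[OF cmons(1,2)] Proj0_Hom[OF cmons(3,4)] S, of c W]
    jet_map_linear[OF prod_cmon_comm_monoid[OF cmons(1,2)] cmons(2) Prod_Obj[OF cmons(3,4)] cmons(4)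
      cmon_hom_Proj(2)[OF cmons(1,2)] Proj1_Hom[OF cmons(3,4)] S, of c W] c
  by (simp_all add: faa_proj0_def faa_proj1_def faa_prod_def mobj_prod_cmon jobj_def Let_def)

end

text \<open>An explicit candidate is needed for the existence half of the universal property; the
  chosen pairing of \<open>Faa C\<close> is a definite description that makes sense only
  afterwards.\<close>

definition faa_pair :: "('o, 'm) faa_map \<Rightarrow> ('o, 'm) faa_map \<Rightarrow> ('o, 'm) faa_map" where
  "faa_pair f g = FaaMap (fdom f) (faa_prod C (fcod f) (fcod g)) (\<lambda>n. \<langle>coeff f n, coeff g n\<rangle>)"

context
  fixes f g M X N Y K Z
  assumes f: "f \<in> Hom (Faa C) (M, X) (N, Y)" and g: "g \<in> Hom (Faa C) (M, X) (K, Z)"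
begin

lemma faa_pair_Hom: "faa_pair f g \<in> Hom (Faa C) (M, X) (faa_prod C (N, Y) (K, Z))"
proof -
  note fD = Faa_HomD[OF f] and gD = Faa_HomD[OF g]
  note o = comm_monoid_in_Obj[OF fD(3)] comm_monoid_in_Obj[OF gD(3)]
  have "FaaMap (M, X) (prod_cmon C N K, Y \<star> Z) (\<lambda>n. \<langle>coeff f n, coeff g n\<rangle>)
      \<in> Hom (Faa C) (M, X) (prod_cmon C N K, Y \<star> Z)"
  proof (rule Faa_HomI[OF fD(1,2) prod_cmon_comm_monoid[OF fD(3) gD(3)] Prod_Obj[OF fD(4) gD(4)]])
    show "\<langle>coeff f 0, coeff g 0\<rangle> \<in> Hom C X (Y \<star> Z)"
      by (rule pair_Hom[OF fD(5) gD(5)])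
    show "\<langle>coeff f n, coeff g n\<rangle> \<in> Hom C (pow_prod C (mobj M) n X) (mobj (prod_cmon C N K))" if "1 \<le> n" for n
      using pair_Hom[OF fD(6)[OF that] gD(6)[OF that]] by (simp add: mobj_prod_cmon)
    fix n :: nat and W a x
    assume a: "\<And>i. i < n \<Longrightarrow> a i \<in> Hom C W (mobj M)" and x: "x \<in> Hom C W X"
    have ap: "apply_map C \<langle>coeff f n, coeff g n\<rangle> (map b [0..<n]) x
        = \<langle>faa_app C f {0..<n} b x, faa_app C g {0..<n} b x\<rangle>"
      if b: "\<And>i. i < n \<Longrightarrow> b i \<in> Hom C W (mobj M)" and n: "1 \<le> n" for b
    proof -
      have t: "foldr (pair C) (map b [0..<n]) x \<in> Hom C W (pow_prod C (mobj M) n X)"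
      proof -
        have "set (map b [0..<n]) \<subseteq> Hom C W (mobj M)"
          using b by auto
        from tuple_Hom[OF this x] show ?thesis
          by simp
      qed
      show ?thesis
        using comp_pair[OF t fD(6)[OF n] gD(6)[OF n]] faa_app_lessThan[OF f b x] faa_app_lessThan[OF g b x]
        by (simp add: apply_map_def)
    qed
    show "apply_map C \<langle>coeff f n, coeff g n\<rangle> (map (\<lambda>i. a (\<sigma> i)) [0..<n]) x
        = apply_map C \<langle>coeff f n, coeff g n\<rangle> (map a [0..<n]) x"
      if n: "1 \<le> n" and \<sigma>: "\<sigma> permutes {0..<n}" for \<sigma> :: "nat \<Rightarrow> nat"
    proof -
      have a\<sigma>: "a (\<sigma> i) \<in> Hom C W (mobj M)" if "i < n" for i
        using permutes_in_image[OF \<sigma>, of i] that a by simp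
      have "faa_app C f (\<sigma> ` {0..<n}) a x = faa_app C f {0..<n} (\<lambda>i. a (\<sigma> i)) x"
        "faa_app C g (\<sigma> ` {0..<n}) a x = faa_app C g {0..<n} (\<lambda>i. a (\<sigma> i)) x"
        using a\<sigma> by (intro faa_app_reindex[OF f permutes_inj_on[OF \<sigma>] _ _ x]
            faa_app_reindex[OF g permutes_inj_on[OF \<sigma>] _ _ x]; simp)+
      then show ?thesis
        using ap[of a, OF a n] ap[of "\<lambda>i. a (\<sigma> i)", OF a\<sigma> n] permutes_image[OF \<sigma>] by simp
    qed
    fix i assume i: "i < n"
    then have n: "1 \<le> n"
      by simp
    have inS: "i \<in> {0..<n}"
      using i by simp
    have aS: "a j \<in> Hom C W (mobj M)" if "j \<in> {0..<n}" for j
      using a that by simp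
    show "apply_map C \<langle>coeff f n, coeff g n\<rangle> (map a [0..<n]) x = zero_map C (prod_cmon C N K) W"
      if z: "a i = zero_map C M W"
      using ap[of a, OF a n] zero_map_prod_cmon[OF fD(3) gD(3) Hom_Dom[OF x]]
        faa_app_zero[OF f finite_atLeastLessThan inS, of a W x, OF aS x z]
        faa_app_zero[OF g finite_atLeastLessThan inS, of a W x, OF aS x z] by simp
    fix b d
    assume b: "\<And>i. i < n \<Longrightarrow> b i \<in> Hom C W (mobj M)" and d: "\<And>i. i < n \<Longrightarrow> d i \<in> Hom C W (mobj M)"
      and e: "d i = plus_map C M (a i) (b i)" "\<And>j. j \<noteq> i \<Longrightarrow> a j = d j" "\<And>j. j \<noteq> i \<Longrightarrow> b j = d j"
    have bS: "b j \<in> Hom C W (mobj M)" if "j \<in> {0..<n}" for j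
      using b that by simp
    have ne: "{0..<n} \<noteq> {}"
      using i by simp
    have H: "faa_app C f {0..<n} a x \<in> Hom C W (mobj N)" "faa_app C f {0..<n} b x \<in> Hom C W (mobj N)"
      "faa_app C g {0..<n} a x \<in> Hom C W (mobj K)" "faa_app C g {0..<n} b x \<in> Hom C W (mobj K)"
      using aS bS ne i by (auto intro!: faa_app_Hom[OF f _ _ x] faa_app_Hom[OF g _ _ x])
    note p = pair_Hom[OF H(1,3)] pair_Hom[OF H(2,4)]
    show "apply_map C \<langle>coeff f n, coeff g n\<rangle> (map d [0..<n]) x
        = plus_map C (prod_cmon C N K) (apply_map C \<langle>coeff f n, coeff g n\<rangle> (map a [0..<n]) x)
          (apply_map C \<langle>coeff f n, coeff g n\<rangle> (map b [0..<n]) x)"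
      using ap[of a, OF a n] ap[of b, OF b n] ap[of d, OF d n]
        faa_app_plus[OF f finite_atLeastLessThan inS, of a W b x d, OF aS bS x e]
        faa_app_plus[OF g finite_atLeastLessThan inS, of a W b x d, OF aS bS x e]
        plus_map_prod_cmon[OF fD(3) gD(3) p] pair_Proj0[OF H(1,3)] pair_Proj1[OF H(1,3)]
        pair_Proj0[OF H(2,4)] pair_Proj1[OF H(2,4)]
      by simp
  qed
  then show ?thesis
    using fD(9,10) gD(10) by (simp add: faa_pair_def faa_prod_def)
qed

text \<open>The projections of a product monoid are homomorphisms and hence pass through the sum
  over partitions, so both components of the left side can be computed and then reassembled by
  \<open>pair_eta\<close>.\<close>

lemma jet_map_faa_pair:
  assumes S: "finite S" and c: "c \<in> jets C W (M, X) S"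
  shows "jet_map C (faa_pair f g) c S = \<langle>jet_map C f c S, jet_map C g c S\<rangle>"
proof -
  note fD = Faa_HomD[OF f] and gD = Faa_HomD[OF g]
  have h: "faa_pair f g \<in> Hom (Faa C) (M, X) (prod_cmon C N K, Y \<star> Z)"
    using faa_pair_Hom by (simp add: faa_prod_def)
  note NK = prod_cmon_comm_monoid[OF fD(3) gD(3)]
  note o = comm_monoid_in_Obj[OF fD(3)] comm_monoid_in_Obj[OF gD(3)]
  have app: "faa_app C (faa_pair f g) P c (c {}) = \<langle>faa_app C f P c (c {}), faa_app C g P c (c {})\<rangle>"
    if P: "partition_on S P" and ne: "S \<noteq> {}" for P
  proof -
    obtain xs where xs: "distinct xs" "set xs = P"
      using finite_distinct_list[OF finite_elements[OF S P]] by blast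
    have n: "1 \<le> length xs"
      using partition_on_eq_empty[OF P] ne xs(2) by (cases xs) auto
    have cx: "c B \<in> Hom C W (mobj M)" if "B \<in> set xs" for B
      using jets_block[OF c P] that xs(2) by simp
    have t: "foldr (pair C) (map c xs) (c {}) \<in> Hom C W (pow_prod C (mobj M) (length xs) X)"
    proof -
      have "set (map c xs) \<subseteq> Hom C W (mobj M)"
        using cx by auto
      from tuple_Hom[OF this jets_point[OF c]] show ?thesis
        by simp
    qed
    show ?thesis
      using faa_app_set[OF h xs(1), of c W "c {}", OF cx jets_point[OF c]] faa_app_set[OF f xs(1), of c W "c {}", OF cx jets_point[OF c]]
        faa_app_set[OF g xs(1), of c W "c {}", OF cx jets_point[OF c]] comp_pair[OF t fD(6)[OF n] gD(6)[OF n]] xs(2)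
      by (simp add: faa_pair_def apply_map_def)
  qed
  show ?thesis
  proof (cases "S = {}")
    case True
    then show ?thesis
      using comp_pair[OF jets_point[OF c] fD(5) gD(5)] by (simp add: jet_map_def faa_pair_def)
  next
    case False
    interpret N: cmon_in_cartesian C N
      by unfold_locales (rule fD)
    interpret K: cmon_in_cartesian C K
      by unfold_locales (rule gD)
    note W = jets_Obj[OF c]
    note tf = jet_term_Hom[OF f c S False] and tg = jet_term_Hom[OF g c S False]
    have th: "faa_app C (faa_pair f g) P c (c {}) \<in> Hom C W (mobj (prod_cmon C N K))" if "P \<in> parts S" for P
      using jet_term_Hom[OF h c S False] that by simp
    have "jet_map C (faa_pair f g) c S \<Zcomp> Proj0 C (mobj N) (mobj K)
        = sum_map C N W (\<lambda>P. faa_app C (faa_pair f g) P c (c {}) \<Zcomp> Proj0 C (mobj N) (mobj K)) (parts S)"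
      unfolding jet_map_nonempty[OF h c False]
      by (rule cmon_hom_sum[OF NK fD(3) cmon_hom_Proj(1)[OF fD(3) gD(3)] W th])
    also have "\<dots> = jet_map C f c S"
      unfolding jet_map_nonempty[OF f c False]
      using app[OF _ False] pair_Proj0[OF tf tg] tf by (intro N.sum_cong[OF W refl]) auto
    finally have 0: "jet_map C (faa_pair f g) c S \<Zcomp> Proj0 C (mobj N) (mobj K) = jet_map C f c S" .
    have "jet_map C (faa_pair f g) c S \<Zcomp> Proj1 C (mobj N) (mobj K)
        = sum_map C K W (\<lambda>P. faa_app C (faa_pair f g) P c (c {}) \<Zcomp> Proj1 C (mobj N) (mobj K)) (parts S)"
      unfolding jet_map_nonempty[OF h c False]
      by (rule cmon_hom_sum[OF NK gD(3) cmon_hom_Proj(2)[OF fD(3) gD(3)] W th])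
    also have "\<dots> = jet_map C g c S"
      unfolding jet_map_nonempty[OF g c False]
      using app[OF _ False] pair_Proj1[OF tf tg] tg by (intro K.sum_cong[OF W refl]) auto
    finally have 1: "jet_map C (faa_pair f g) c S \<Zcomp> Proj1 C (mobj N) (mobj K) = jet_map C g c S" .
    have "jet_map C (faa_pair f g) c S \<in> Hom C W (mobj N \<star> mobj K)"
      using jet_map_at[OF h c S] False by (simp add: mobj_prod_cmon)
    from pair_eta[OF this o] show ?thesis
      unfolding 0 1 ..
  qed
qed

end

lemma cartesian_Faa: "cartesian_category (Faa C)"
proof (intro cartesian_category.intro category_Faa cartesian_category_axioms.intro)
  show One: "One (Faa C) \<in> Obj (Faa C)"
    using one_cmon_comm_monoid One_Obj by (simp add: is_faa_obj_def)
  show "Prod (Faa C) P Q \<in> Obj (Faa C)" if "P \<in> Obj (Faa C)" "Q \<in> Obj (Faa C)" for P Q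
    using faa_prod_Obj[OF that] by simp
  show "Proj0 (Faa C) P Q \<in> Hom (Faa C) (Prod (Faa C) P Q) P"
    "Proj1 (Faa C) P Q \<in> Hom (Faa C) (Prod (Faa C) P Q) Q"
    if "P \<in> Obj (Faa C)" "Q \<in> Obj (Faa C)" for P Q
    using faa_proj_Hom[OF that] by simp_all
  fix P assume P: "P \<in> Obj (Faa C)"
  have "\<exists>f. f \<in> Hom (Faa C) P (One (Faa C))"
  proof -
    obtain M X where MX: "P = (M, X)" "comm_monoid_in C M" "X \<in> Obj C"
      using P by (cases P) (auto simp: is_faa_obj_def)
    note b = bang_Hom[OF comm_monoid_in_Obj[OF MX(2)]]
    have O: "mobj (one_cmon C) = One C"
      by (simp add: one_cmon_def)
    note o = one_cmon_comm_monoid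
    have "cmon_hom C M (one_cmon C) (bang C (mobj M))"
      unfolding cmon_hom_def O
      using b One_eq[OF Comp_Hom[OF plus_map_Hom[OF MX(2)] b] plus_map_Hom[OF o, unfolded O]]
        One_eq[OF Comp_Hom[OF zero_map_Hom[OF MX(2)] b] zero_map_Hom[OF o, unfolded O]]
        Comp_Hom[OF _ b] by blast
    from linear_faa_Hom[OF MX(2) o MX(3) One_Obj this bang_Hom[OF MX(3)]] show ?thesis
      unfolding MX(1) by auto
  qed
  moreover have "f = g" if "f \<in> Hom (Faa C) P (One (Faa C))" "g \<in> Hom (Faa C) P (One (Faa C))" for f g
  proof (rule Faa_eqI'[OF that])
    fix W S and c :: "nat set \<Rightarrow> 'm" assume c: "c \<in> jets C W P S" and S: "finite S"
    \<comment> \<open>Every coefficient of a jet at the terminal object is a map to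
      \<open>One C\<close>, hence unique.\<close>
    have "jobj (One (Faa C)) S = One C"
      by (simp add: jobj_def one_cmon_def)
    then show "jet_map C f c S = jet_map C g c S"
      using jet_map_at[OF that(1) c S] jet_map_at[OF that(2) c S] One_eq by simp
  qed
  ultimately show "\<exists>!f. f \<in> Hom (Faa C) P (One (Faa C))"
    by blast
next
  fix f g P Q R
  assume f: "f \<in> Hom (Faa C) P Q" and g: "g \<in> Hom (Faa C) P R"
  note Q = Faa_Hom_Obj(2)[OF f] and R = Faa_Hom_Obj(2)[OF g]
  note p = faa_proj_Hom[OF Q R]
  interpret Faa: category "Faa C"
    by (rule category_Faa)
  let ?h = "faa_pair f g"
  have h: "?h \<in> Hom (Faa C) P (faa_prod C Q R)"
    using faa_pair_Hom[of f "fst P" "snd P" "fst Q" "snd Q" g "fst R" "snd R"] f g by simp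
  have j: "jet_map C ?h c S = \<langle>jet_map C f c S, jet_map C g c S\<rangle>"
    if "c \<in> jets C W P S" "finite S" for W S and c :: "nat set \<Rightarrow> 'm"
    using jet_map_faa_pair[of f "fst P" "snd P" "fst Q" "snd Q" g "fst R" "snd R" S c W] f g that by simp
  have pr: "jet_map C (faa_comp C k (faa_proj0 C Q R)) c S = jet_map C k c S \<Zcomp> Proj0 C (jobj Q S) (jobj R S)"
    "jet_map C (faa_comp C k (faa_proj1 C Q R)) c S = jet_map C k c S \<Zcomp> Proj1 C (jobj Q S) (jobj R S)"
    if "k \<in> Hom (Faa C) P (faa_prod C Q R)" "c \<in> jets C W P S" "finite S" for W S k and c :: "nat set \<Rightarrow> 'm"
    using jet_map_comp'[OF that(1) p(1) that(3,2)] jet_map_comp'[OF that(1) p(2) that(3,2)]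
      jet_map_proj[OF Q R that(3) jet_map_jets'[OF that]] by simp_all
  have 0: "faa_comp C ?h (faa_proj0 C Q R) = f"
  proof (rule Faa_eqI'[OF _ f])
    fix W S and c :: "nat set \<Rightarrow> 'm" assume c: "c \<in> jets C W P S" and S: "finite S"
    show "jet_map C (faa_comp C ?h (faa_proj0 C Q R)) c S = jet_map C f c S"
      unfolding pr(1)[OF h c S] j[OF c S] by (rule pair_Proj0[OF jet_map_at[OF f c S] jet_map_at[OF g c S]])
  qed (use Faa.Comp_Hom[OF h p(1)] in simp)
  have 1: "faa_comp C ?h (faa_proj1 C Q R) = g"
  proof (rule Faa_eqI'[OF _ g])
    fix W S and c :: "nat set \<Rightarrow> 'm" assume c: "c \<in> jets C W P S" and S: "finite S"
    show "jet_map C (faa_comp C ?h (faa_proj1 C Q R)) c S = jet_map C g c S"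
      unfolding pr(2)[OF h c S] j[OF c S] by (rule pair_Proj1[OF jet_map_at[OF f c S] jet_map_at[OF g c S]])
  qed (use Faa.Comp_Hom[OF h p(2)] in simp)
  \<comment> \<open>The two projections act on each coefficient as projections of \<open>C\<close>,
    where they are jointly monic.\<close>
  have uniq: "k = k'"
    if k: "k \<in> Hom (Faa C) P (faa_prod C Q R)" and k': "k' \<in> Hom (Faa C) P (faa_prod C Q R)"
      and e: "faa_comp C k (faa_proj0 C Q R) = faa_comp C k' (faa_proj0 C Q R)"
        "faa_comp C k (faa_proj1 C Q R) = faa_comp C k' (faa_proj1 C Q R)" for k k'
  proof (rule Faa_eqI'[OF k k'])
    fix W S and c :: "nat set \<Rightarrow> 'm" assume c: "c \<in> jets C W P S" and S: "finite S"
    show "jet_map C k c S = jet_map C k' c S"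
      by (rule Prod_eqI[OF jet_map_at[OF k c S, unfolded jobj_faa_prod]
            jet_map_at[OF k' c S, unfolded jobj_faa_prod] jobj_Obj[OF Q] jobj_Obj[OF R]])
        (simp_all only: pr[OF k c S, symmetric] pr[OF k' c S, symmetric] e)
  qed
  show "\<exists>!h. h \<in> Hom (Faa C) P (Prod (Faa C) Q R) \<and>
      h \<Zcomp>\<^bsub>Faa C\<^esub> Proj0 (Faa C) Q R = f \<and> h \<Zcomp>\<^bsub>Faa C\<^esub> Proj1 (Faa C) Q R = g"
    unfolding Faa_simps
  proof (intro ex1I[of _ ?h] conjI h 0 1)
    fix k
    assume "k \<in> Hom (Faa C) P (faa_prod C Q R) \<and>
      faa_comp C k (faa_proj0 C Q R) = f \<and> faa_comp C k (faa_proj1 C Q R) = g"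
    then show "k = ?h"
      using uniq[OF _ h] 0 1 by simp
  qed
qed

end

section \<open>The differential\<close>

text \<open>
  Under \<open>c \<mapsto> prolong c\<close> a jet over \<open>S\<close> at \<open>(A, A) \<times> (A, X)\<close> is a jet over \<open>S \<union> {z}\<close> at \<open>(A, X)\<close>: the
  second component carries the coefficients without \<open>\<epsilon>\<^sub>z\<close>, the first one those with \<open>\<epsilon>\<^sub>z\<close>.
\<close>

definition prolong ::
    "('o, 'm) cart \<Rightarrow> ('o, 'm) faa_obj \<Rightarrow> 'i \<Rightarrow> ('i set \<Rightarrow> 'm) \<Rightarrow> 'i set \<Rightarrow> 'm" where
  "prolong C P z c T =
    (if z \<in> T then c (T - {z}) \<Zcomp>\<^bsub>C\<^esub> Proj0 C (mobj (fst P)) (jobj P (T - {z}))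
     else c T \<Zcomp>\<^bsub>C\<^esub> Proj1 C (mobj (fst P)) (jobj P T))"

context cartesian_category
begin

text \<open>The interchange law makes the addition of a commutative monoid a homomorphism, and it
  adds up the base and tangent parts of the differential.\<close>

lemma plus_map_interchange:
  assumes M: "comm_monoid_in C M"
    and a: "a \<in> Hom C W (mobj M)" and b: "b \<in> Hom C W (mobj M)"
    and c: "c \<in> Hom C W (mobj M)" and d: "d \<in> Hom C W (mobj M)"
  shows "plus_map C M (plus_map C M a b) (plus_map C M c d)
    = plus_map C M (plus_map C M a c) (plus_map C M b d)"
proof -
  note p = plus_map_Hom[OF M]
  have "plus_map C M b (plus_map C M c d) = plus_map C M c (plus_map C M b d)"
    using plus_map_assoc[OF M b c d] plus_map_assoc[OF M c b d] plus_map_comm[OF M b c] by simp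
  then show ?thesis
    using plus_map_assoc[OF M a b p[OF c d]] plus_map_assoc[OF M a c p[OF b d]] by simp
qed

context
  fixes f M X N Y
  assumes f: "f \<in> Hom (Faa C) (M, X) (N, Y)"
begin

interpretation N: cmon_in_cartesian C N
  by unfold_locales (rule Faa_HomD(3)[OF f])

lemma A_Obj: "mobj M \<in> Obj C" and X_Obj: "X \<in> Obj C" and N_cmon: "comm_monoid_in C N"
  and M_cmon: "comm_monoid_in C M"
  using Faa_HomD[OF f] comm_monoid_in_Obj by blast+

lemma proj_comps:
  assumes "x \<in> Hom C W (mobj M \<star> X)"
  shows "x \<Zcomp> Proj0 C (mobj M) X \<in> Hom C W (mobj M)" "x \<Zcomp> Proj1 C (mobj M) X \<in> Hom C W X"
  using assms A_Obj X_Obj by (auto intro: Comp_Hom Proj0_Hom Proj1_Hom)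

lemma proj_comps':
  assumes "x \<in> Hom C W (mobj M \<star> mobj M)"
  shows "x \<Zcomp> Proj0 C (mobj M) (mobj M) \<in> Hom C W (mobj M)" "x \<Zcomp> Proj1 C (mobj M) (mobj M) \<in> Hom C W (mobj M)"
  using assms A_Obj by (auto intro: Comp_Hom Proj0_Hom Proj1_Hom)

text \<open>The part of the differential that carries the direction \<open>a\<close>: the arguments
  of \<open>f\<close> are indexed by \<open>S\<close> and by one extra index \<open>z\<close>, which
  stands for \<open>a\<close>.\<close>

definition base_term :: "'i \<Rightarrow> 'i set \<Rightarrow> ('i \<Rightarrow> 'm) \<Rightarrow> 'm \<Rightarrow> 'm" where
  "base_term z S c x = faa_app C f (insert z S)
    (\<lambda>i. if i = z then x \<Zcomp> Proj0 C (mobj M) X else c i \<Zcomp> Proj1 C (mobj M) (mobj M)) (x \<Zcomp> Proj1 C (mobj M) X)"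

text \<open>One summand of the second part of the differential: argument \<open>j\<close>
  contributes its component \<open>v\<^sup>j\<close>, every other argument its component
  \<open>w\<close>.\<close>

definition tangent_term :: "'i set \<Rightarrow> ('i \<Rightarrow> 'm) \<Rightarrow> 'm \<Rightarrow> 'i \<Rightarrow> 'm" where
  "tangent_term S c x j = faa_app C f S
    (\<lambda>i. if i = j then c i \<Zcomp> Proj0 C (mobj M) (mobj M) else c i \<Zcomp> Proj1 C (mobj M) (mobj M)) (x \<Zcomp> Proj1 C (mobj M) X)"

lemma base_term_Hom:
  assumes "finite S" "\<And>i. i \<in> S \<Longrightarrow> c i \<in> Hom C W (mobj M \<star> mobj M)" "x \<in> Hom C W (mobj M \<star> X)"
  shows "base_term z S c x \<in> Hom C W (mobj N)"
  unfolding base_term_def using assms(1) proj_comps'[OF assms(2)]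
  by (intro faa_app_Hom[OF f _ _ proj_comps(2)[OF assms(3)]]) (auto simp: proj_comps(1)[OF assms(3)])

lemma tangent_term_Hom:
  assumes "finite S" "\<And>i. i \<in> S \<Longrightarrow> c i \<in> Hom C W (mobj M \<star> mobj M)" "x \<in> Hom C W (mobj M \<star> X)" "j \<in> S"
  shows "tangent_term S c x j \<in> Hom C W (mobj N)"
  unfolding tangent_term_def using assms(1,4) proj_comps'[OF assms(2)]
  by (intro faa_app_Hom[OF f _ _ proj_comps(2)[OF assms(3)]]) auto

context
  fixes xs :: "'i list" and r :: nat and V p
  assumes V: "V = pow_prod C (mobj M \<star> mobj M) r (mobj M \<star> X)" and r: "r = length xs" and xs: "distinct xs"
    and p: "p = proj C (mobj M \<star> mobj M) r (mobj M \<star> X)"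
begin

lemma p_Hom: "i < r \<Longrightarrow> p i \<in> Hom C V (mobj M \<star> mobj M)" "p r \<in> Hom C V (mobj M \<star> X)"
  unfolding p V
  using proj_Hom[OF Prod_Obj[OF A_Obj A_Obj] Prod_Obj[OF A_Obj X_Obj]]
    proj_last_Hom[OF Prod_Obj[OF A_Obj A_Obj] Prod_Obj[OF A_Obj X_Obj]] by simp_all

lemma coeff_Suc_Hom: "coeff f (Suc r) \<in> Hom C (pow_prod C (mobj M) (length (a # map g [0..<r])) X) (mobj N)"
  using Faa_HomD(6)[OF f, of "Suc r"] by (simp del: pow_prod.simps)

lemma first_Hom: "apply_map C (coeff f (Suc r))
    ((p r \<Zcomp> Proj0 C (mobj M) X) # map (\<lambda>j. p j \<Zcomp> Proj1 C (mobj M) (mobj M)) [0..<r]) (p r \<Zcomp> Proj1 C (mobj M) X) \<in> Hom C V (mobj N)"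
  using proj_comps[OF p_Hom(2)] proj_comps'[OF p_Hom(1)]
  by (intro apply_map_Hom[OF _ _ coeff_Suc_Hom]) auto

lemma second_Hom:
  assumes j: "j < r"
  shows "apply_map C (coeff f r) ((p j \<Zcomp> Proj0 C (mobj M) (mobj M)) # map (\<lambda>j. p j \<Zcomp> Proj1 C (mobj M) (mobj M)) ([0..<j] @ [Suc j..<r]))
    (p r \<Zcomp> Proj1 C (mobj M) X) \<in> Hom C V (mobj N)"
proof -
  have "length ((p j \<Zcomp> Proj0 C (mobj M) (mobj M)) # map (\<lambda>j. p j \<Zcomp> Proj1 C (mobj M) (mobj M)) ([0..<j] @ [Suc j..<r])) = r"
    using j by simp
  then show ?thesis
    using proj_comps[OF p_Hom(2)] proj_comps'[OF p_Hom(1)] j Faa_HomD(6)[OF f, of r]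
    by (intro apply_map_Hom[of _ _ "mobj M" _ X]) auto
qed

lemma delta1_coeff_Hom: "0 < r \<Longrightarrow> delta1_coeff C f r \<in> Hom C V (mobj N)"
  using first_Hom second_Hom Hom_Dom[OF p_Hom(2)] Faa_HomD(9,10)[OF f]
  unfolding delta1_coeff_def Let_def
  by (simp add: V[symmetric] p[symmetric] del: pow_prod.simps map_append)
    (intro plus_map_Hom[OF N_cmon] N.sum_closed, auto)

text \<open>The numbered variables of \<open>delta1_coeff\<close> are replaced by an arbitrary index
  set. The definition moves \<open>v\<^sup>j\<close> to the front of the list, which is harmless
  because \<open>f\<^sub>r\<close> is symmetric.\<close>

lemma apply_delta1_coeff:
  assumes z: "z \<notin> set xs" and c: "\<And>i. i \<in> set xs \<Longrightarrow> c i \<in> Hom C W (mobj M \<star> mobj M)"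
    and x: "x \<in> Hom C W (mobj M \<star> X)"
  shows "apply_map C (delta1_coeff C f r) (map c xs) x
    = plus_map C N (base_term z (set xs) c x) (sum_map C N W (tangent_term (set xs) c x) (set xs))"
proof -
  note W = Hom_Dom[OF x] and x' = proj_comps[OF x]
  have b: "base_term z (set xs) c x = apply_map C (coeff f (Suc r))
      ((x \<Zcomp> Proj0 C (mobj M) X) # map (\<lambda>i. c i \<Zcomp> Proj1 C (mobj M) (mobj M)) xs) (x \<Zcomp> Proj1 C (mobj M) X)"
  proof -
    have "map (\<lambda>i. if i = z then x \<Zcomp> Proj0 C (mobj M) X else c i \<Zcomp> Proj1 C (mobj M) (mobj M)) (z # xs)
        = (x \<Zcomp> Proj0 C (mobj M) X) # map (\<lambda>i. c i \<Zcomp> Proj1 C (mobj M) (mobj M)) xs"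
      using z by auto
    moreover have "faa_app C f (set (z # xs)) (\<lambda>i. if i = z then x \<Zcomp> Proj0 C (mobj M) X else c i \<Zcomp> Proj1 C (mobj M) (mobj M))
        (x \<Zcomp> Proj1 C (mobj M) X) = apply_map C (coeff f (length (z # xs)))
        (map (\<lambda>i. if i = z then x \<Zcomp> Proj0 C (mobj M) X else c i \<Zcomp> Proj1 C (mobj M) (mobj M)) (z # xs)) (x \<Zcomp> Proj1 C (mobj M) X)"
      using xs z x'(1) proj_comps'[OF c] by (intro faa_app_set[OF f _ _ x'(2)]) auto
    ultimately show ?thesis
      unfolding base_term_def by (simp only: list.set list.size r) simp
  qed
  show ?thesis
  proof (cases "r = 0")
    \<comment> \<open>The coefficient of index \<open>0\<close> is defined separately as
      \<open>f\<^sub>1\<close>. It fits the general formula: there are no tangent terms, and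
      \<open>z\<close> is the only index of the base term.\<close>
    case True
    then have "xs = []"
      using r by simp
    then show ?thesis
      using b pair_eta[OF x A_Obj X_Obj] True
        plus_map_zero_right[OF N_cmon base_term_Hom[of "set xs" c W x z]] x
      by (simp add: delta1_coeff_def apply_map_def N.sum_empty[OF W])
  next
    case False
    let ?t = "foldr (pair C) (map c xs) x"
    have cs: "set (map c xs) \<subseteq> Hom C W (mobj M \<star> mobj M)"
      using c by auto
    have t: "?t \<in> Hom C W V"
      using tuple_Hom[OF cs x] by (simp add: V r)
    have tp: "?t \<Zcomp> p i = c (xs ! i)" if "i < r" for i
      using tuple_proj(1)[OF cs x, of i] that by (simp add: p r)
    have tpr: "?t \<Zcomp> p r = x"
      using tuple_proj(2)[OF cs x] by (simp add: p r)
    have tq: "?t \<Zcomp> (p i \<Zcomp> Proj0 C (mobj M) (mobj M)) = c (xs ! i) \<Zcomp> Proj0 C (mobj M) (mobj M)"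
      "?t \<Zcomp> (p i \<Zcomp> Proj1 C (mobj M) (mobj M)) = c (xs ! i) \<Zcomp> Proj1 C (mobj M) (mobj M)" if "i < r" for i
      using Comp_assoc[OF t p_Hom(1)[OF that]] Proj0_Hom Proj1_Hom A_Obj tp[OF that] by metis+
    have tqr: "?t \<Zcomp> (p r \<Zcomp> Proj0 C (mobj M) X) = x \<Zcomp> Proj0 C (mobj M) X"
      "?t \<Zcomp> (p r \<Zcomp> Proj1 C (mobj M) X) = x \<Zcomp> Proj1 C (mobj M) X"
      using Comp_assoc[OF t p_Hom(2)] Proj0_Hom Proj1_Hom A_Obj X_Obj tpr by metis+
    let ?as = "(p r \<Zcomp> Proj0 C (mobj M) X) # map (\<lambda>j. p j \<Zcomp> Proj1 C (mobj M) (mobj M)) [0..<r]"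
    let ?bs = "\<lambda>j. (p j \<Zcomp> Proj0 C (mobj M) (mobj M)) # map (\<lambda>j. p j \<Zcomp> Proj1 C (mobj M) (mobj M)) ([0..<j] @ [Suc j..<r])"
    have "?t \<Zcomp> apply_map C (coeff f (Suc r)) ?as (p r \<Zcomp> Proj1 C (mobj M) X)
        = apply_map C (coeff f (Suc r)) (map (\<lambda>k. ?t \<Zcomp> k) ?as) (?t \<Zcomp> (p r \<Zcomp> Proj1 C (mobj M) X))"
      using proj_comps[OF p_Hom(2)] proj_comps'[OF p_Hom(1)]
      by (intro comp_apply_map[OF t _ _ coeff_Suc_Hom]) auto
    also have "map (\<lambda>k. ?t \<Zcomp> k) ?as = (x \<Zcomp> Proj0 C (mobj M) X) # map (\<lambda>i. c i \<Zcomp> Proj1 C (mobj M) (mobj M)) xs"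
      using tqr(1) tq(2) by (auto simp: r intro!: nth_equalityI)
    finally have 1: "?t \<Zcomp> apply_map C (coeff f (Suc r)) ?as (p r \<Zcomp> Proj1 C (mobj M) X) = base_term z (set xs) c x"
      unfolding b tqr(2) .
    have inj: "inj_on (nth xs) {0..<r}"
      using xs by (intro inj_on_nth) (auto simp: r)
    have im: "nth xs ` {0..<r} = set xs"
      by (auto simp: r set_conv_nth)
    have 2: "?t \<Zcomp> apply_map C (coeff f r) (?bs j) (p r \<Zcomp> Proj1 C (mobj M) X) = tangent_term (set xs) c x (xs ! j)"
      if j: "j < r" for j
    proof -
      \<comment> \<open>The positions in the order of \<open>delta1_coeff\<close>, with
        \<open>j\<close> first.\<close>
      let ?is = "j # [0..<j] @ [Suc j..<r]"
      let ?d = "\<lambda>i. if i = xs ! j then c i \<Zcomp> Proj0 C (mobj M) (mobj M) else c i \<Zcomp> Proj1 C (mobj M) (mobj M)"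
      have idx: "distinct ?is" "set ?is = {0..<r}" "length ?is = r"
        using j by auto
      have ys: "distinct (map (nth xs) ?is)" "set (map (nth xs) ?is) = set xs"
        using idx inj im unfolding distinct_map set_map by simp_all
      have n: "xs ! i \<noteq> xs ! j" if "i \<in> set ([0..<j] @ [Suc j..<r])" for i
      proof
        assume "xs ! i = xs ! j"
        then show False
          using that j nth_eq_iff_index_eq[OF xs] by (auto simp: r)
      qed
      have len: "length (?bs j) = r"
        using j by simp
      have fH: "coeff f r \<in> Hom C (pow_prod C (mobj M) (length (?bs j)) X) (mobj N)"
        unfolding len using Faa_HomD(6)[OF f] False by simp
      have "?t \<Zcomp> apply_map C (coeff f r) (?bs j) (p r \<Zcomp> Proj1 C (mobj M) X)
          = apply_map C (coeff f r) (map (\<lambda>k. ?t \<Zcomp> k) (?bs j)) (?t \<Zcomp> (p r \<Zcomp> Proj1 C (mobj M) X))"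
        using proj_comps[OF p_Hom(2)] proj_comps'[OF p_Hom(1)] j
        by (intro comp_apply_map[OF t _ _ fH]) auto
      also have "map (\<lambda>k. ?t \<Zcomp> k) (?bs j) = map ?d (map (nth xs) ?is)"
        using tq j n by auto
      also have "apply_map C (coeff f r) \<dots> (?t \<Zcomp> (p r \<Zcomp> Proj1 C (mobj M) X)) = tangent_term (set xs) c x (xs ! j)"
      proof -
        have "faa_app C f (set (map (nth xs) ?is)) ?d (x \<Zcomp> Proj1 C (mobj M) X)
            = apply_map C (coeff f (length (map (nth xs) ?is))) (map ?d (map (nth xs) ?is)) (x \<Zcomp> Proj1 C (mobj M) X)"
          using proj_comps'[OF c] ys(2) by (intro faa_app_set[OF f ys(1) _ x'(2)]) auto
        then show ?thesis
          unfolding tqr(2) tangent_term_def ys(2) length_map idx(3) by (rule sym)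
      qed
      finally show ?thesis .
    qed
    have "?t \<Zcomp> delta1_coeff C f r = ?t \<Zcomp> plus_map C N
        (apply_map C (coeff f (Suc r)) ?as (p r \<Zcomp> Proj1 C (mobj M) X))
        (sum_map C N V (\<lambda>j. apply_map C (coeff f r) (?bs j) (p r \<Zcomp> Proj1 C (mobj M) X)) {0..<r})"
      using False Faa_HomD(9,10)[OF f] by (simp add: delta1_coeff_def V p Let_def)
    also have "\<dots> = plus_map C N (base_term z (set xs) c x)
        (?t \<Zcomp> sum_map C N V (\<lambda>j. apply_map C (coeff f r) (?bs j) (p r \<Zcomp> Proj1 C (mobj M) X)) {0..<r})"
      unfolding 1[symmetric]
      using second_Hom by (intro comp_plus_map[OF N_cmon t first_Hom] N.sum_closed[OF Hom_Cod[OF t]]) auto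
    also have "?t \<Zcomp> sum_map C N V (\<lambda>j. apply_map C (coeff f r) (?bs j) (p r \<Zcomp> Proj1 C (mobj M) X)) {0..<r}
        = sum_map C N W (\<lambda>j. ?t \<Zcomp> apply_map C (coeff f r) (?bs j) (p r \<Zcomp> Proj1 C (mobj M) X)) {0..<r}"
      using second_Hom by (intro N.comp_sum[OF t]) auto
    also have "\<dots> = sum_map C N W (\<lambda>j. tangent_term (set xs) c x (xs ! j)) {0..<r}"
      using 2 c x by (intro N.sum_cong[OF W refl]) (auto intro!: tangent_term_Hom simp: r)
    also have "\<dots> = sum_map C N W (tangent_term (set xs) c x) (set xs)"
      unfolding im[symmetric] using c x
      by (intro N.sum_reindex[OF W inj, symmetric]) (auto intro!: tangent_term_Hom simp: r)
    finally show ?thesis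
      by (simp add: apply_map_def)
  qed
qed

end

lemma delta1_Hom: "delta1 C f \<in> Hom (Faa C) (faa_prod C (M, mobj M) (M, X)) (N, mobj N)"
proof -
  note MM = prod_cmon_comm_monoid[OF M_cmon M_cmon]
  have "FaaMap (prod_cmon C M M, mobj M \<star> X) (N, mobj N) (delta1_coeff C f)
      \<in> Hom (Faa C) (prod_cmon C M M, mobj M \<star> X) (N, mobj N)"
  proof (rule Faa_HomI[OF MM Prod_Obj[OF A_Obj X_Obj] N_cmon N.Obj_mobj], unfold mobj_prod_cmon)
    show "delta1_coeff C f 0 \<in> Hom C (mobj M \<star> X) (mobj N)"
      using Faa_HomD(6)[OF f, of 1] by (simp add: delta1_coeff_def)
    show "delta1_coeff C f n \<in> Hom C (pow_prod C (mobj M \<star> mobj M) n (mobj M \<star> X)) (mobj N)" if "1 \<le> n" for n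
      using delta1_coeff_Hom[OF refl _ _ refl, of n "[0..<n]"] that by simp
    fix n :: nat and W a x
    assume a: "\<And>i. i < n \<Longrightarrow> a i \<in> Hom C W (mobj M \<star> mobj M)" and x: "x \<in> Hom C W (mobj M \<star> X)"
    note W = Hom_Dom[OF x] and x' = proj_comps[OF x]
    \<comment> \<open>The number \<open>n\<close> serves as the extra index, being just outside
      \<open>{0..<n}\<close>.\<close>
    let ?E = "\<lambda>c. plus_map C N (base_term n {0..<n} c x) (sum_map C N W (tangent_term {0..<n} c x) {0..<n})"
    have ap: "apply_map C (delta1_coeff C f n) (map c [0..<n]) x = ?E c"
      if "\<And>i. i < n \<Longrightarrow> c i \<in> Hom C W (mobj M \<star> mobj M)" for c
      using apply_delta1_coeff[OF refl _ _ refl, of n "[0..<n]" n c W x] that x by simp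
    show "apply_map C (delta1_coeff C f n) (map (\<lambda>i. a (\<sigma> i)) [0..<n]) x
        = apply_map C (delta1_coeff C f n) (map a [0..<n]) x"
      if \<sigma>: "\<sigma> permutes {0..<n}" for \<sigma> :: "nat \<Rightarrow> nat"
    proof -
      have s: "set (map \<sigma> [0..<n]) = {0..<n}" "distinct (map \<sigma> [0..<n])"
        using permutes_image[OF \<sigma>] permutes_inj_on[OF \<sigma>] by (simp_all add: distinct_map)
      have "apply_map C (delta1_coeff C f n) (map a (map \<sigma> [0..<n])) x = ?E a"
        using apply_delta1_coeff[OF refl _ s(2) refl, of n n a W x] s(1) a x by simp
      then show ?thesis
        using ap[of a, OF a] by (simp add: comp_def)
    qed
    have bH: "base_term n {0..<n} c x \<in> Hom C W (mobj N)"
      and tH: "j \<in> {0..<n} \<Longrightarrow> tangent_term {0..<n} c x j \<in> Hom C W (mobj N)"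
      if "\<And>i. i < n \<Longrightarrow> c i \<in> Hom C W (mobj M \<star> mobj M)" for c j
      using that x by (auto intro!: base_term_Hom tangent_term_Hom)
    have sH: "sum_map C N W (tangent_term {0..<n} c x) {0..<n} \<in> Hom C W (mobj N)"
      if "\<And>i. i < n \<Longrightarrow> c i \<in> Hom C W (mobj M \<star> mobj M)" for c
      using tH[of c, OF that] by (intro N.sum_closed[OF W])
    fix i assume i: "i < n"
    have c': "c j \<Zcomp> Proj0 C (mobj M) (mobj M) \<in> Hom C W (mobj M)" "c j \<Zcomp> Proj1 C (mobj M) (mobj M) \<in> Hom C W (mobj M)"
      if "\<And>i. i < n \<Longrightarrow> c i \<in> Hom C W (mobj M \<star> mobj M)" "j < n" for c j
      using proj_comps'[OF that(1)[OF that(2)]] .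
    show "apply_map C (delta1_coeff C f n) (map a [0..<n]) x = zero_map C N W"
      if z: "a i = zero_map C (prod_cmon C M M) W"
    proof -
      note z' = Proj_zero_prod_cmon[OF M_cmon M_cmon W, folded z]
      have "base_term n {0..<n} a x = zero_map C N W"
        unfolding base_term_def using i a z' x' c'[of a, OF a]
        by (intro faa_app_zero[OF f, of _ i]) auto
      \<comment> \<open>Argument \<open>i\<close> enters by its first component if
        \<open>j = i\<close> and by its second otherwise; both components of the zero of the product
        monoid are zero.\<close>
      moreover have "tangent_term {0..<n} a x j = zero_map C N W" if "j \<in> {0..<n}" for j
        unfolding tangent_term_def using i a z' x' c'[of a, OF a]
        by (intro faa_app_zero[OF f, of _ i]) auto
      then have "sum_map C N W (tangent_term {0..<n} a x) {0..<n} = zero_map C N W"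
        by (intro N.sum_zero[OF W])
      ultimately show ?thesis
        using ap[of a, OF a] plus_map_zero_left[OF N_cmon zero_map_Hom[OF N_cmon W]] by simp
    qed
    fix b d
    assume b: "\<And>i. i < n \<Longrightarrow> b i \<in> Hom C W (mobj M \<star> mobj M)" and d: "\<And>i. i < n \<Longrightarrow> d i \<in> Hom C W (mobj M \<star> mobj M)"
      and e: "d i = plus_map C (prod_cmon C M M) (a i) (b i)" "\<And>j. j \<noteq> i \<Longrightarrow> a j = d j" "\<And>j. j \<noteq> i \<Longrightarrow> b j = d j"
    note e' = Proj_plus_prod_cmon[OF M_cmon M_cmon a[OF i] b[OF i], folded e(1)]
    have 1: "base_term n {0..<n} d x = plus_map C N (base_term n {0..<n} a x) (base_term n {0..<n} b x)"
      unfolding base_term_def using i e' e(2,3) x' c'[of a, OF a] c'[of b, OF b]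
      by (intro faa_app_plus[OF f, of _ i]) auto
    have 2: "tangent_term {0..<n} d x j = plus_map C N (tangent_term {0..<n} a x j) (tangent_term {0..<n} b x j)"
      if "j \<in> {0..<n}" for j
      unfolding tangent_term_def using i e' e(2,3) x' c'[of a, OF a] c'[of b, OF b]
      by (intro faa_app_plus[OF f, of _ i]) auto
    have "sum_map C N W (tangent_term {0..<n} d x) {0..<n}
        = sum_map C N W (\<lambda>j. plus_map C N (tangent_term {0..<n} a x j) (tangent_term {0..<n} b x j)) {0..<n}"
      using 2 plus_map_Hom[OF N_cmon tH[of a, OF a] tH[of b, OF b]] by (intro N.sum_cong[OF W refl]) auto
    also have "\<dots> = plus_map C N (sum_map C N W (tangent_term {0..<n} a x) {0..<n})
        (sum_map C N W (tangent_term {0..<n} b x) {0..<n})"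
      using tH[of a, OF a] tH[of b, OF b] by (intro N.sum_plus[OF W])
    finally have 3: "sum_map C N W (tangent_term {0..<n} d x) {0..<n}
        = plus_map C N (sum_map C N W (tangent_term {0..<n} a x) {0..<n})
          (sum_map C N W (tangent_term {0..<n} b x) {0..<n})" .
    \<comment> \<open>The base part and the tangent part are each additive in argument
      \<open>i\<close>; the interchange law combines them.\<close>
    show "apply_map C (delta1_coeff C f n) (map d [0..<n]) x
        = plus_map C N (apply_map C (delta1_coeff C f n) (map a [0..<n]) x)
            (apply_map C (delta1_coeff C f n) (map b [0..<n]) x)"
      using ap[of a, OF a] ap[of b, OF b] ap[of d, OF d] 1 3
        plus_map_interchange[OF N_cmon bH[of a, OF a] bH[of b, OF b]
          sH[of a, OF a] sH[of b, OF b]]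
      by simp
  qed
  then show ?thesis
    using Faa_HomD(9,10)[OF f] by (simp add: delta1_def faa_prod_def)
qed

section \<open>The differential as an action on prolonged jets\<close>

lemma faa_app_delta1:
  assumes S: "finite S" "z \<notin> S" and c: "\<And>i. i \<in> S \<Longrightarrow> c i \<in> Hom C W (mobj M \<star> mobj M)"
    and x: "x \<in> Hom C W (mobj M \<star> X)"
  shows "faa_app C (delta1 C f) S c x
    = plus_map C N (base_term z S c x) (sum_map C N W (tangent_term S c x) S)"
proof -
  obtain xs where xs: "distinct xs" "set xs = S"
    using finite_distinct_list[OF S(1)] by blast
  have h: "delta1 C f \<in> Hom (Faa C) (prod_cmon C M M, mobj M \<star> X) (N, mobj N)"
    using delta1_Hom by (simp add: faa_prod_def)
  have "faa_app C (delta1 C f) (set xs) c x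
      = apply_map C (coeff (delta1 C f) (length xs)) (map c xs) x"
    using c xs x by (intro faa_app_set[OF h xs(1)]) (auto simp: mobj_prod_cmon)
  moreover have "coeff (delta1 C f) = delta1_coeff C f"
    by (simp add: delta1_def Let_def)
  ultimately show ?thesis
    using apply_delta1_coeff[OF refl refl xs(1) refl, of z c W x] S c x xs(2) by simp
qed

lemma prolong_jets:
  assumes z: "z \<notin> S" and c: "c \<in> jets C W (faa_prod C (M, mobj M) (M, X)) S"
  shows "prolong C (M, X) z c \<in> jets C W (M, X) (insert z S)"
proof (rule jetsI')
  fix T assume T: "T \<subseteq> insert z S"
  have o: "jobj (M, X) U \<in> Obj C" for U :: "'b set"
    using A_Obj X_Obj by (simp add: jobj_def)
  have c': "c U \<in> Hom C W (mobj M \<star> jobj (M, X) U)" if "U \<subseteq> S" for U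
    using jets_at[OF c that] unfolding jobj_faa_prod by (cases "U = {}") auto
  show "prolong C (M, X) z c T \<in> Hom C W (jobj (M, X) T)"
  proof (cases "z \<in> T")
    case True
    then have "T - {z} \<subseteq> S" "T \<noteq> {}"
      using T by auto
    then show ?thesis
      using Comp_Hom[OF c' Proj0_Hom[OF A_Obj o]] True by (simp add: prolong_def)
  next
    case False
    then have "T \<subseteq> S"
      using T by auto
    then show ?thesis
      using Comp_Hom[OF c' Proj1_Hom[OF A_Obj o]] False by (simp add: prolong_def)
  qed
qed

text \<open>Arranging the partitions of \<open>insert z S\<close> by their trace on \<open>S\<close>
  matches the two parts of the differential term by term. A block \<open>{z}\<close> contributes the
  first component of \<open>c {}\<close>, which is the direction; putting \<open>z\<close> into a
  block \<open>B\<close> replaces the second component of \<open>c B\<close> by the first.\<close>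

lemma jet_map_delta1:
  assumes S: "finite S" "z \<notin> S" and c: "c \<in> jets C W (faa_prod C (M, mobj M) (M, X)) S"
  shows "jet_map C (delta1 C f) c S = jet_map C f (prolong C (M, X) z c) (insert z S)"
proof -
  have h: "delta1 C f \<in> Hom (Faa C) (prod_cmon C M M, mobj M \<star> X) (N, mobj N)"
    using delta1_Hom by (simp add: faa_prod_def)
  have c': "c \<in> jets C W (prod_cmon C M M, mobj M \<star> X) S"
    using c by (simp add: faa_prod_def)
  let ?d = "prolong C (M, X) z c"
  have d: "?d \<in> jets C W (M, X) (insert z S)"
    by (rule prolong_jets[OF S(2) c])
  have d0: "?d {} = c {} \<Zcomp> Proj1 C (mobj M) X" "?d {z} = c {} \<Zcomp> Proj0 C (mobj M) X"
    by (simp_all add: prolong_def)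
  have x: "c {} \<in> Hom C W (mobj M \<star> X)"
    by (rule jets_point[OF c'])
  note W = Hom_Dom[OF x]
  have ne: "insert z S \<noteq> {}"
    by simp
  have F: "faa_app C f Q ?d (?d {}) \<in> Hom C W (mobj N)" if "partition_on (insert z S) Q" for Q
    using jet_term_Hom[OF f d _ ne that] S by simp
  have expand: "faa_app C (delta1 C f) P c (c {})
      = plus_map C N (faa_app C f (insert {z} P) ?d (?d {}))
          (sum_map C N W (\<lambda>B. faa_app C f (insert (insert z B) (P - {B})) ?d (?d {})) P)"
    if P: "partition_on S P" for P
  proof -
    have fin: "finite P"
      by (rule finite_elements[OF S(1) P])
    have zP: "z \<notin> B" "B \<noteq> {}" if "B \<in> P" for B
      using partition_on_block_subset[OF P that] partition_on_block_nonempty[OF P that] S(2) by auto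
    have sz: "{z} \<notin> P"
      using zP by blast
    have cB: "c B \<in> Hom C W (mobj M \<star> mobj M)" if "B \<in> P" for B
      using jets_block[OF c' P that] by (simp add: mobj_prod_cmon)
    have dB: "?d B = c B \<Zcomp> Proj1 C (mobj M) (mobj M)" "?d (insert z B) = c B \<Zcomp> Proj0 C (mobj M) (mobj M)" if "B \<in> P" for B
      using zP[OF that] by (simp_all add: prolong_def)
    \<comment> \<open>The indices are now blocks, and the extra index of the base term is the block
      \<open>{z}\<close> itself.\<close>
    have 1: "base_term {z} P c (c {}) = faa_app C f (insert {z} P) ?d (?d {})"
      unfolding base_term_def d0(1)
    proof (rule faa_app_cong)
      fix B assume B: "B \<in> insert {z} P"
      show "(if B = {z} then c {} \<Zcomp> Proj0 C (mobj M) X else c B \<Zcomp> Proj1 C (mobj M) (mobj M)) = ?d B"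
        using B d0(2) dB(1) by auto
    qed (use fin in simp)
    have 2: "tangent_term P c (c {}) B = faa_app C f (insert (insert z B) (P - {B})) ?d (?d {})" if B: "B \<in> P" for B
    proof -
      \<comment> \<open>Enlarging \<open>B\<close> by \<open>z\<close> only renames one index,
        injectively, because no block of \<open>P\<close> contains \<open>z\<close>.\<close>
      let ?h = "\<lambda>D. if D = B then insert z B else D"
      have im: "?h ` P = insert (insert z B) (P - {B})"
        using B by auto
      have inj: "inj_on ?h P"
        using zP by (intro inj_onI) (auto split: if_splits)
      have dh: "?d (?h D) \<in> Hom C W (mobj M)" if "D \<in> P" for D
        using dB[OF that] proj_comps'[OF cB[OF that]] by (cases "D = B") simp_all
      have "faa_app C f (?h ` P) ?d (?d {}) = faa_app C f P (\<lambda>D. ?d (?h D)) (?d {})"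
        by (intro faa_app_reindex[OF f inj fin _ jets_point[OF d]] dh)
      also have "\<dots> = tangent_term P c (c {}) B"
        unfolding tangent_term_def d0(1) using dB by (intro faa_app_cong[OF fin]) auto
      finally show ?thesis
        unfolding im ..
    qed
    have "sum_map C N W (tangent_term P c (c {})) P
        = sum_map C N W (\<lambda>B. faa_app C f (insert (insert z B) (P - {B})) ?d (?d {})) P"
      using 2 F[OF partition_on_insert_into_block[OF S(2) P]] by (intro N.sum_cong[OF W refl]) auto
    then show ?thesis
      using faa_app_delta1[OF fin sz cB x] 1 by simp
  qed
  have RHS: "jet_map C f ?d (insert z S) = sum_map C N W
      (\<lambda>P. plus_map C N (faa_app C f (insert {z} P) ?d (?d {}))
        (sum_map C N W (\<lambda>B. faa_app C f (insert (insert z B) (P - {B})) ?d (?d {})) P)) (parts S)"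
    unfolding jet_map_nonempty[OF f d ne] by (rule N.sum_parts_insert[OF W S F])
  have tH: "faa_app C (delta1 C f) P c (c {}) \<in> Hom C W (mobj N)" if P: "partition_on S P" for P
    unfolding expand[OF P]
    using F[OF partition_on_insert_singleton[OF S(2) P]] F[OF partition_on_insert_into_block[OF S(2) P]]
    by (intro plus_map_Hom[OF N_cmon] N.sum_closed[OF W]) auto
  have "jet_map C (delta1 C f) c S = sum_map C N W (\<lambda>P. faa_app C (delta1 C f) P c (c {})) (parts S)"
  proof (cases "S = {}")
    \<comment> \<open>The base coefficient of the differential already takes values in the monoid,
      so over the empty set its value is the sum over the single empty partition and the two cases
      of \<open>jet_map\<close> take the same form.\<close>
    case True
    have "parts S = {{}}"
      unfolding True by (auto simp: partition_on_empty)
    moreover have "sum_map C N W (\<lambda>P. faa_app C (delta1 C f) P c (c {})) {{}} = faa_app C (delta1 C f) {} c (c {})"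
      using tH[of "{}"] True by (intro N.sum_singleton[OF W]) (simp add: partition_on_empty)
    ultimately show ?thesis
      by (simp add: True jet_map_def faa_app_empty)
  next
    case False
    then show ?thesis
      by (rule jet_map_nonempty[OF h c'])
  qed
  also have "\<dots> = jet_map C f ?d (insert z S)"
    unfolding RHS using expand tH by (intro N.sum_cong[OF W refl]) auto
  finally show ?thesis .
qed

end

end

section \<open>The axioms\<close>

lemma mobj_Faa_L: "mobj (Faa_L C P) = (fst P, mobj (fst P))"
  by (simp add: Faa_L_def Let_def)

lemma jobj_Faa_L: "jobj (mobj (Faa_L C P)) T = mobj (fst P)"
  by (simp add: mobj_Faa_L jobj_def)

context cartesian_category
begin

interpretation Faa: cartesian_category "Faa C"
  by (rule cartesian_Faa)

lemmas Faa_homs = Faa.Hom_intros[unfolded Faa_simps(2-9)]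

lemma Faa_L_Obj: "P \<in> Obj (Faa C) \<Longrightarrow> mobj (Faa_L C P) \<in> Obj (Faa C)"
  using comm_monoid_in_Obj by (auto simp: mobj_Faa_L is_faa_obj_def)

text \<open>The pairing of \<open>Faa C\<close> is known by its universal property; its components
  on a jet are found by composing with the projections.\<close>

lemma jet_map_pair:
  assumes f: "f \<in> Hom (Faa C) P Q" and g: "g \<in> Hom (Faa C) P R"
    and S: "finite S" and c: "c \<in> jets C W P S"
  shows "jet_map C \<langle>f, g\<rangle>\<^bsub>Faa C\<^esub> c S = \<langle>jet_map C f c S, jet_map C g c S\<rangle>"
proof -
  note Q = Faa_Hom_Obj(2)[OF f] and R = Faa_Hom_Obj(2)[OF g]
  have h: "\<langle>f, g\<rangle>\<^bsub>Faa C\<^esub> \<in> Hom (Faa C) P (faa_prod C Q R)"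
    using Faa_homs(2)[OF f g] .
  have "jet_map C f c S = jet_map C \<langle>f, g\<rangle>\<^bsub>Faa C\<^esub> c S \<Zcomp> Proj0 C (jobj Q S) (jobj R S)"
    using Faa.pair_Proj0[OF f g] jet_map_comp'[OF h faa_proj_Hom(1)[OF Q R] S c]
      jet_map_proj(1)[OF Q R S jet_map_jets'[OF h c S]] by simp
  moreover have "jet_map C g c S = jet_map C \<langle>f, g\<rangle>\<^bsub>Faa C\<^esub> c S \<Zcomp> Proj1 C (jobj Q S) (jobj R S)"
    using Faa.pair_Proj1[OF f g] jet_map_comp'[OF h faa_proj_Hom(2)[OF Q R] S c]
      jet_map_proj(2)[OF Q R S jet_map_jets'[OF h c S]] by simp
  ultimately show ?thesis
    using pair_eta[OF jet_map_at[OF h c S, unfolded jobj_faa_prod] jobj_Obj[OF Q] jobj_Obj[OF R]] by simp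
qed

section \<open>The monoid \<open>Faa_L C P\<close> and its operations on jets\<close>

context
  fixes P
  assumes P: "P \<in> Obj (Faa C)"
begin

lemma fst_cmon: "comm_monoid_in C (fst P)"
  using P by (auto simp: is_faa_obj_def)

text \<open>This is the interchange law once more; it makes the addition of \<open>Faa_L\<close> a
  linear map in the sense of \<open>linear_faa_Hom\<close>.\<close>

lemma cmon_hom_madd: "cmon_hom C (prod_cmon C (fst P) (fst P)) (fst P) (madd (fst P))"
proof -
  let ?M = "fst P" and ?A = "mobj (fst P)"
  note M = fst_cmon and A = comm_monoid_in_Obj[OF fst_cmon]
  note P0 = Comp_Hom[OF _ Proj0_Hom[OF A A]] and P1 = Comp_Hom[OF _ Proj1_Hom[OF A A]]
  have madd: "a \<Zcomp> madd ?M = plus_map C ?M (a \<Zcomp> Proj0 C ?A ?A) (a \<Zcomp> Proj1 C ?A ?A)"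
    if "a \<in> Hom C W (?A \<star> ?A)" for a W
    unfolding plus_map_def pair_eta[OF that A A] ..
  have "plus_map C (prod_cmon C ?M ?M) a b \<Zcomp> madd ?M = plus_map C ?M (a \<Zcomp> madd ?M) (b \<Zcomp> madd ?M)"
    if a: "a \<in> Hom C W (?A \<star> ?A)" and b: "b \<in> Hom C W (?A \<star> ?A)" for a b W
    unfolding madd[OF a] madd[OF b]
      madd[OF plus_map_Hom[OF prod_cmon_comm_monoid[OF M M], unfolded mobj_prod_cmon, OF a b]]
      Proj_plus_prod_cmon[OF M M a b]
    by (rule plus_map_interchange[OF M P0[OF a] P0[OF b] P1[OF a] P1[OF b]])
  moreover have "zero_map C (prod_cmon C ?M ?M) W \<Zcomp> madd ?M = zero_map C ?M W" if W: "W \<in> Obj C" for W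
    unfolding madd[OF zero_map_Hom[OF prod_cmon_comm_monoid[OF M M] W, unfolded mobj_prod_cmon]]
      Proj_zero_prod_cmon[OF M M W]
    by (rule plus_map_zero_left[OF M zero_map_Hom[OF M W]])
  ultimately show ?thesis
    unfolding cmon_hom_def mobj_prod_cmon using madd_Hom[OF M] by blast
qed

lemma cmon_hom_mzero: "cmon_hom C (one_cmon C) (fst P) (mzero (fst P))"
proof -
  let ?M = "fst P"
  note M = fst_cmon
  have O: "mobj (one_cmon C) = One C"
    by (simp add: one_cmon_def)
  have z: "a \<Zcomp> mzero ?M = zero_map C ?M W" if "a \<in> Hom C W (One C)" for a W
    unfolding zero_map_def bang_eq[OF that] ..
  note p = plus_map_Hom[OF one_cmon_comm_monoid, unfolded O]
    and zz = zero_map_Hom[OF one_cmon_comm_monoid, unfolded O]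
  show ?thesis
    unfolding cmon_hom_def O
    using mzero_Hom[OF M] z[OF p] z[OF zz] z plus_map_zero_left[OF M zero_map_Hom[OF M Hom_Dom]]
    by simp
qed

lemma madd_Faa_L_Hom:
    "madd (Faa_L C P) \<in> Hom (Faa C) (faa_prod C (mobj (Faa_L C P)) (mobj (Faa_L C P))) (mobj (Faa_L C P))"
  and jet_map_madd: "finite S \<Longrightarrow>
    c \<in> jets C W (faa_prod C (mobj (Faa_L C P)) (mobj (Faa_L C P))) S \<Longrightarrow>
    jet_map C (madd (Faa_L C P)) c S = c S \<Zcomp> madd (fst P)"
proof -
  note M = fst_cmon and A = comm_monoid_in_Obj[OF fst_cmon]
  note l = prod_cmon_comm_monoid[OF M M] M Prod_Obj[OF A A] A cmon_hom_madd madd_Hom[OF M]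
  show "madd (Faa_L C P) \<in> Hom (Faa C) (faa_prod C (mobj (Faa_L C P)) (mobj (Faa_L C P))) (mobj (Faa_L C P))"
    using linear_faa_Hom[OF l] by (simp add: Faa_L_def Let_def faa_prod_def mobj_prod_cmon)
  show "jet_map C (madd (Faa_L C P)) c S = c S \<Zcomp> madd (fst P)"
    if "finite S" "c \<in> jets C W (faa_prod C (mobj (Faa_L C P)) (mobj (Faa_L C P))) S"
    using jet_map_linear[OF l that(1), of c W] that(2)
    by (simp add: Faa_L_def Let_def faa_prod_def mobj_prod_cmon)
qed

lemma mzero_Faa_L_Hom: "mzero (Faa_L C P) \<in> Hom (Faa C) (One (Faa C)) (mobj (Faa_L C P))"
  and jet_map_mzero: "finite S \<Longrightarrow> c \<in> jets C W (One (Faa C)) S \<Longrightarrow>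
    jet_map C (mzero (Faa_L C P)) c S = c S \<Zcomp> mzero (fst P)"
proof -
  note M = fst_cmon and A = comm_monoid_in_Obj[OF fst_cmon]
  have O: "mobj (one_cmon C) = One C"
    by (simp add: one_cmon_def)
  note l = one_cmon_comm_monoid M One_Obj A cmon_hom_mzero mzero_Hom[OF M]
  show "mzero (Faa_L C P) \<in> Hom (Faa C) (One (Faa C)) (mobj (Faa_L C P))"
    using linear_faa_Hom[OF l] by (simp add: Faa_L_def Let_def O)
  show "jet_map C (mzero (Faa_L C P)) c S = c S \<Zcomp> mzero (fst P)"
    if "finite S" "c \<in> jets C W (One (Faa C)) S"
    using jet_map_linear[OF l that(1), of c W] that(2) by (simp add: Faa_L_def Let_def O)
qed

lemmas plus_Faa_Hom = Faa.plus_map_Hom'[of "Faa_L C P", OF madd_Faa_L_Hom[folded Faa_simps(4)]]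
lemmas zero_Faa_Hom = Faa.zero_map_Hom'[of "Faa_L C P", OF mzero_Faa_L_Hom]

text \<open>Sums in \<open>Faa C\<close> become sums in the underlying monoid, coefficient by
  coefficient; the monoid laws of \<open>Faa_L\<close> and axiom [CD.2] are transferred along
  this.\<close>

lemma jet_map_plus_Faa:
  assumes f: "f \<in> Hom (Faa C) Q (mobj (Faa_L C P))" and g: "g \<in> Hom (Faa C) Q (mobj (Faa_L C P))"
    and S: "finite S" and c: "c \<in> jets C W Q S"
  shows "jet_map C (plus_map (Faa C) (Faa_L C P) f g) c S = plus_map C (fst P) (jet_map C f c S) (jet_map C g c S)"
proof -
  note fg = Faa_homs(2)[OF f g]
  show ?thesis
    unfolding plus_map_def Faa_simps
      jet_map_comp'[OF fg madd_Faa_L_Hom S c] jet_map_madd[OF S jet_map_jets'[OF fg c S]]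
      jet_map_pair[OF f g S c] ..
qed

lemma jet_map_zero_Faa:
  assumes Q: "Q \<in> Obj (Faa C)" and S: "finite S" and c: "c \<in> jets C W Q S"
  shows "jet_map C (zero_map (Faa C) (Faa_L C P) Q) c S = zero_map C (fst P) W"
proof -
  have b: "bang (Faa C) Q \<in> Hom (Faa C) Q (One (Faa C))"
    by (rule Faa.bang_Hom[OF Q])
  have "jobj (One (Faa C)) S = One C"
    by (simp add: jobj_def one_cmon_def)
  then have "jet_map C (bang (Faa C) Q) c S = bang C W"
    using jet_map_at[OF b c S] bang_eq by simp
  then show ?thesis
    unfolding zero_map_def Faa_simps(3)
      jet_map_comp'[OF b mzero_Faa_L_Hom S c] jet_map_mzero[OF S jet_map_jets'[OF b c S]] by simp
qed

lemma Faa_L_comm_monoid: "comm_monoid_in (Faa C) (Faa_L C P)"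
proof (rule Faa.comm_monoid_inI)
  show "mobj (Faa_L C P) \<in> Obj (Faa C)"
    by (rule Faa_L_Obj[OF P])
  show "madd (Faa_L C P) \<in> Hom (Faa C) (Prod (Faa C) (mobj (Faa_L C P)) (mobj (Faa_L C P))) (mobj (Faa_L C P))"
    using madd_Faa_L_Hom by simp
  show "mzero (Faa_L C P) \<in> Hom (Faa C) (One (Faa C)) (mobj (Faa_L C P))"
    by (rule mzero_Faa_L_Hom)
  note M = fst_cmon
  note at = jet_map_at[where Q = "mobj (Faa_L C P)", unfolded jobj_Faa_L]
  let ?p = "plus_map (Faa C) (Faa_L C P)"
  fix Q f g h
  assume f: "f \<in> Hom (Faa C) Q (mobj (Faa_L C P))"
  note Q = Faa_Hom_Obj(1)[OF f]
  note z = zero_Faa_Hom[OF Q]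
  show "?p (zero_map (Faa C) (Faa_L C P) Q) f = f"
    by (rule Faa_eqI'[OF plus_Faa_Hom[OF z f] f])
      (simp add: jet_map_plus_Faa[OF z f] jet_map_zero_Faa[OF Q] plus_map_zero_left[OF M at[OF f]])
  assume g: "g \<in> Hom (Faa C) Q (mobj (Faa_L C P))"
  show "?p f g = ?p g f"
    by (rule Faa_eqI'[OF plus_Faa_Hom[OF f g] plus_Faa_Hom[OF g f]])
      (simp add: jet_map_plus_Faa[OF f g] jet_map_plus_Faa[OF g f] plus_map_comm[OF M at[OF f] at[OF g]])
  assume h: "h \<in> Hom (Faa C) Q (mobj (Faa_L C P))"
  note fg = plus_Faa_Hom[OF f g] and gh = plus_Faa_Hom[OF g h]
  show "?p (?p f g) h = ?p f (?p g h)"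
    by (rule Faa_eqI'[OF plus_Faa_Hom[OF fg h] plus_Faa_Hom[OF f gh]])
      (simp add: jet_map_plus_Faa[OF f g] jet_map_plus_Faa[OF g h] jet_map_plus_Faa[OF fg h]
        jet_map_plus_Faa[OF f gh] plus_map_assoc[OF M at[OF f] at[OF g] at[OF h]])
qed

end

section \<open>First and second differentials on paired jets\<close>

lemma delta1_Hom':
  assumes "f \<in> Hom (Faa C) P Q"
  shows "delta1 C f \<in> Hom (Faa C) (faa_prod C (mobj (Faa_L C P)) P) (mobj (Faa_L C Q))"
  using delta1_Hom[of f "fst P" "snd P" "fst Q" "snd Q"] assms by (simp add: mobj_Faa_L)

lemma jet_map_delta1':
  assumes "f \<in> Hom (Faa C) P Q" "finite S" "z \<notin> S" "c \<in> jets C W (faa_prod C (mobj (Faa_L C P)) P) S"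
  shows "jet_map C (delta1 C f) c S = jet_map C f (prolong C P z c) (insert z S)"
  using jet_map_delta1[of f "fst P" "snd P" "fst Q" "snd Q" S z c W] assms by (simp add: mobj_Faa_L)

lemma prolong_jets':
  assumes "P \<in> Obj (Faa C)" "z \<notin> S" "c \<in> jets C W (faa_prod C (mobj (Faa_L C P)) P) S"
  shows "prolong C P z c \<in> jets C W P (insert z S)"
proof -
  \<comment> \<open>In \<open>prolong_jets\<close> the typing of the object comes from a map out of
    it; the identity provides one.\<close>
  have "faa_id C P \<in> Hom (Faa C) (fst P, snd P) (fst P, snd P)"
    using faa_id_Hom[OF assms(1)] by simp
  from prolong_jets[OF this assms(2), of c W] show ?thesis
    using assms(3) by (simp add: mobj_Faa_L)
qed

lemma prolong_pair:
  assumes T: "T \<subseteq> insert z S" and c: "\<And>T. T \<subseteq> S \<Longrightarrow> c T = \<langle>u T, w T\<rangle>"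
    and u: "\<And>T. T \<subseteq> S \<Longrightarrow> u T \<in> Hom C W (mobj (fst P))" and w: "\<And>T. T \<subseteq> S \<Longrightarrow> w T \<in> Hom C W (jobj P T)"
  shows "prolong C P z c T = (if z \<in> T then u (T - {z}) else w T)"
proof (cases "z \<in> T")
  case True
  then have "T - {z} \<subseteq> S"
    using T by auto
  then show ?thesis
    using True c pair_Proj0[OF u w] by (simp add: prolong_def)
next
  case False
  then have "T \<subseteq> S"
    using T by auto
  then show ?thesis
    using False c pair_Proj1[OF u w] by (simp add: prolong_def)
qed

lemma pair_jets:
  assumes "\<And>T. T \<subseteq> S \<Longrightarrow> c T = \<langle>u T, w T\<rangle>"
    and "\<And>T. T \<subseteq> S \<Longrightarrow> u T \<in> Hom C W (mobj (fst P))" "\<And>T. T \<subseteq> S \<Longrightarrow> w T \<in> Hom C W (jobj P T)"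
  shows "c \<in> jets C W (faa_prod C (mobj (Faa_L C P)) P) S"
proof (rule jetsI')
  fix T assume T: "T \<subseteq> S"
  show "c T \<in> Hom C W (jobj (faa_prod C (mobj (Faa_L C P)) P) T)"
    unfolding jobj_faa_prod jobj_Faa_L assms(1)[OF T] by (rule pair_Hom[OF assms(2,3)[OF T]])
qed

text \<open>Formally the prolonged jet is \<open>w + \<epsilon>\<^sub>z u\<close>: the differential
  of \<open>f\<close> at \<open>w\<close> in direction \<open>u\<close> is the part with
  \<open>\<epsilon>\<^sub>z\<close> of the value of \<open>f\<close> there.\<close>

lemma jet_map_delta1_pair:
  assumes f: "f \<in> Hom (Faa C) P Q" and S: "finite S" "z \<notin> S"
    and c: "\<And>T. T \<subseteq> S \<Longrightarrow> c T = \<langle>u T, w T\<rangle>"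
    and u: "\<And>T. T \<subseteq> S \<Longrightarrow> u T \<in> Hom C W (mobj (fst P))" and w: "\<And>T. T \<subseteq> S \<Longrightarrow> w T \<in> Hom C W (jobj P T)"
  shows "jet_map C (delta1 C f) c S = jet_map C f (\<lambda>T. if z \<in> T then u (T - {z}) else w T) (insert z S)"
proof -
  note cj = pair_jets[OF c u w]
  have "jet_map C (delta1 C f) c S = jet_map C f (prolong C P z c) (insert z S)"
    by (rule jet_map_delta1'[OF f S cj])
  also have "\<dots> = jet_map C f (\<lambda>T. if z \<in> T then u (T - {z}) else w T) (insert z S)"
    using prolong_pair[OF _ c u w] S
    by (intro jet_map_cong'[OF f prolong_jets'[OF Faa_Hom_Obj(1)[OF f] S(2) cj], symmetric]) auto
  finally show ?thesis .
qed

lemma jets_shift: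
  assumes u: "\<And>T. T \<subseteq> S \<Longrightarrow> u T \<in> Hom C W (mobj (fst P))" and w: "\<And>T. T \<subseteq> S \<Longrightarrow> w T \<in> Hom C W (jobj P T)"
  shows "(\<lambda>T. if z \<in> T then u (T - {z}) else w T) \<in> jets C W P (insert z S)"
proof (rule jetsI')
  fix T assume T: "T \<subseteq> insert z S"
  show "(if z \<in> T then u (T - {z}) else w T) \<in> Hom C W (jobj P T)"
  proof (cases "z \<in> T")
    case True
    then have "T - {z} \<subseteq> S" "T \<noteq> {}"
      using T by auto
    then show ?thesis
      using True u by simp
  next
    case False
    then have "T \<subseteq> S"
      using T by auto
    then show ?thesis
      using False w by simp
  qed
qed

text \<open>Formally \<open>E\<close> is \<open>d + \<epsilon>\<^sub>z b + \<epsilon>\<^sub>y c +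
  \<epsilon>\<^sub>y \<epsilon>\<^sub>z a\<close>, where the outer differential introduces
  \<open>z\<close> and the inner one \<open>y\<close>. Exchanging \<open>y\<close> and
  \<open>z\<close> exchanges \<open>b\<close> and \<open>c\<close>.\<close>

lemma jet_map_delta1_delta1:
  assumes f: "f \<in> Hom (Faa C) P Q" and S: "finite S" "z \<notin> S" "y \<notin> S" "y \<noteq> z"
    and e: "\<And>T. T \<subseteq> S \<Longrightarrow> e T = \<langle>\<langle>a T, b T\<rangle>, \<langle>c T, d T\<rangle>\<rangle>"
    and abc: "\<And>T. T \<subseteq> S \<Longrightarrow> a T \<in> Hom C W (mobj (fst P))" "\<And>T. T \<subseteq> S \<Longrightarrow> b T \<in> Hom C W (mobj (fst P))"
      "\<And>T. T \<subseteq> S \<Longrightarrow> c T \<in> Hom C W (mobj (fst P))"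
    and d: "\<And>T. T \<subseteq> S \<Longrightarrow> d T \<in> Hom C W (jobj P T)"
  defines "E \<equiv> \<lambda>T. if y \<in> T then if z \<in> T then a (T - {y} - {z}) else c (T - {y})
      else if z \<in> T then b (T - {z}) else d T"
  shows "jet_map C (delta1 C (delta1 C f)) e S = jet_map C f E (insert y (insert z S))"
    and "E \<in> jets C W P (insert y (insert z S))"
proof -
  let ?LP = "mobj (Faa_L C P)"
  let ?P2 = "faa_prod C ?LP P"
  have A2: "mobj (fst ?P2) = mobj (fst P) \<star> mobj (fst P)"
    by (simp add: faa_prod_def mobj_prod_cmon mobj_Faa_L)
  have j2: "jobj ?P2 T = mobj (fst P) \<star> jobj P T" for T :: "'a set"
    by (simp add: jobj_faa_prod jobj_Faa_L)
  let ?u = "\<lambda>T. if z \<in> T then a (T - {z}) else c T" and ?w = "\<lambda>T. if z \<in> T then b (T - {z}) else d T"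
  have sub: "T - {z} \<subseteq> S" "z \<notin> T \<Longrightarrow> T \<subseteq> S" if "T \<subseteq> insert z S" for T
    using that by auto
  have uw: "?u T \<in> Hom C W (mobj (fst P))" "?w T \<in> Hom C W (jobj P T)" if T: "T \<subseteq> insert z S" for T
  proof -
    show "?u T \<in> Hom C W (mobj (fst P))"
      using sub[OF T] abc by auto
    have "jobj P T = mobj (fst P)" if "z \<in> T"
      using that by (intro jobj_simps) auto
    then show "?w T \<in> Hom C W (jobj P T)"
      using sub[OF T] abc d by auto
  qed
  have yS: "finite (insert z S)" "y \<notin> insert z S"
    using S by auto
  \<comment> \<open>After the outer differential each coefficient over \<open>insert z S\<close> is
    still a pair of a tangent and a base part, so the formula for pairs applies a second
    time.\<close>
  let ?e1 = "\<lambda>T. if z \<in> T then \<langle>a (T - {z}), b (T - {z})\<rangle> else \<langle>c T, d T\<rangle>"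
  have "jet_map C (delta1 C (delta1 C f)) e S = jet_map C (delta1 C f) ?e1 (insert z S)"
    using abc d by (intro jet_map_delta1_pair[OF delta1_Hom'[OF f] S(1,2) e, where W = W])
      (auto simp: A2 j2 intro: pair_Hom)
  also have "\<dots> = jet_map C f (\<lambda>T. if y \<in> T then ?u (T - {y}) else ?w T) (insert y (insert z S))"
    by (rule jet_map_delta1_pair[OF f yS, of ?e1 ?u ?w W]) (use uw in auto)
  also have "(\<lambda>T. if y \<in> T then ?u (T - {y}) else ?w T) = E"
    using S(4) unfolding E_def by (auto simp: fun_eq_iff)
  finally show "jet_map C (delta1 C (delta1 C f)) e S = jet_map C f E (insert y (insert z S))" .
  show "E \<in> jets C W P (insert y (insert z S))"
    using jets_shift[of "insert z S" ?u W P ?w y, OF uw]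
    unfolding \<open>(\<lambda>T. if y \<in> T then ?u (T - {y}) else ?w T) = E\<close> .
qed

text \<open>A block with \<open>z\<close> but without \<open>y\<close> has coefficient zero. So of
  the ways to add \<open>z\<close> to a partition of \<open>S\<close> just one survives, putting it
  into the block of \<open>y\<close>, where \<open>E\<close> takes the value of \<open>G\<close>.
  The coefficients of \<open>E\<close> with \<open>y\<close> but without \<open>z\<close> do not
  enter this term, which is why the value in [CD.6] is independent of \<open>c\<close>.\<close>

lemma jet_map_contract:
  assumes f: "f \<in> Hom (Faa C) P Q" and S: "finite S" "y \<in> S" "z \<notin> S"
    and E: "E \<in> jets C W P (insert z S)" and G: "G \<in> jets C W P S"
    and zero: "\<And>T. T \<subseteq> S \<Longrightarrow> y \<notin> T \<Longrightarrow> E (insert z T) = zero_map C (fst P) W"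
    and shift: "\<And>T. T \<subseteq> S \<Longrightarrow> y \<in> T \<Longrightarrow> E (insert z T) = G T"
    and eq: "\<And>T. T \<subseteq> S \<Longrightarrow> y \<notin> T \<Longrightarrow> E T = G T"
  shows "jet_map C f E (insert z S) = jet_map C f G S"
proof -
  obtain M X N Y where PQ: "P = (M, X)" "Q = (N, Y)"
    by (cases P, cases Q)
  note f = f[unfolded PQ] and E = E[unfolded PQ] and G = G[unfolded PQ]
  interpret N: cmon_in_cartesian C N
    by unfold_locales (rule Faa_HomD(3)[OF f])
  note W = jets_Obj[OF E]
  have ne: "insert z S \<noteq> {}" "S \<noteq> {}"
    using S by auto
  have E0: "E {} = G {}"
    using eq by simp
  have fin: "finite (insert z S)"
    using S by simp
  let ?F = "\<lambda>R. faa_app C f R E (E {})"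
  have F: "?F R \<in> Hom C W (mobj N)" if "partition_on (insert z S) R" for R
    by (rule jet_term_Hom[OF f E fin ne(1) that])
  have tG: "faa_app C f R G (G {}) \<in> Hom C W (mobj N)" if "partition_on S R" for R
    by (rule jet_term_Hom[OF f G S(1) ne(2) that])
  have *: "plus_map C N (?F (insert {z} R)) (sum_map C N W (\<lambda>B. ?F (insert (insert z B) (R - {B}))) R)
      = faa_app C f R G (G {})" if R: "partition_on S R" for R
  proof -
    have finR: "finite R"
      by (rule finite_elements[OF S(1) R])
    obtain D where D: "D \<in> R" "y \<in> D"
      using S(2) partition_onD1[OF R] by blast
    have sub: "B \<subseteq> S" if "B \<in> R" for B
      by (rule partition_on_block_subset[OF R that])
    have zB: "z \<notin> B" if "B \<in> R" for B
      using sub[OF that] S(3) by blast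
    have yB: "y \<notin> B" if "B \<in> R" "B \<noteq> D" for B
      using partition_on_block_eq[OF R that(1) D(1) _ D(2)] that(2) by blast
    note R1 = partition_on_insert_singleton[OF S(3) R] and R2 = partition_on_insert_into_block[OF S(3) R]
    have "?F (insert {z} R) = zero_map C N W"
    proof (rule faa_app_zero[OF f _ insertI1 jets_block[OF E R1] jets_point[OF E]])
      show "E {z} = zero_map C M W"
        using zero[of "{}"] PQ by simp
    qed (use finR in simp)
    moreover have "?F (insert (insert z B) (R - {B})) = zero_map C N W" if B: "B \<in> R - {D}" for B
    proof (rule faa_app_zero[OF f _ insertI1 jets_block[OF E R2] jets_point[OF E]])
      show "E (insert z B) = zero_map C M W"
        using zero[OF sub yB] B PQ by simp
    qed (use finR B in simp_all)
    then have "sum_map C N W (\<lambda>B. ?F (insert (insert z B) (R - {B}))) R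
        = sum_map C N W (\<lambda>B. ?F (insert (insert z B) (R - {B}))) {D}"
      using finR D(1) F[OF R2] by (intro N.sum_neutral_right[OF W]) auto
    moreover have "sum_map C N W (\<lambda>B. ?F (insert (insert z B) (R - {B}))) {D}
        = ?F (insert (insert z D) (R - {D}))"
      using F[OF R2[OF D(1)]] by (rule N.sum_singleton[OF W])
    moreover have "?F (insert (insert z D) (R - {D})) = faa_app C f R G (G {})"
    proof -
      let ?h = "\<lambda>B. if B = D then insert z B else B"
      have im: "?h ` R = insert (insert z D) (R - {D})"
        using D(1) by auto
      have inj: "inj_on ?h R"
        using zB D(1) by (intro inj_onI) (auto split: if_splits)
      have Eh: "E (?h B) = G B" if "B \<in> R" for B
        using shift[OF sub[OF that]] eq[OF sub[OF that]] yB[OF that] D by (cases "B = D") auto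
      have "?F (?h ` R) = faa_app C f R (\<lambda>B. E (?h B)) (E {})"
        using Eh jets_block[OF G R] by (intro faa_app_reindex[OF f inj finR _ jets_point[OF E]]) auto
      also have "\<dots> = faa_app C f R G (G {})"
        unfolding E0 using Eh by (intro faa_app_cong[OF finR]) auto
      finally show ?thesis
        unfolding im .
    qed
    ultimately show ?thesis
      using plus_map_zero_left[OF N.cmon tG[OF R]] by simp
  qed
  have "jet_map C f E (insert z S) = sum_map C N W (\<lambda>R. plus_map C N (?F (insert {z} R))
      (sum_map C N W (\<lambda>B. ?F (insert (insert z B) (R - {B}))) R)) (parts S)"
    unfolding jet_map_nonempty[OF f E ne(1)] by (rule N.sum_parts_insert[OF W S(1,3)]) (rule F)
  also have "\<dots> = sum_map C N W (\<lambda>R. faa_app C f R G (G {})) (parts S)"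
    using * tG by (intro N.sum_cong[OF W refl]) auto
  finally show ?thesis
    unfolding jet_map_nonempty[OF f G ne(2)] .
qed

end

section \<open>Compatibility of \<open>Faa_L\<close> with products, and the differential
  axioms\<close>

context cartesian_category
begin

interpretation Faa: cartesian_category "Faa C"
  by (rule cartesian_Faa)

text \<open>The two monoids have literally the same carrier object, so it remains to compare their
  operations as maps; on jets this becomes the description of a product monoid in
  \<open>C\<close>.\<close>

lemma Faa_L_prod:
  assumes P: "P \<in> Obj (Faa C)" and Q: "Q \<in> Obj (Faa C)"
  shows "Faa_L C (faa_prod C P Q) = prod_cmon (Faa C) (Faa_L C P) (Faa_L C Q)"
proof -
  let ?LP = "mobj (Faa_L C P)" and ?LQ = "mobj (Faa_L C Q)"
  let ?M = "fst P" and ?N = "fst Q"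
  note M = fst_cmon[OF P] and N = fst_cmon[OF Q]
  note o = comm_monoid_in_Obj[OF M] comm_monoid_in_Obj[OF N]
  note LP = Faa_L_Obj[OF P] and LQ = Faa_L_Obj[OF Q] and PQ = faa_prod_Obj[OF P Q]
  note L2 = faa_prod_Obj[OF LP LQ]
  have mobj: "mobj (Faa_L C (faa_prod C P Q)) = faa_prod C ?LP ?LQ"
    by (simp add: mobj_Faa_L faa_prod_def mobj_prod_cmon)
  have fst_PQ: "fst (faa_prod C P Q) = prod_cmon C ?M ?N"
    by (simp add: faa_prod_def)
  let ?p0 = "faa_proj0 C (faa_prod C ?LP ?LQ) (faa_prod C ?LP ?LQ)"
  let ?p1 = "faa_proj1 C (faa_prod C ?LP ?LQ) (faa_prod C ?LP ?LQ)"
  let ?a = "faa_proj0 C ?LP ?LQ" and ?b = "faa_proj1 C ?LP ?LQ"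
  let ?p0a = "faa_comp C ?p0 ?a" and ?p1a = "faa_comp C ?p1 ?a"
  let ?p0b = "faa_comp C ?p0 ?b" and ?p1b = "faa_comp C ?p1 ?b"
  note p = faa_proj_Hom[OF L2 L2] and ab = faa_proj_Hom[OF LP LQ]
  note pa = Faa_homs(1)[OF p(1) ab(1)] Faa_homs(1)[OF p(2) ab(1)]
  note pb = Faa_homs(1)[OF p(1) ab(2)] Faa_homs(1)[OF p(2) ab(2)]
  note plus_a = plus_Faa_Hom[OF P pa] and plus_b = plus_Faa_Hom[OF Q pb]
  have "madd (Faa_L C (faa_prod C P Q))
    = \<langle>plus_map (Faa C) (Faa_L C P) ?p0a ?p1a, plus_map (Faa C) (Faa_L C Q) ?p0b ?p1b\<rangle>\<^bsub>Faa C\<^esub>"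
  proof (rule Faa_eqI'[OF madd_Faa_L_Hom[OF PQ, unfolded mobj] Faa_homs(2)[OF plus_a plus_b]])
    fix W S and c :: "nat set \<Rightarrow> 'm"
    assume c: "c \<in> jets C W (faa_prod C (faa_prod C ?LP ?LQ) (faa_prod C ?LP ?LQ)) S" and S: "finite S"
    let ?A = "mobj ?M" and ?B = "mobj ?N"
    have j: "jobj (faa_prod C ?LP ?LQ) S = ?A \<star> ?B"
      by (simp add: jobj_faa_prod jobj_Faa_L)
    have cS: "c S \<in> Hom C W ((?A \<star> ?B) \<star> (?A \<star> ?B))"
      using jets_at[OF c order_refl] by (simp add: jobj_faa_prod jobj_Faa_L)
    note AB = Prod_Obj[OF o]
    have c01: "c S \<Zcomp> Proj0 C (?A \<star> ?B) (?A \<star> ?B) \<in> Hom C W (?A \<star> ?B)"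
      "c S \<Zcomp> Proj1 C (?A \<star> ?B) (?A \<star> ?B) \<in> Hom C W (?A \<star> ?B)"
      by (rule Comp_Hom[OF cS Proj0_Hom[OF AB AB]] Comp_Hom[OF cS Proj1_Hom[OF AB AB]])+
    have jp: "jet_map C ?p0 c S = c S \<Zcomp> Proj0 C (?A \<star> ?B) (?A \<star> ?B)"
      "jet_map C ?p1 c S = c S \<Zcomp> Proj1 C (?A \<star> ?B) (?A \<star> ?B)"
      unfolding jet_map_proj[OF L2 L2 S c] j by simp_all
    have jab: "jet_map C ?a d S = d S \<Zcomp> Proj0 C ?A ?B" "jet_map C ?b d S = d S \<Zcomp> Proj1 C ?A ?B"
      if "d \<in> jets C W (faa_prod C ?LP ?LQ) S" for d
      unfolding jet_map_proj[OF LP LQ S that] jobj_Faa_L by simp_all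
    note jj = jab[OF jet_map_jets'[OF p(1) c S]] jab[OF jet_map_jets'[OF p(2) c S]]
    have "jet_map C (madd (Faa_L C (faa_prod C P Q))) c S = c S \<Zcomp> madd (prod_cmon C ?M ?N)"
      using jet_map_madd[OF PQ S, of c W] c unfolding mobj fst_PQ by simp
    also have "\<dots> = plus_map C (prod_cmon C ?M ?N) (c S \<Zcomp> Proj0 C (?A \<star> ?B) (?A \<star> ?B)) (c S \<Zcomp> Proj1 C (?A \<star> ?B) (?A \<star> ?B))"
      unfolding plus_map_def pair_eta[OF cS AB AB] ..
    also have "\<dots> = jet_map C \<langle>plus_map (Faa C) (Faa_L C P) ?p0a ?p1a, plus_map (Faa C) (Faa_L C Q) ?p0b ?p1b\<rangle>\<^bsub>Faa C\<^esub> c S"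
      unfolding jet_map_pair[OF plus_a plus_b S c] jet_map_plus_Faa[OF P pa S c] jet_map_plus_Faa[OF Q pb S c]
        jet_map_comp'[OF p(1) ab(1) S c] jet_map_comp'[OF p(2) ab(1) S c]
        jet_map_comp'[OF p(1) ab(2) S c] jet_map_comp'[OF p(2) ab(2) S c] jj jp
      by (rule plus_map_prod_cmon[OF M N c01])
    finally show "jet_map C (madd (Faa_L C (faa_prod C P Q))) c S
      = jet_map C \<langle>plus_map (Faa C) (Faa_L C P) ?p0a ?p1a, plus_map (Faa C) (Faa_L C Q) ?p0b ?p1b\<rangle>\<^bsub>Faa C\<^esub> c S" .
  qed
  moreover have "mzero (Faa_L C (faa_prod C P Q)) = \<langle>mzero (Faa_L C P), mzero (Faa_L C Q)\<rangle>\<^bsub>Faa C\<^esub>"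
  proof (rule Faa_eqI'[OF mzero_Faa_L_Hom[OF PQ, unfolded mobj]
        Faa_homs(2)[OF mzero_Faa_L_Hom[OF P] mzero_Faa_L_Hom[OF Q]]])
    fix W S and c :: "nat set \<Rightarrow> 'm"
    assume c: "c \<in> jets C W (One (Faa C)) S" and S: "finite S"
    have "jobj (One (Faa C)) S = One C"
      by (simp add: jobj_def one_cmon_def)
    then have cS: "c S \<in> Hom C W (One C)"
      using jets_at[OF c order_refl] by simp
    have "mzero (prod_cmon C ?M ?N) = \<langle>mzero ?M, mzero ?N\<rangle>"
      by (simp add: prod_cmon_def Let_def)
    then show "jet_map C (mzero (Faa_L C (faa_prod C P Q))) c S
        = jet_map C \<langle>mzero (Faa_L C P), mzero (Faa_L C Q)\<rangle>\<^bsub>Faa C\<^esub> c S"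
      using jet_map_mzero[OF PQ S c] jet_map_mzero[OF P S c] jet_map_mzero[OF Q S c]
        jet_map_pair[OF mzero_Faa_L_Hom[OF P] mzero_Faa_L_Hom[OF Q] S c]
        comp_pair[OF cS mzero_Hom[OF M] mzero_Hom[OF N]]
      by (simp add: fst_PQ)
  qed
  ultimately show ?thesis
    using mobj by (intro cmon.expand) (simp add: prod_cmon_def Let_def)
qed

lemma Faa_L_One: "Faa_L C (One (Faa C)) = one_cmon (Faa C)"
proof -
  note O = Faa.One_Obj
  have m: "mobj (Faa_L C (One (Faa C))) = One (Faa C)"
    by (simp add: mobj_Faa_L) (simp add: one_cmon_def)
  show ?thesis
    using m Faa.bang_eq[of "madd (Faa_L C (One (Faa C)))"] Faa.bang_eq[of "mzero (Faa_L C (One (Faa C)))"]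
      madd_Faa_L_Hom[OF O] mzero_Faa_L_Hom[OF O]
    by (intro cmon.expand) (simp add: one_cmon_def[of "Faa C"])
qed

text \<open>The coefficient of the prolonged jet at \<open>insert z S\<close> is the tangent part,
  and \<open>f\<close> acts on it by \<open>k\<close>, so the base point is forgotten. For
  \<open>f\<close> only nonempty \<open>S\<close> is considered because its base map may differ from
  \<open>k\<close>; for \<open>h\<close> base and tangent parts lie in the same monoid. This covers
  [CD.1] and [CD.3].\<close>

lemma delta1_linear:
  assumes f: "f \<in> Hom (Faa C) P Q" and k: "k \<in> Hom C (mobj (fst P)) (mobj (fst Q))"
    and h: "h \<in> Hom (Faa C) (mobj (Faa_L C P)) (mobj (Faa_L C Q))"
    and jf: "\<And>W S (c :: nat set \<Rightarrow> 'm). finite S \<Longrightarrow> S \<noteq> {} \<Longrightarrow> c \<in> jets C W P S \<Longrightarrow> jet_map C f c S = c S \<Zcomp> k"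
    and jh: "\<And>W S (c :: nat set \<Rightarrow> 'm). finite S \<Longrightarrow> c \<in> jets C W (mobj (Faa_L C P)) S \<Longrightarrow> jet_map C h c S = c S \<Zcomp> k"
  shows "delta1 C f = faa_comp C (faa_proj0 C (mobj (Faa_L C P)) P) h"
proof -
  note P = Faa_Hom_Obj(1)[OF f] and LP = Faa_L_Obj[OF Faa_Hom_Obj(1)[OF f]]
  note p0 = faa_proj_Hom(1)[OF LP P]
  show ?thesis
  proof (rule Faa_eqI'[OF delta1_Hom'[OF f] Faa_homs(1)[OF p0 h]])
    fix W S and c :: "nat set \<Rightarrow> 'm"
    assume c: "c \<in> jets C W (faa_prod C (mobj (Faa_L C P)) P) S" and S: "finite S"
    obtain z where z: "z \<notin> S"
      using ex_new_if_finite[OF infinite_UNIV_nat S] by blast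
    have "prolong C P z c (insert z S) = c S \<Zcomp> Proj0 C (mobj (fst P)) (jobj P S)"
      using z by (simp add: prolong_def)
    then show "jet_map C (delta1 C f) c S = jet_map C (faa_comp C (faa_proj0 C (mobj (Faa_L C P)) P) h) c S"
      using jet_map_delta1'[OF f S z c] jf[OF _ _ prolong_jets'[OF P z c]] S
        jet_map_comp'[OF p0 h S c] jh[OF S jet_map_jets'[OF p0 c S]] jet_map_proj(1)[OF LP P S c]
      by (simp add: jobj_Faa_L)
  qed
qed

lemma delta1_comp:
  assumes f: "f \<in> Hom (Faa C) P Q" and g: "g \<in> Hom (Faa C) Q R"
  shows "delta1 C (faa_comp C f g)
    = faa_comp C \<langle>delta1 C f, faa_comp C (faa_proj1 C (mobj (Faa_L C P)) P) f\<rangle>\<^bsub>Faa C\<^esub> (delta1 C g)"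
proof -
  note P = Faa_Hom_Obj(1)[OF f] and Q = Faa_Hom_Obj(2)[OF f]
  note LP = Faa_L_Obj[OF P]
  note fg = Faa_homs(1)[OF f g] and Df = delta1_Hom'[OF f] and Dg = delta1_Hom'[OF g]
  note p1 = faa_proj_Hom(2)[OF LP P]
  note p1f = Faa_homs(1)[OF p1 f]
  note Tf = Faa_homs(2)[OF Df p1f]
  show ?thesis
  proof (rule Faa_eqI'[OF delta1_Hom'[OF fg] Faa_homs(1)[OF Tf Dg]])
    fix W S and c :: "nat set \<Rightarrow> 'm"
    assume c: "c \<in> jets C W (faa_prod C (mobj (Faa_L C P)) P) S" and S: "finite S"
    obtain z where z: "z \<notin> S"
      using ex_new_if_finite[OF infinite_UNIV_nat S] by blast
    have iS: "finite (insert z S)"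
      using S by simp
    let ?c = "prolong C P z c"
    have pc: "?c \<in> jets C W P (insert z S)"
      by (rule prolong_jets'[OF P z c])
    have cT: "c \<in> jets C W (faa_prod C (mobj (Faa_L C P)) P) T" "finite T" "z \<notin> T" if "T \<subseteq> S" for T
      using jets_mono[OF c that] finite_subset[OF that S] z that by auto
    let ?T = "\<langle>delta1 C f, faa_comp C (faa_proj1 C (mobj (Faa_L C P)) P) f\<rangle>\<^bsub>Faa C\<^esub>"
    have T: "jet_map C ?T c T = \<langle>jet_map C (delta1 C f) c T, jet_map C f ?c T\<rangle>" if T: "T \<subseteq> S" for T
    proof -
      note t = cT[OF T]
      have e: "?c U = jet_map C (faa_proj1 C (mobj (Faa_L C P)) P) c U" if U: "U \<subseteq> T" for U
      proof -
        have "U \<subseteq> S" "z \<notin> U"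
          using U T z by auto
        then show ?thesis
          using jet_map_proj(2)[OF LP P cT(2)[OF \<open>U \<subseteq> S\<close>] cT(1)[OF \<open>U \<subseteq> S\<close>]]
          by (simp add: prolong_def jobj_Faa_L)
      qed
      have "jet_map C f ?c T = jet_map C (faa_comp C (faa_proj1 C (mobj (Faa_L C P)) P) f) c T"
        unfolding jet_map_comp'[OF p1 f t(2,1)]
        by (rule jet_map_cong'[OF f jet_map_jets'[OF p1 t(1,2)] t(2) e])
      then show ?thesis
        using jet_map_pair[OF Df p1f t(2,1)] by simp
    qed
    have u: "jet_map C (delta1 C f) c T \<in> Hom C W (mobj (fst Q))" if "T \<subseteq> S" for T
      using jet_map_at[OF Df cT(1,2)[OF that]] unfolding jobj_Faa_L .
    have w: "jet_map C f ?c T \<in> Hom C W (jobj Q T)" if "T \<subseteq> S" for T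
      using that by (intro jet_map_at[OF f jets_mono[OF pc] cT(2)]) auto
    have "jet_map C (delta1 C (faa_comp C f g)) c S = jet_map C g (jet_map C f ?c) (insert z S)"
      unfolding jet_map_delta1'[OF fg S z c] by (rule jet_map_comp'[OF f g iS pc])
    \<comment> \<open>Sorted by whether \<open>z\<close> occurs, the coefficients of the image jet
      are those of the differential of \<open>f\<close> at \<open>c\<close> and those of
      \<open>f\<close> at the base part of \<open>c\<close>: the two components of
      \<open>?T\<close>.\<close>
    also have "\<dots> = jet_map C g (\<lambda>T. if z \<in> T then jet_map C (delta1 C f) c (T - {z}) else jet_map C f ?c T) (insert z S)"
    proof (rule jet_map_cong'[OF g jets_shift[OF u w] iS])
      fix T assume T: "T \<subseteq> insert z S"
      show "jet_map C f ?c T = (if z \<in> T then jet_map C (delta1 C f) c (T - {z}) else jet_map C f ?c T)"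
      proof (cases "z \<in> T")
        case True
        then have "T - {z} \<subseteq> S" "insert z (T - {z}) = T"
          using T by auto
        then show ?thesis
          using True jet_map_delta1'[OF f cT(2,3,1)[OF \<open>T - {z} \<subseteq> S\<close>]] by simp
      qed simp
    qed
    also have "\<dots> = jet_map C (delta1 C g) (jet_map C ?T c) S"
      by (rule jet_map_delta1_pair[OF g S z T u w, symmetric])
    also have "\<dots> = jet_map C (faa_comp C ?T (delta1 C g)) c S"
      by (rule jet_map_comp'[OF Tf Dg S c, symmetric])
    finally show "jet_map C (delta1 C (faa_comp C f g)) c S = jet_map C (faa_comp C ?T (delta1 C g)) c S" .
  qed
qed

text \<open>The action preserves pairs over every index set, in particular over
  \<open>insert z S\<close>; this is [CD.4].\<close>

lemma delta1_pair:
  assumes f: "f \<in> Hom (Faa C) P Q" and g: "g \<in> Hom (Faa C) P R"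
  shows "delta1 C \<langle>f, g\<rangle>\<^bsub>Faa C\<^esub> = \<langle>delta1 C f, delta1 C g\<rangle>\<^bsub>Faa C\<^esub>"
proof -
  note P = Faa_Hom_Obj(1)[OF f]
  note fg = Faa_homs(2)[OF f g] and Df = delta1_Hom'[OF f] and Dg = delta1_Hom'[OF g]
  have cod: "mobj (Faa_L C (faa_prod C Q R)) = faa_prod C (mobj (Faa_L C Q)) (mobj (Faa_L C R))"
    by (simp add: mobj_Faa_L faa_prod_def mobj_prod_cmon)
  show ?thesis
  proof (rule Faa_eqI'[OF delta1_Hom'[OF fg, unfolded cod] Faa_homs(2)[OF Df Dg]])
    fix W S and c :: "nat set \<Rightarrow> 'm"
    assume c: "c \<in> jets C W (faa_prod C (mobj (Faa_L C P)) P) S" and S: "finite S"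
    obtain z where z: "z \<notin> S"
      using ex_new_if_finite[OF infinite_UNIV_nat S] by blast
    have "finite (insert z S)"
      using S by simp
    then show "jet_map C (delta1 C \<langle>f, g\<rangle>\<^bsub>Faa C\<^esub>) c S = jet_map C \<langle>delta1 C f, delta1 C g\<rangle>\<^bsub>Faa C\<^esub> c S"
      unfolding jet_map_pair[OF Df Dg S c] jet_map_delta1'[OF fg S z c] jet_map_delta1'[OF f S z c]
        jet_map_delta1'[OF g S z c]
      by (rule jet_map_pair[OF f g _ prolong_jets'[OF P z c]])
  qed
qed

text \<open>The direction enters precisely the coefficients at sets containing \<open>z\<close>, so
  additivity in the direction is \<open>jet_map_plus\<close> at the index \<open>z\<close>.\<close>

lemma delta1_plus:
  assumes f: "f \<in> Hom (Faa C) P Q" and a: "a \<in> Hom (Faa C) R (mobj (Faa_L C P))"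
    and b: "b \<in> Hom (Faa C) R (mobj (Faa_L C P))" and c: "c \<in> Hom (Faa C) R P"
  shows "faa_comp C \<langle>plus_map (Faa C) (Faa_L C P) a b, c\<rangle>\<^bsub>Faa C\<^esub> (delta1 C f)
    = plus_map (Faa C) (Faa_L C Q) (faa_comp C \<langle>a, c\<rangle>\<^bsub>Faa C\<^esub> (delta1 C f)) (faa_comp C \<langle>b, c\<rangle>\<^bsub>Faa C\<^esub> (delta1 C f))"
proof -
  note P = Faa_Hom_Obj(1)[OF f] and Q = Faa_Hom_Obj(2)[OF f]
  note Df = delta1_Hom'[OF f] and ab = plus_Faa_Hom[OF P a b]
  note pr = Faa_homs(2)[OF a c] Faa_homs(2)[OF b c] Faa_homs(2)[OF ab c]
  note cm = Faa_homs(1)[OF pr(1) Df] Faa_homs(1)[OF pr(2) Df] Faa_homs(1)[OF pr(3) Df]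
  show ?thesis
  proof (rule Faa_eqI'[OF cm(3) plus_Faa_Hom[OF Q cm(1,2)]])
    fix W S and d :: "nat set \<Rightarrow> 'm" assume d: "d \<in> jets C W R S" and S: "finite S"
    obtain z where z: "z \<notin> S"
      using ex_new_if_finite[OF infinite_UNIV_nat S] by blast
    have dT: "d \<in> jets C W R T" "finite T" if "T \<subseteq> S" for T
      using jets_mono[OF d that] finite_subset[OF that S] by auto
    note at = jet_map_at[OF _ dT, where Q = "mobj (Faa_L C P)", unfolded jobj_Faa_L]
    note atc = jet_map_at[OF c dT]
    have e: "jet_map C (faa_comp C \<langle>u, c\<rangle>\<^bsub>Faa C\<^esub> (delta1 C f)) d S
        = jet_map C f (\<lambda>T. if z \<in> T then jet_map C u d (T - {z}) else jet_map C c d T) (insert z S)"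
      if u: "u \<in> Hom (Faa C) R (mobj (Faa_L C P))" for u
      unfolding jet_map_comp'[OF Faa_homs(2)[OF u c] Df S d]
      by (rule jet_map_delta1_pair[OF f S z jet_map_pair[OF u c dT(2,1)] at[OF u] atc])
    have j: "(\<lambda>T. if z \<in> T then jet_map C u d (T - {z}) else jet_map C c d T) \<in> jets C W (fst P, snd P) (insert z S)"
      if u: "u \<in> Hom (Faa C) R (mobj (Faa_L C P))" for u
      using jets_shift[OF at[OF u] atc] by simp
    have f': "f \<in> Hom (Faa C) (fst P, snd P) (fst Q, snd Q)"
      using f by simp
    show "jet_map C (faa_comp C \<langle>plus_map (Faa C) (Faa_L C P) a b, c\<rangle>\<^bsub>Faa C\<^esub> (delta1 C f)) d S
      = jet_map C (plus_map (Faa C) (Faa_L C Q) (faa_comp C \<langle>a, c\<rangle>\<^bsub>Faa C\<^esub> (delta1 C f))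
          (faa_comp C \<langle>b, c\<rangle>\<^bsub>Faa C\<^esub> (delta1 C f))) d S"
      unfolding jet_map_plus_Faa[OF Q cm(1,2) S d] e[OF a] e[OF b] e[OF ab]
    proof (rule jet_map_plus[OF f' _ insertI1 j[OF ab] j[OF a] j[OF b]])
      fix T assume "T \<subseteq> insert z S" "z \<in> T"
      then have "T - {z} \<subseteq> S"
        by auto
      then show "(if z \<in> T then jet_map C (plus_map (Faa C) (Faa_L C P) a b) d (T - {z}) else jet_map C c d T)
        = plus_map C (fst P) (if z \<in> T then jet_map C a d (T - {z}) else jet_map C c d T)
          (if z \<in> T then jet_map C b d (T - {z}) else jet_map C c d T)"
        using jet_map_plus_Faa[OF P a b dT(2,1)] \<open>z \<in> T\<close> by simp
    qed (use S in simp_all)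
  qed
qed

lemma delta1_zero:
  assumes f: "f \<in> Hom (Faa C) P Q" and a: "a \<in> Hom (Faa C) R P"
  shows "faa_comp C \<langle>zero_map (Faa C) (Faa_L C P) R, a\<rangle>\<^bsub>Faa C\<^esub> (delta1 C f) = zero_map (Faa C) (Faa_L C Q) R"
proof -
  note P = Faa_Hom_Obj(1)[OF f] and Q = Faa_Hom_Obj(2)[OF f] and R = Faa_Hom_Obj(1)[OF a]
  note Df = delta1_Hom'[OF f] and z0 = zero_Faa_Hom[OF P R]
  note pr = Faa_homs(2)[OF z0 a]
  show ?thesis
  proof (rule Faa_eqI'[OF Faa_homs(1)[OF pr Df] zero_Faa_Hom[OF Q R]])
    fix W S and d :: "nat set \<Rightarrow> 'm" assume d: "d \<in> jets C W R S" and S: "finite S"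
    obtain z where z: "z \<notin> S"
      using ex_new_if_finite[OF infinite_UNIV_nat S] by blast
    have dT: "d \<in> jets C W R T" "finite T" if "T \<subseteq> S" for T
      using jets_mono[OF d that] finite_subset[OF that S] by auto
    note at = jet_map_at[OF z0 dT, unfolded jobj_Faa_L] and ata = jet_map_at[OF a dT]
    have f': "f \<in> Hom (Faa C) (fst P, snd P) (fst Q, snd Q)"
      using f by simp
    let ?e = "\<lambda>T. if z \<in> T then jet_map C (zero_map (Faa C) (Faa_L C P) R) d (T - {z}) else jet_map C a d T"
    have ej: "?e \<in> jets C W (fst P, snd P) (insert z S)"
      using jets_shift[OF at ata] by simp
    have "jet_map C f ?e (insert z S) = zero_map C (fst Q) W"
    proof (rule jet_map_zero[OF f' _ insertI1 ej])
      fix T assume "T \<subseteq> insert z S" "z \<in> T"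
      then have "T - {z} \<subseteq> S"
        by auto
      then show "?e T = zero_map C (fst P) W"
        using jet_map_zero_Faa[OF P R dT(2,1)] \<open>z \<in> T\<close> by simp
    qed (use S in simp)
    moreover have "jet_map C (delta1 C f) (jet_map C \<langle>zero_map (Faa C) (Faa_L C P) R, a\<rangle>\<^bsub>Faa C\<^esub> d) S
        = jet_map C f ?e (insert z S)"
      by (rule jet_map_delta1_pair[OF f S z jet_map_pair[OF z0 a dT(2,1)] at ata])
    ultimately show "jet_map C (faa_comp C \<langle>zero_map (Faa C) (Faa_L C P) R, a\<rangle>\<^bsub>Faa C\<^esub> (delta1 C f)) d S
        = jet_map C (zero_map (Faa C) (Faa_L C Q) R) d S"
      unfolding jet_map_comp'[OF pr Df S d] jet_map_zero_Faa[OF Q R S d] by simp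
  qed
qed

text \<open>The computation shared by [CD.6] and [CD.7]: the second-order point of
  \<open>jet_map_delta1_delta1\<close>, with coefficients obtained by letting the four maps act on a
  jet \<open>e\<close>.\<close>

lemma jet_map_second_differential:
  assumes f: "f \<in> Hom (Faa C) P Q" and a: "a \<in> Hom (Faa C) R (mobj (Faa_L C P))"
    and b: "b \<in> Hom (Faa C) R (mobj (Faa_L C P))" and c: "c \<in> Hom (Faa C) R (mobj (Faa_L C P))"
    and d: "d \<in> Hom (Faa C) R P"
    and S: "finite S" "z \<notin> S" "y \<notin> S" "y \<noteq> z" and e: "e \<in> jets C W R S"
  defines "E \<equiv> \<lambda>T. if y \<in> T then if z \<in> T then jet_map C a e (T - {y} - {z}) else jet_map C c e (T - {y})
      else if z \<in> T then jet_map C b e (T - {z}) else jet_map C d e T"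
  shows "jet_map C (faa_comp C \<langle>\<langle>a, b\<rangle>\<^bsub>Faa C\<^esub>, \<langle>c, d\<rangle>\<^bsub>Faa C\<^esub>\<rangle>\<^bsub>Faa C\<^esub> (delta1 C (delta1 C f))) e S
      = jet_map C f E (insert y (insert z S))"
    and "E \<in> jets C W P (insert y (insert z S))"
proof -
  note P = Faa_Hom_Obj(1)[OF f]
  have eT: "e \<in> jets C W R T" "finite T" if "T \<subseteq> S" for T
    using jets_mono[OF e that] finite_subset[OF that S(1)] by auto
  note at = jet_map_at[OF _ eT, where Q = "mobj (Faa_L C P)", unfolded jobj_Faa_L]
  note ab = Faa_homs(2)[OF a b] and cd = Faa_homs(2)[OF c d]
  note abcd = Faa_homs(2)[OF ab cd]
  have L: "mobj (Faa_L C (faa_prod C (mobj (Faa_L C P)) P)) = faa_prod C (mobj (Faa_L C P)) (mobj (Faa_L C P))"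
    by (simp add: mobj_Faa_L faa_prod_def mobj_prod_cmon)
  note DDf = delta1_Hom'[OF delta1_Hom'[OF f], unfolded L]
  have x: "jet_map C \<langle>\<langle>a, b\<rangle>\<^bsub>Faa C\<^esub>, \<langle>c, d\<rangle>\<^bsub>Faa C\<^esub>\<rangle>\<^bsub>Faa C\<^esub> e T
      = \<langle>\<langle>jet_map C a e T, jet_map C b e T\<rangle>, \<langle>jet_map C c e T, jet_map C d e T\<rangle>\<rangle>" if "T \<subseteq> S" for T
    unfolding jet_map_pair[OF ab cd eT(2,1)[OF that]] jet_map_pair[OF a b eT(2,1)[OF that]]
      jet_map_pair[OF c d eT(2,1)[OF that]] ..
  note dd = jet_map_delta1_delta1[OF f S x at[OF a] at[OF b] at[OF c] jet_map_at[OF d eT]]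
  show "jet_map C (faa_comp C \<langle>\<langle>a, b\<rangle>\<^bsub>Faa C\<^esub>, \<langle>c, d\<rangle>\<^bsub>Faa C\<^esub>\<rangle>\<^bsub>Faa C\<^esub> (delta1 C (delta1 C f))) e S
      = jet_map C f E (insert y (insert z S))"
    unfolding jet_map_comp'[OF abcd DDf S(1) e] E_def by (rule dd(1))
  show "E \<in> jets C W P (insert y (insert z S))"
    unfolding E_def by (rule dd(2))
qed

lemma second_differential_Hom:
  assumes f: "f \<in> Hom (Faa C) P Q" and a: "a \<in> Hom (Faa C) R (mobj (Faa_L C P))"
    and b: "b \<in> Hom (Faa C) R (mobj (Faa_L C P))" and c: "c \<in> Hom (Faa C) R (mobj (Faa_L C P))"
    and d: "d \<in> Hom (Faa C) R P"
  shows "faa_comp C \<langle>\<langle>a, b\<rangle>\<^bsub>Faa C\<^esub>, \<langle>c, d\<rangle>\<^bsub>Faa C\<^esub>\<rangle>\<^bsub>Faa C\<^esub> (delta1 C (delta1 C f)) \<in> Hom (Faa C) R (mobj (Faa_L C Q))"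
proof -
  have L: "mobj (Faa_L C (faa_prod C (mobj (Faa_L C P)) P)) = faa_prod C (mobj (Faa_L C P)) (mobj (Faa_L C P))"
    "mobj (Faa_L C (mobj (Faa_L C Q))) = mobj (Faa_L C Q)"
    by (simp_all add: mobj_Faa_L faa_prod_def mobj_prod_cmon)
  show ?thesis
    using Faa_homs(1)[OF Faa_homs(2)[OF Faa_homs(2)[OF a b] Faa_homs(2)[OF c d]]
      delta1_Hom'[OF delta1_Hom'[OF f], unfolded L]] .
qed

lemma delta1_delta1_linear:
  assumes f: "f \<in> Hom (Faa C) P Q" and a: "a \<in> Hom (Faa C) R (mobj (Faa_L C P))"
    and c: "c \<in> Hom (Faa C) R (mobj (Faa_L C P))" and d: "d \<in> Hom (Faa C) R P"
  shows "faa_comp C \<langle>\<langle>a, zero_map (Faa C) (Faa_L C P) R\<rangle>\<^bsub>Faa C\<^esub>, \<langle>c, d\<rangle>\<^bsub>Faa C\<^esub>\<rangle>\<^bsub>Faa C\<^esub> (delta1 C (delta1 C f))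
    = faa_comp C \<langle>a, d\<rangle>\<^bsub>Faa C\<^esub> (delta1 C f)"
proof -
  note P = Faa_Hom_Obj(1)[OF f] and R = Faa_Hom_Obj(1)[OF d]
  note z0 = zero_Faa_Hom[OF P R] and Df = delta1_Hom'[OF f] and ad = Faa_homs(2)[OF a d]
  show ?thesis
  proof (rule Faa_eqI'[OF second_differential_Hom[OF f a z0 c d] Faa_homs(1)[OF ad Df]])
    fix W S and e :: "nat set \<Rightarrow> 'm" assume e: "e \<in> jets C W R S" and S: "finite S"
    obtain z where z: "z \<notin> S"
      using ex_new_if_finite[OF infinite_UNIV_nat S] by blast
    obtain y where y: "y \<notin> insert z S"
      using ex_new_if_finite[OF infinite_UNIV_nat, of "insert z S"] S by blast
    then have y': "y \<notin> S" "y \<noteq> z"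
      by auto
    have eT: "e \<in> jets C W R T" "finite T" if "T \<subseteq> S" for T
      using jets_mono[OF e that] finite_subset[OF that S] by auto
    note at = jet_map_at[OF _ eT, where Q = "mobj (Faa_L C P)", unfolded jobj_Faa_L] and atd = jet_map_at[OF d eT]
    note dd = jet_map_second_differential[OF f a z0 c d S z y' e]
    \<comment> \<open>Formally \<open>d + \<epsilon>\<^sub>y a\<close>, the jet that computes the
      right side. On the left, \<open>b = 0\<close> leaves \<open>d + \<epsilon>\<^sub>y c +
      \<epsilon>\<^sub>y \<epsilon>\<^sub>z a\<close>, and \<open>jet_map_contract\<close> removes
      \<open>z\<close>.\<close>
    let ?G = "\<lambda>T. if y \<in> T then jet_map C a e (T - {y}) else jet_map C d e T"
    have G: "?G \<in> jets C W P (insert y S)"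
      by (rule jets_shift[OF at[OF a] atd])
    have sub: "T - {y} \<subseteq> S" "y \<notin> T \<Longrightarrow> T \<subseteq> S" "z \<notin> T" "z \<notin> T - {y}" if "T \<subseteq> insert y S" for T
      using that z y' by auto
    have r: "jet_map C (delta1 C f) (jet_map C \<langle>a, d\<rangle>\<^bsub>Faa C\<^esub> e) S = jet_map C f ?G (insert y S)"
      by (rule jet_map_delta1_pair[OF f S y'(1) jet_map_pair[OF a d eT(2,1)] at[OF a] atd])
    show "jet_map C (faa_comp C \<langle>\<langle>a, zero_map (Faa C) (Faa_L C P) R\<rangle>\<^bsub>Faa C\<^esub>, \<langle>c, d\<rangle>\<^bsub>Faa C\<^esub>\<rangle>\<^bsub>Faa C\<^esub> (delta1 C (delta1 C f))) e S
        = jet_map C (faa_comp C \<langle>a, d\<rangle>\<^bsub>Faa C\<^esub> (delta1 C f)) e S"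
      unfolding dd(1) jet_map_comp'[OF ad Df S e] r insert_commute[of y z]
    proof (rule jet_map_contract[OF f _ insertI1 _ dd(2)[unfolded insert_commute[of y z]] G])
      show "z \<notin> insert y S" "finite (insert y S)"
        using z y' S by auto
      fix T assume T: "T \<subseteq> insert y S"
      have i: "insert z T - {y} - {z} = T - {y}" "insert z T - {z} = T"
        using sub[OF T] by auto
      show "(if y \<in> insert z T then if z \<in> insert z T then jet_map C a e (insert z T - {y} - {z}) else jet_map C c e (insert z T - {y})
          else if z \<in> insert z T then jet_map C (zero_map (Faa C) (Faa_L C P) R) e (insert z T - {z})
          else jet_map C d e (insert z T)) = zero_map C (fst P) W" if "y \<notin> T"
        using that y' i jet_map_zero_Faa[OF P R eT(2,1)[OF sub(2)[OF T that]]] by simp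
      show "(if y \<in> insert z T then if z \<in> insert z T then jet_map C a e (insert z T - {y} - {z}) else jet_map C c e (insert z T - {y})
          else if z \<in> insert z T then jet_map C (zero_map (Faa C) (Faa_L C P) R) e (insert z T - {z})
          else jet_map C d e (insert z T)) = ?G T" if "y \<in> T"
        using that i by simp
      show "(if y \<in> T then if z \<in> T then jet_map C a e (T - {y} - {z}) else jet_map C c e (T - {y})
          else if z \<in> T then jet_map C (zero_map (Faa C) (Faa_L C P) R) e (T - {z}) else jet_map C d e T) = ?G T" if "y \<notin> T"
        using that sub(3)[OF T] by simp
    qed
  qed
qed

lemma delta1_delta1_symmetric:
  assumes f: "f \<in> Hom (Faa C) P Q" and b: "b \<in> Hom (Faa C) R (mobj (Faa_L C P))"
    and c: "c \<in> Hom (Faa C) R (mobj (Faa_L C P))" and d: "d \<in> Hom (Faa C) R P"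
  shows "faa_comp C \<langle>\<langle>zero_map (Faa C) (Faa_L C P) R, b\<rangle>\<^bsub>Faa C\<^esub>, \<langle>c, d\<rangle>\<^bsub>Faa C\<^esub>\<rangle>\<^bsub>Faa C\<^esub> (delta1 C (delta1 C f))
    = faa_comp C \<langle>\<langle>zero_map (Faa C) (Faa_L C P) R, c\<rangle>\<^bsub>Faa C\<^esub>, \<langle>b, d\<rangle>\<^bsub>Faa C\<^esub>\<rangle>\<^bsub>Faa C\<^esub> (delta1 C (delta1 C f))"
proof -
  note P = Faa_Hom_Obj(1)[OF f] and R = Faa_Hom_Obj(1)[OF d]
  note z0 = zero_Faa_Hom[OF P R]
  show ?thesis
  proof (rule Faa_eqI'[OF second_differential_Hom[OF f z0 b c d] second_differential_Hom[OF f z0 c b d]])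
    fix W S and e :: "nat set \<Rightarrow> 'm" assume e: "e \<in> jets C W R S" and S: "finite S"
    obtain z where z: "z \<notin> S"
      using ex_new_if_finite[OF infinite_UNIV_nat S] by blast
    obtain y where y: "y \<notin> insert z S"
      using ex_new_if_finite[OF infinite_UNIV_nat, of "insert z S"] S by blast
    then have y': "y \<notin> S" "y \<noteq> z" "z \<noteq> y"
      by auto
    note 1 = jet_map_second_differential[OF f z0 b c d S z y'(1,2) e]
    \<comment> \<open>Here the outer differential introduces \<open>y\<close> and the inner one
      \<open>z\<close>, the reverse of the first computation; so the exchange of \<open>b\<close>
      and \<open>c\<close> produces the same jet over the same indices.\<close>
    note 2 = jet_map_second_differential(1)[OF f z0 c b d S y'(1) z y'(3) e]
    show "jet_map C (faa_comp C \<langle>\<langle>zero_map (Faa C) (Faa_L C P) R, b\<rangle>\<^bsub>Faa C\<^esub>, \<langle>c, d\<rangle>\<^bsub>Faa C\<^esub>\<rangle>\<^bsub>Faa C\<^esub> (delta1 C (delta1 C f))) e S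
      = jet_map C (faa_comp C \<langle>\<langle>zero_map (Faa C) (Faa_L C P) R, c\<rangle>\<^bsub>Faa C\<^esub>, \<langle>b, d\<rangle>\<^bsub>Faa C\<^esub>\<rangle>\<^bsub>Faa C\<^esub> (delta1 C (delta1 C f))) e S"
      unfolding 1(1) 2 insert_commute[of z y]
    proof (rule jet_map_cong'[OF f 1(2), symmetric])
      fix T assume "T \<subseteq> insert y (insert z S)"
      have "T - {z} - {y} = T - {y} - {z}"
        by auto
      then show "(if z \<in> T then if y \<in> T then jet_map C (zero_map (Faa C) (Faa_L C P) R) e (T - {z} - {y}) else jet_map C b e (T - {z})
            else if y \<in> T then jet_map C c e (T - {y}) else jet_map C d e T)
          = (if y \<in> T then if z \<in> T then jet_map C (zero_map (Faa C) (Faa_L C P) R) e (T - {y} - {z}) else jet_map C c e (T - {y})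
            else if z \<in> T then jet_map C b e (T - {z}) else jet_map C d e T)"
        by simp
    qed (use S in simp)
  qed
qed

lemma Faa_differential: "generalized_cartesian_differential_category (Faa C) (Faa_L C) (delta1 C)"
proof (intro generalized_cartesian_differential_category.intro cartesian_Faa
    generalized_cartesian_differential_category_axioms.intro, unfold Faa_simps(2-9))
  fix P assume P: "P \<in> Obj (Faa C)"
  let ?LP = "mobj (Faa_L C P)"
  note LP = Faa_L_Obj[OF P] and LL = faa_prod_Obj[OF Faa_L_Obj[OF P] Faa_L_Obj[OF P]]
  show "comm_monoid_in (Faa C) (Faa_L C P)"
    by (rule Faa_L_comm_monoid[OF P])
  \<comment> \<open>The construction \<open>Faa_L\<close> depends on the monoid component alone, and
    the carrier \<open>(M, A)\<close> keeps that component.\<close>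
  show idem: "Faa_L C ?LP = Faa_L C P"
    by (simp add: mobj_Faa_L) (simp add: Faa_L_def)
  have L2: "mobj (Faa_L C (faa_prod C ?LP ?LP)) = faa_prod C ?LP ?LP"
    by (simp add: mobj_Faa_L faa_prod_def mobj_prod_cmon)
  have f1: "fst ?LP = fst P"
    by (simp add: mobj_Faa_L)
  have f2: "mobj (fst (faa_prod C ?LP ?LP)) = mobj (fst P) \<star> mobj (fst P)"
    by (simp add: mobj_Faa_L faa_prod_def mobj_prod_cmon)
  \<comment> \<open>The source and target of the addition are their own tangent objects, so the same
    map serves as \<open>f\<close> and as \<open>h\<close> in \<open>delta1_linear\<close>; the zero
    is treated alike.\<close>
  show "delta1 C (madd (Faa_L C P)) = faa_comp C (faa_proj0 C (faa_prod C ?LP ?LP) (faa_prod C ?LP ?LP)) (madd (Faa_L C P))"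
    by (rule delta1_linear[OF madd_Faa_L_Hom[OF P], of "madd (fst P)" "madd (Faa_L C P)", unfolded L2 idem f2 f1,
          OF madd_Hom[OF fst_cmon[OF P]] madd_Faa_L_Hom[OF P] jet_map_madd[OF P] jet_map_madd[OF P]])
  have L1: "mobj (Faa_L C (one_cmon C, One C)) = (one_cmon C, One C)"
    using Faa_L_One by (simp add: one_cmon_def[of "Faa C"])
  have O: "mobj (one_cmon C) = One C"
    by (simp add: one_cmon_def)
  show "delta1 C (mzero (Faa_L C P)) = faa_comp C (faa_proj0 C (one_cmon C, One C) (one_cmon C, One C)) (mzero (Faa_L C P))"
    by (rule delta1_linear[OF mzero_Faa_L_Hom[OF P, unfolded Faa_simps], of "mzero (fst P)" "mzero (Faa_L C P)",
          unfolded L1 idem f1 fst_conv O, OF mzero_Hom[OF fst_cmon[OF P]]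
          mzero_Faa_L_Hom[OF P, unfolded Faa_simps] jet_map_mzero[OF P, unfolded Faa_simps]
          jet_map_mzero[OF P, unfolded Faa_simps]])
  fix Q assume Q: "Q \<in> Obj (Faa C)"
  let ?LQ = "mobj (Faa_L C Q)"
  show "Faa_L C (faa_prod C P Q) = prod_cmon (Faa C) (Faa_L C P) (Faa_L C Q)"
    by (rule Faa_L_prod[OF P Q])
  have LPQ: "mobj (Faa_L C (faa_prod C P Q)) = faa_prod C ?LP ?LQ"
    by (simp add: mobj_Faa_L faa_prod_def mobj_prod_cmon)
  have fPQ: "mobj (fst (faa_prod C P Q)) = mobj (fst P) \<star> mobj (fst Q)"
    by (simp add: faa_prod_def mobj_prod_cmon)
  note A = comm_monoid_in_Obj[OF fst_cmon[OF P]] comm_monoid_in_Obj[OF fst_cmon[OF Q]]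
  note LQ = Faa_L_Obj[OF Q]
  show "delta1 C (faa_proj0 C P Q) = faa_comp C (faa_proj0 C (mobj (Faa_L C (faa_prod C P Q))) (faa_prod C P Q)) (faa_proj0 C ?LP ?LQ)"
    by (rule delta1_linear[OF faa_proj_Hom(1)[OF P Q], of "Proj0 C (mobj (fst P)) (mobj (fst Q))"])
      (simp_all add: LPQ fPQ Proj0_Hom[OF A] faa_proj_Hom[OF LP LQ] jet_map_proj[OF P Q] jet_map_proj[OF LP LQ] jobj_Faa_L)
  show "delta1 C (faa_proj1 C P Q) = faa_comp C (faa_proj0 C (mobj (Faa_L C (faa_prod C P Q))) (faa_prod C P Q)) (faa_proj1 C ?LP ?LQ)"
    by (rule delta1_linear[OF faa_proj_Hom(2)[OF P Q], of "Proj1 C (mobj (fst P)) (mobj (fst Q))"])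
      (simp_all add: LPQ fPQ Proj1_Hom[OF A] faa_proj_Hom[OF LP LQ] jet_map_proj[OF P Q] jet_map_proj[OF LP LQ] jobj_Faa_L)
next
  show "Faa_L C (one_cmon C, One C) = one_cmon (Faa C)"
    using Faa_L_One by simp
  fix f P Q assume f: "f \<in> Hom (Faa C) P Q"
  show "delta1 C f \<in> Hom (Faa C) (faa_prod C (mobj (Faa_L C P)) P) (mobj (Faa_L C Q))"
    by (rule delta1_Hom'[OF f])
  show "delta1 C (faa_comp C f g) = faa_comp C \<langle>delta1 C f, faa_comp C (faa_proj1 C (mobj (Faa_L C P)) P) f\<rangle>\<^bsub>Faa C\<^esub> (delta1 C g)"
    if "g \<in> Hom (Faa C) Q R" for g R
    by (rule delta1_comp[OF f that])
  show "delta1 C \<langle>f, g\<rangle>\<^bsub>Faa C\<^esub> = \<langle>delta1 C f, delta1 C g\<rangle>\<^bsub>Faa C\<^esub>" if "g \<in> Hom (Faa C) P R" for g R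
    by (rule delta1_pair[OF f that])
qed (rule delta1_plus delta1_zero delta1_delta1_linear delta1_delta1_symmetric; assumption)+

end

theorem corollary2p13:
  fixes X :: "('o, 'm) cart"
  assumes "cartesian_category X"
  shows "generalized_cartesian_differential_category (Faa X) (Faa_L X) (delta1 X)"
proof -
  interpret cartesian_category X
    by (rule assms)
  show ?thesis
    by (rule Faa_differential)
qed

end
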